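(* Let $A_1$ and $A_2$ be two dilations on $\mathbb{R}^n$. The following are equivalent: (i) the quasi-norms $\rho_1$ and $\rho_2$ associated to $A_1$ and $A_2$, respectively, are equivalent up to a linear transformation, i.e. there are a constant $c>0$ and an invertible real $n\times n$ matrix $S$ such that $$\frac1c\,\rho_1(x)\le\rho_2(Sx)\le c\,\rho_1(x)\qquad\text{for all }x\in\mathbb{R}^n;$$ (ii) for all $r>1$ and $m=1,2,\ldots$ we have $$\sum_{|\lambda|=r^{\varepsilon}}\dim\ker(A_1-\lambda\mathbf{I})^m=\sum_{|\lambda|=r}\dim\ker(A_2-\lambda\mathbf{I})^m,\qquad\text{where }\varepsilon=\frac{\ln|\det A_1|}{\ln|\det A_2|}.$$
   Context: A dilation is a real $n\times n$ matrix $A$ all of whose complex eigenvalues satisfy $|\lambda|>1$. A quasi-norm associated with $A$ is a measurable map $\rho_A:\mathbb{R}^n\to[0,\infty)$ such that $\rho_A(x)=0$ iff $x=0$; $\rho_A(Ax)=|\det A|\,\rho_A(x)$ for all $x$; and $\rho_A(x+y)\le c(\rho_A(x)+\rho_A(y))$ for all $x,y$ and some constant $c>0$. Such quasi-norms exist, and any two associated with the same $A$ are comparable up to multiplicative constants. In (ii), $A_1$ and $A_2$ are treated as linear maps on $\mathbb{C}^n$, $\lambda$ ranges over the complex eigenvalues of the given modulus, and dimensions are over $\mathbb{C}$. *)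

theory Defs
  imports "HOL-Analysis.Analysis"
begin

definition complexify :: "real^'n^'n \<Rightarrow> complex^'n^'n"
  where "complexify A = map_matrix complex_of_real A"

definition complex_eigenvalue :: "real^'n^'n \<Rightarrow> complex \<Rightarrow> bool"
  where "complex_eigenvalue A \<mu> \<longleftrightarrow> (\<exists>v. v \<noteq> 0 \<and> complexify A *v v = \<mu> *s v)"

definition dilation :: "real^'n^'n \<Rightarrow> bool"
  where "dilation A \<longleftrightarrow> (\<forall>\<mu>. complex_eigenvalue A \<mu> \<longrightarrow> cmod \<mu> > 1)"

(* Measurability is with respect to the Lebesgue sigma-algebra on the domain, so in particular
   every Borel measurable quasi-norm is included. *)
definition quasi_norm :: "real^'n^'n \<Rightarrow> (real^'n \<Rightarrow> real) \<Rightarrow> bool"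
  where "quasi_norm A \<rho> \<longleftrightarrow>
    \<rho> \<in> borel_measurable lebesgue \<and>
    (\<forall>x. \<rho> x \<ge> 0) \<and>
    (\<forall>x. \<rho> x = 0 \<longleftrightarrow> x = 0) \<and>
    (\<forall>x. \<rho> (A *v x) = \<bar>det A\<bar> * \<rho> x) \<and>
    (\<exists>c>0. \<forall>x y. \<rho> (x + y) \<le> c * (\<rho> x + \<rho> y))"

definition equivalent_up_to_linear :: "(real^'n \<Rightarrow> real) \<Rightarrow> (real^'n \<Rightarrow> real) \<Rightarrow> bool"
  where "equivalent_up_to_linear \<rho>\<^sub>1 \<rho>\<^sub>2 \<longleftrightarrow>
    (\<exists>c>0. \<exists>S :: real^'n^'n. invertible S \<and>
      (\<forall>x. (1 / c) * \<rho>\<^sub>1 x \<le> \<rho>\<^sub>2 (S *v x) \<and> \<rho>\<^sub>2 (S *v x) \<le> c * \<rho>\<^sub>1 x))"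

(* The operator (^) on vectors of vectors is the entrywise power, not the matrix power. *)
primrec matrix_power :: "'a::semiring_1^'n^'n \<Rightarrow> nat \<Rightarrow> 'a^'n^'n"
  where
    "matrix_power A 0 = mat 1"
  | "matrix_power A (Suc m) = A ** matrix_power A m"

(* vec.dim is the dimension over the scalar field of the entries, here the complex numbers,
   whereas dim would be the dimension over the reals. *)
definition dim_ker_power :: "real^'n^'n \<Rightarrow> complex \<Rightarrow> nat \<Rightarrow> nat"
  where "dim_ker_power A \<mu> m =
    vec.dim {v. matrix_power (complexify A - mat \<mu>) m *v v = 0}"

(* Only eigenvalues contribute, and restricting to them is essential: the circle of radius r is
   infinite, and a sum over an infinite set is 0 by convention. *)
definition sum_dim_ker :: "real^'n^'n \<Rightarrow> real \<Rightarrow> nat \<Rightarrow> nat"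
  where "sum_dim_ker A r m =
    (\<Sum>\<mu> | complex_eigenvalue A \<mu> \<and> cmod \<mu> = r. dim_ker_power A \<mu> m)"

end

theory Submission
  imports Defs
    "HOL-Computational_Algebra.Fundamental_Theorem_Algebra"
begin

text \<open>With \<open>j = \<lfloor>\<epsilon> k\<rfloor>\<close>, the quasi-norms are equivalent up to \<open>S\<close> iff \<open>|A\<^sub>1\<^sup>k x|\<close> and \<open>|A\<^sub>2\<^sup>j S x|\<close> are
  comparable uniformly in \<open>x\<close> and in \<open>k\<close> over all integers, because a quasi-norm is of order one exactly
  where the Euclidean norm is, and \<open>|det A\<^sub>1|\<^sup>k\<close> and \<open>|det A\<^sub>2|\<^sup>j\<close> are comparable.

  The vectors with \<open>|A\<^sup>k x| = O(r\<^sup>k (1 + |k|)\<^sup>d)\<close> over all integers \<open>k\<close> form the direct sum of the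
  kernels of \<open>(A - \<lambda>)\<^sup>d\<^sup>+\<^sup>1\<close> with \<open>|\<lambda>| = r\<close>. Comparability of the orbits identifies these growth spaces of
  \<open>A\<^sub>1\<close> and \<open>A\<^sub>2\<close>, which gives the equality of dimensions.

  Conversely, multiplying \<open>A\<close> on each generalized eigenspace by a unimodular scalar and taking a real
  power there by the binomial series yields a matrix \<open>|A|\<^sup>t\<close> with positive eigenvalues whose \<open>k\<close>-th power
  is uniformly comparable with \<open>A\<close> to the power \<open>\<lfloor>t k\<rfloor>\<close>. Equality of the dimensions makes \<open>|A\<^sub>1|\<close> and
  \<open>|A\<^sub>2|\<^sup>\<epsilon>\<close> similar over the complex numbers. The resulting one-sided orbit estimate is linear in \<open>S\<close>, so it
  passes to real and imaginary parts and hence to an invertible real combination of them. The reverse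
  estimate follows by Cramer's rule, since the determinants of \<open>A\<^sub>2\<^sup>j S A\<^sub>1\<^sup>-\<^sup>k\<close> are bounded away from zero.\<close>

section \<open>Gluing linear maps and similarity of nilpotent maps\<close>

text \<open>Both signs of \<open>k\<close> matter. For positive \<open>k\<close> alone the growth
  bound would admit every eigenvalue of modulus at most \<open>r\<close>; negative \<open>k\<close>
  excludes the smaller ones, and the polynomial factor then measures which power of
  \<open>A - \<lambda>\<close> kills a vector. Arguments of eigenvalues leave no trace in norms, so
  only sums over circles can appear in (ii).

  A two-sided orbit estimate need not survive the passage to real and imaginary parts: the upper
  bound does, the lower bound may fail. So the converse transports the upper bound only, and the
  choice of \<epsilon> pays a second time: it balances \<open>|det A\<^sub>1|^k\<close> against
  \<open>|det A\<^sub>2|^j\<close> and keeps the determinant of the comparison matrix away from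
  zero.

  On generalized eigenspaces the binomial series is a finite sum, so the group law of real powers is
  the Vandermonde identity and growth in \<open>t\<close> is polynomial. Quasi-norms are only
  measurable, with neither continuity nor homogeneity under scalars; Euclidean estimates for them go
  through powers of \<open>A\<close> and a local boundedness obtained from measure.\<close>

abbreviation lin :: "('a::field^'n \<Rightarrow> 'a^'m) \<Rightarrow> bool"
  where "lin \<equiv> Vector_Spaces.linear (*s) (*s)"

lemma linI:
  assumes "\<And>x y. f (x + y) = f x + f y" and "\<And>c x. f (c *s x) = c *s f x"
  shows "lin f"
  using assms by (simp add: Vector_Spaces.linear_iff vec.vector_space_axioms)

lemma lin_add: "lin f \<Longrightarrow> f (x + y) = f x + f y"
  and lin_scale: "lin f \<Longrightarrow> f (c *s x) = c *s f x"
  by (simp_all add: Vector_Spaces.linear_iff)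

lemma lin_0: "lin f \<Longrightarrow> f 0 = 0"
  using lin_scale[of f 0 0] by simp

lemma lin_diff: "lin f \<Longrightarrow> f (x - y) = f x - f y"
  using lin_add[of f "x - y" y] by simp

lemma lin_sum: "lin f \<Longrightarrow> f (\<Sum>i\<in>I. y i) = (\<Sum>i\<in>I. f (y i))"
  by (induction I rule: infinite_finite_induct) (simp_all add: lin_0 lin_add)

lemma lin_compose: "lin f \<Longrightarrow> lin g \<Longrightarrow> lin (\<lambda>x. f (g x))"
  by (rule linI) (simp_all add: lin_add lin_scale)

lemma lin_plus: "lin f \<Longrightarrow> lin g \<Longrightarrow> lin (\<lambda>x. f x + g x)"
  by (rule linI) (simp_all add: lin_add lin_scale vec.scale_right_distrib)

lemma lin_minus: "lin f \<Longrightarrow> lin g \<Longrightarrow> lin (\<lambda>x. f x - g x)"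
  by (rule linI) (simp_all add: lin_diff lin_add lin_scale vec.scale_right_diff_distrib)

lemma lin_smult: "lin f \<Longrightarrow> lin (\<lambda>x. c *s f x)"
  by (rule linI) (simp_all add: lin_add lin_scale vec.scale_right_distrib mult.commute)

lemma lin_id: "lin (\<lambda>x. x)" and lin_zero: "lin (\<lambda>x. 0)"
  by (auto intro: linI)

lemma lin_sum_fun: "(\<And>i. i \<in> I \<Longrightarrow> lin (f i)) \<Longrightarrow> lin (\<lambda>x. \<Sum>i\<in>I. f i x)"
  by (induction I rule: infinite_finite_induct) (simp_all add: lin_zero lin_plus)

lemma lin_image_subspace: "lin f \<Longrightarrow> vec.subspace W \<Longrightarrow> vec.subspace (f ` W)"
  by (rule vec.linear_subspace_image)

lemma projection_exists:
  fixes U :: "('a::field^'n) set"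
  assumes "vec.subspace U"
  obtains p where "lin p" "\<And>x. p x \<in> U" "\<And>x. x \<in> U \<Longrightarrow> p x = x"
  using vec.linear_exists_left_inverse_on[OF lin_id assms] by (auto simp: image_subset_iff)

text \<open>The complement is the kernel, within \<open>K\<close>, of a projection onto
  \<open>U\<close>.\<close>

lemma subspace_complement:
  fixes U K :: "('a::field^'n) set"
  assumes U: "vec.subspace U" and K: "vec.subspace K" and UK: "U \<subseteq> K"
  obtains C where "vec.subspace C" "C \<subseteq> K" "U \<inter> C \<subseteq> {0}"
    "\<And>x. x \<in> K \<Longrightarrow> \<exists>u\<in>U. \<exists>c\<in>C. x = u + c" "vec.dim K = vec.dim U + vec.dim C"
proof -
  obtain p where p: "lin p" "\<And>x. p x \<in> U" "\<And>x. x \<in> U \<Longrightarrow> p x = x"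
    using projection_exists[OF U] by blast
  define C where "C = {x\<in>K. p x = 0}"
  have C: "vec.subspace C"
    using K p(1) by (auto simp: C_def vec.subspace_def lin_0 lin_add lin_scale)
  have UC: "U \<inter> C \<subseteq> {0}"
    using p(3) by (auto simp: C_def)
  have dec: "\<exists>u\<in>U. \<exists>c\<in>C. x = u + c" if "x \<in> K" for x
  proof (intro bexI)
    show "x = p x + (x - p x)" by simp
    show "x - p x \<in> C"
      using that p UK K by (auto simp: C_def lin_diff intro: vec.subspace_diff)
  qed (use p in auto)
  have "{x + y |x y. x \<in> U \<and> y \<in> C} = K"
    using dec UK K by (auto simp: C_def dest: vec.subspace_add) blast+
  moreover have "vec.dim (U \<inter> C) = 0"
    using UC by (simp only: vec.dim_eq_0)
  ultimately have "vec.dim K = vec.dim U + vec.dim C"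
    using vec.dim_sums_Int[OF U C] by (simp del: vec.dim_eq_0)
  with C UC dec show ?thesis
    by (intro that[of C]) (auto simp: C_def)
qed

text \<open>The sum of \<open>A\<close> and \<open>B\<close> need not be the whole space, so a map
  \<open>r\<close> fixing \<open>A\<close> and killing \<open>B\<close> is built first: subtracting
  a projection onto \<open>B\<close> is injective on \<open>A\<close>, and a left inverse undoes it
  there. Then \<open>f (r x) + g (x - r x)\<close> meets both prescriptions.\<close>

lemma linear_glue:
  fixes f g :: "'a::field^'n \<Rightarrow> 'a^'m"
  assumes A: "vec.subspace A" and B: "vec.subspace B" and AB: "A \<inter> B \<subseteq> {0}"
    and f: "lin f" and g: "lin g"
  obtains F where "lin F" "\<And>x. x \<in> A \<Longrightarrow> F x = f x" "\<And>x. x \<in> B \<Longrightarrow> F x = g x"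
proof -
  obtain p where p: "lin p" "\<And>x. p x \<in> B" "\<And>x. x \<in> B \<Longrightarrow> p x = x"
    using projection_exists[OF B] by blast
  let ?q = "\<lambda>x. x - p x"
  have q: "lin ?q"
    by (intro lin_minus lin_id p)
  have "inj_on ?q A"
  proof (rule inj_onI)
    fix x y assume xy: "x \<in> A" "y \<in> A" "?q x = ?q y"
    then have "x - y = p (x - y)"
      by (simp add: lin_diff[OF p(1)] algebra_simps)
    then have "x - y \<in> A \<inter> B"
      using p(2)[of "x - y"] xy A by (auto intro: vec.subspace_diff)
    with AB show "x = y" by auto
  qed
  then obtain l where l: "lin l" "\<And>x. x \<in> A \<Longrightarrow> l (?q x) = x"
    using vec.linear_exists_left_inverse_on[OF q A] by blast
  define r where "r = (\<lambda>x. l (?q x))"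
  have r: "lin r"
    unfolding r_def by (rule lin_compose[OF l(1) q])
  have rA: "r x = x" if "x \<in> A" for x
    using l that by (simp add: r_def)
  have rB: "r x = 0" if "x \<in> B" for x
    using p(3)[OF that] by (simp add: r_def lin_0[OF l(1)])
  show ?thesis
  proof
    show "lin (\<lambda>x. f (r x) + g (x - r x))"
      by (intro lin_plus lin_compose[OF f r] lin_compose[OF g] lin_minus lin_id r)
  qed (auto simp: rA rB lin_0[OF f] lin_0[OF g])
qed

section \<open>Direct sums of finite families of subspaces\<close>

definition independent_family :: "'i set \<Rightarrow> ('i \<Rightarrow> ('a::field^'n) set) \<Rightarrow> bool"
  where "independent_family I W \<longleftrightarrow>
    (\<forall>y. (\<forall>i\<in>I. y i \<in> W i) \<longrightarrow> (\<Sum>i\<in>I. y i) = 0 \<longrightarrow> (\<forall>i\<in>I. y i = 0))"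

definition subspace_sum :: "'i set \<Rightarrow> ('i \<Rightarrow> ('a::field^'n) set) \<Rightarrow> ('a^'n) set"
  where "subspace_sum I W = {\<Sum>i\<in>I. y i |y. \<forall>i\<in>I. y i \<in> W i}"

lemma subspace_subspace_sum:
  assumes "\<And>i. i \<in> I \<Longrightarrow> vec.subspace (W i)"
  shows "vec.subspace (subspace_sum I W)"
  unfolding vec.subspace_def
proof (intro conjI ballI allI)
  show "0 \<in> subspace_sum I W"
    unfolding subspace_sum_def using assms
    by (auto intro!: exI[of _ "\<lambda>_. 0"] simp: vec.subspace_0)
next
  fix u v assume "u \<in> subspace_sum I W" "v \<in> subspace_sum I W"
  then obtain x y where "u = sum x I" "v = sum y I" "\<forall>i\<in>I. x i \<in> W i" "\<forall>i\<in>I. y i \<in> W i"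
    by (auto simp: subspace_sum_def)
  then show "u + v \<in> subspace_sum I W"
    unfolding subspace_sum_def using assms
    by (auto intro!: exI[of _ "\<lambda>i. x i + y i"] simp: sum.distrib vec.subspace_add)
next
  fix c u assume "u \<in> subspace_sum I W"
  then obtain x where "u = sum x I" "\<forall>i\<in>I. x i \<in> W i"
    by (auto simp: subspace_sum_def)
  then show "c *s u \<in> subspace_sum I W"
    unfolding subspace_sum_def using assms
    by (auto intro!: exI[of _ "\<lambda>i. c *s x i"] simp: vec.scale_sum_right vec.subspace_scale)
qed

lemma subspace_sum_insert:
  assumes "finite I" and "j \<notin> I"
  shows "subspace_sum (insert j I) W = {x + y |x y. x \<in> W j \<and> y \<in> subspace_sum I W}"
proof (intro subset_antisym subsetI)
  fix z assume "z \<in> subspace_sum (insert j I) W"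
  then obtain y where "z = sum y (insert j I)" "\<forall>i\<in>insert j I. y i \<in> W i"
    by (auto simp: subspace_sum_def)
  then show "z \<in> {x + y |x y. x \<in> W j \<and> y \<in> subspace_sum I W}"
    using assms by (auto simp: subspace_sum_def)
next
  fix z assume "z \<in> {x + y |x y. x \<in> W j \<and> y \<in> subspace_sum I W}"
  then obtain x y where xy: "z = x + sum y I" "x \<in> W j" "\<forall>i\<in>I. y i \<in> W i"
    by (auto simp: subspace_sum_def)
  have "sum (y(j := x)) I = sum y I"
    using assms by (intro sum.cong) auto
  then have "z = sum (y(j := x)) (insert j I)"
    using xy assms by simp
  moreover have "\<forall>i\<in>insert j I. (y(j := x)) i \<in> W i"
    using xy by auto
  ultimately show "z \<in> subspace_sum (insert j I) W"
    unfolding subspace_sum_def by blast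
qed

text \<open>Reduces directness of a family to that of two summands, the form used by inductions over
  the index set.\<close>

lemma independent_family_insertD:
  assumes "finite I" and "j \<notin> I" and W: "\<And>i. i \<in> insert j I \<Longrightarrow> vec.subspace (W i)"
    and ind: "independent_family (insert j I) W"
  shows "independent_family I W" and "W j \<inter> subspace_sum I W \<subseteq> {0}"
proof -
  have *: "x = 0 \<and> (\<forall>i\<in>I. y i = 0)" if "x \<in> W j" "\<forall>i\<in>I. y i \<in> W i" "x + sum y I = 0" for x y
  proof -
    have "sum (y(j := x)) I = sum y I"
      using assms by (intro sum.cong) auto
    then have "sum (y(j := x)) (insert j I) = 0"
      using that assms by simp
    moreover have "\<forall>i\<in>insert j I. (y(j := x)) i \<in> W i"
      using that by auto
    ultimately have "\<forall>i\<in>insert j I. (y(j := x)) i = 0"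
      using ind unfolding independent_family_def by blast
    with assms(2) show ?thesis
      by (metis fun_upd_apply insert_iff)
  qed
  show "independent_family I W"
    unfolding independent_family_def
    using *[of 0] W by (auto simp: vec.subspace_0)
  show "W j \<inter> subspace_sum I W \<subseteq> {0}"
  proof
    fix x assume "x \<in> W j \<inter> subspace_sum I W"
    then obtain y where "x \<in> W j" "x = sum y I" "\<forall>i\<in>I. y i \<in> W i"
      by (auto simp: subspace_sum_def)
    with *[of "- x" y] W show "x \<in> {0}"
      by (simp add: vec.subspace_neg)
  qed
qed

text \<open>The source of the global maps below: projections to generalized eigenspaces, real powers
  of a matrix and the similarity are all prescribed on generalized eigenspaces and then
  glued.\<close>

lemma linear_glue_family:
  fixes f :: "'i \<Rightarrow> 'a::field^'n \<Rightarrow> 'a^'m"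
  assumes "finite I" and "\<And>i. i \<in> I \<Longrightarrow> vec.subspace (W i)" and "independent_family I W"
    and "\<And>i. i \<in> I \<Longrightarrow> lin (f i)"
  shows "\<exists>F. lin F \<and> (\<forall>i\<in>I. \<forall>x\<in>W i. F x = f i x)"
  using assms
proof (induction I rule: finite_induct)
  case empty
  then show ?case using lin_zero by auto
next
  case (insert j I)
  note ind = independent_family_insertD[OF insert.hyps insert.prems(1,2)]
  obtain F where F: "lin F" "\<forall>i\<in>I. \<forall>x\<in>W i. F x = f i x"
    using insert.IH ind insert.prems by auto
  obtain G where G: "lin G" "\<And>x. x \<in> W j \<Longrightarrow> G x = f j x"
      "\<And>x. x \<in> subspace_sum I W \<Longrightarrow> G x = F x"
    using linear_glue[of "W j" "subspace_sum I W" "f j" F] ind F insert.prems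
    by (metis insert_iff subspace_subspace_sum)
  have "x \<in> subspace_sum I W" if "i \<in> I" "x \<in> W i" for i x
  proof -
    have "x = (\<Sum>k\<in>I. if k = i then x else 0)"
      using that insert.hyps by simp
    moreover have "\<forall>k\<in>I. (if k = i then x else 0) \<in> W k"
      using that insert.prems by (auto simp: vec.subspace_0)
    ultimately show ?thesis
      unfolding subspace_sum_def by blast
  qed
  with F G show ?case
    by (intro exI[of _ G]) auto
qed

lemma dim_subspace_sum:
  assumes "finite I" and "\<And>i. i \<in> I \<Longrightarrow> vec.subspace (W i)" and "independent_family I W"
  shows "vec.dim (subspace_sum I W) = (\<Sum>i\<in>I. vec.dim (W i))"
  using assms
proof (induction I rule: finite_induct)
  case empty
  then show ?case
    by (simp add: subspace_sum_def)
next
  case (insert j I)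
  note ind = independent_family_insertD[OF insert.hyps insert.prems(1,2)]
  have "vec.dim (W j \<inter> subspace_sum I W) = 0"
    using ind by (simp only: vec.dim_eq_0)
  moreover have "vec.dim (subspace_sum I W) = (\<Sum>i\<in>I. vec.dim (W i))"
    using insert ind by simp
  ultimately show ?case
    using vec.dim_sums_Int[of "W j" "subspace_sum I W"] insert.hyps insert.prems(1)
    by (simp add: subspace_sum_insert subspace_subspace_sum del: vec.dim_eq_0)
qed

section \<open>Nilpotent maps with equal kernel dimensions\<close>

lemma funpow_Suc_inner: "(f ^^ Suc n) x = (f ^^ n) (f x)"
  by (simp add: funpow_swap1)

lemma lin_funpow:
  fixes h :: "'a::field^'k \<Rightarrow> 'a^'k"
  assumes "lin h" shows "lin (h ^^ m)"
proof (induction m)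
  case (Suc m)
  then show ?case
    using lin_compose[OF assms, of "h ^^ m"] by (simp add: o_def)
qed (simp add: id_def lin_id)

text \<open>Rank-nullity for \<open>h\<close> on the kernel of \<open>h^(m+1)\<close> in
  \<open>U\<close>, whose image under \<open>h\<close> is the kernel of \<open>h^m\<close> in the
  image of \<open>U\<close>. It hands the dimension hypothesis of the similarity lemma down from a
  space to its image.\<close>

lemma dim_ker_power_image:
  fixes h :: "'a::field^'k \<Rightarrow> 'a^'k"
  assumes h: "lin h" and U: "vec.subspace U"
  shows "vec.dim {x\<in>h ` U. (h ^^ m) x = 0} + vec.dim {x\<in>U. h x = 0}
      = vec.dim {x\<in>U. (h ^^ Suc m) x = 0}"
proof -
  let ?K = "{x\<in>U. (h ^^ Suc m) x = 0}" and ?K1 = "{x\<in>U. h x = 0}"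
  have K: "vec.subspace ?K"
    using U lin_funpow[OF h, of "Suc m"]
    by (auto simp: vec.subspace_def lin_0 lin_add lin_scale simp del: funpow.simps)
  have K1: "vec.subspace ?K1"
    using U h by (auto simp: vec.subspace_def lin_0 lin_add lin_scale)
  have sub1: "?K1 \<subseteq> ?K"
    by (auto simp: funpow_Suc_inner lin_0[OF lin_funpow[OF h]] simp del: funpow.simps)
  obtain C where C: "vec.subspace C" "C \<subseteq> ?K" "?K1 \<inter> C \<subseteq> {0}"
    "\<And>x. x \<in> ?K \<Longrightarrow> \<exists>u\<in>?K1. \<exists>c\<in>C. x = u + c"
    "vec.dim ?K = vec.dim ?K1 + vec.dim C"
    by (rule subspace_complement[OF K1 K sub1]) blast
  have "inj_on h C"
  proof (rule inj_onI)
    fix x y assume xy: "x \<in> C" "y \<in> C" "h x = h y"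
    then have "x - y \<in> C"
      using C(1) vec.subspace_diff by blast
    moreover from this have "x - y \<in> ?K1"
      using C(2) xy by (auto simp: lin_diff[OF h])
    ultimately show "x = y"
      using C(3) by auto
  qed
  then have "inj_on h (vec.span C)"
    using C(1) by (simp only: vec.span_eq_iff[THEN iffD2])
  then have "vec.dim (h ` C) = vec.dim C"
    by (rule vec.dim_image_eq[OF h])
  moreover have "h ` C = {x\<in>h ` U. (h ^^ m) x = 0}"
  proof (intro subset_antisym subsetI)
    fix z assume "z \<in> h ` C"
    then show "z \<in> {x\<in>h ` U. (h ^^ m) x = 0}"
      using C(2) by (auto simp: funpow_Suc_inner simp del: funpow.simps)
  next
    fix z assume "z \<in> {x\<in>h ` U. (h ^^ m) x = 0}"
    then obtain x where x: "x \<in> U" "z = h x" "(h ^^ Suc m) x = 0"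
      by (auto simp: funpow_Suc_inner simp del: funpow.simps)
    then obtain u c where "u \<in> U" "h u = 0" "c \<in> C" "x = u + c"
      using C(4)[of x] by auto
    with x show "z \<in> h ` C"
      by (simp add: lin_add[OF h])
  qed
  ultimately show ?thesis
    using C(5) by simp
qed

text \<open>Induction on the nilpotency index: an intertwiner of the restrictions to \<open>f ` V\<close> and \<open>g ` W\<close> is
  extended to \<open>V\<close> by an isomorphism between complements in the kernels and, elsewhere, by lifting
  through \<open>g\<close>. It is injective as soon as it is injective on the kernel of \<open>f\<close>.\<close>

lemma nilpotent_similar:
  fixes f :: "'a::field^'n \<Rightarrow> 'a^'n" and g :: "'a^'m \<Rightarrow> 'a^'m"
  assumes f: "lin f" and g: "lin g"
    and "vec.subspace V" and "vec.subspace W"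
    and "f ` V \<subseteq> V" and "g ` W \<subseteq> W"
    and "\<And>x. x \<in> V \<Longrightarrow> (f ^^ q) x = 0" and "\<And>x. x \<in> W \<Longrightarrow> (g ^^ q) x = 0"
    and "\<And>m. vec.dim {x\<in>V. (f ^^ m) x = 0} = vec.dim {x\<in>W. (g ^^ m) x = 0}"
  shows "\<exists>S. lin S \<and> S ` V \<subseteq> W \<and> (\<forall>x\<in>V. S x = 0 \<longrightarrow> x = 0) \<and> (\<forall>x\<in>V. S (f x) = g (S x))"
  using assms(3-)
proof (induction q arbitrary: V W)
  case 0
  then show ?case
    by (intro exI[of _ "\<lambda>_. 0"]) (auto simp: lin_zero vec.subspace_0 lin_0[OF g])
next
  case (Suc q)
  have fV: "vec.subspace (f ` V)" and gW: "vec.subspace (g ` W)"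
    by (rule lin_image_subspace[OF f Suc.prems(1)], rule lin_image_subspace[OF g Suc.prems(2)])
  \<comment> \<open>The case \<open>m = 1\<close> of the hypothesis equates the dimensions of the
    kernels of \<open>f\<close> and \<open>g\<close> themselves, which therefore cancel.\<close>
  have dims: "vec.dim {x\<in>f ` V. (f ^^ m) x = 0} = vec.dim {x\<in>g ` W. (g ^^ m) x = 0}" for m
    using dim_ker_power_image[OF f Suc.prems(1), of m] dim_ker_power_image[OF g Suc.prems(2), of m]
      Suc.prems(7)[of 1, simplified] Suc.prems(7)[of "Suc m"] by linarith
  have "\<exists>S. lin S \<and> S ` (f ` V) \<subseteq> g ` W \<and> (\<forall>x\<in>f ` V. S x = 0 \<longrightarrow> x = 0)
      \<and> (\<forall>x\<in>f ` V. S (f x) = g (S x))"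
  proof (rule Suc.IH[OF fV gW])
    show "f ` f ` V \<subseteq> f ` V" "g ` g ` W \<subseteq> g ` W"
      by (intro image_mono Suc.prems)+
    show "(f ^^ q) x = 0" if "x \<in> f ` V" for x
      using that Suc.prems(5) funpow_Suc_inner[of q f] by (metis imageE)
    show "(g ^^ q) x = 0" if "x \<in> g ` W" for x
      using that Suc.prems(6) funpow_Suc_inner[of q g] by (metis imageE)
  qed (rule dims)
  then obtain S where S': "lin S \<and> S ` (f ` V) \<subseteq> g ` W \<and> (\<forall>x\<in>f ` V. S x = 0 \<longrightarrow> x = 0)
      \<and> (\<forall>x\<in>f ` V. S (f x) = g (S x))" ..
  then have S: "lin S" "S ` (f ` V) \<subseteq> g ` W" "x \<in> f ` V \<Longrightarrow> S x = 0 \<Longrightarrow> x = 0"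
      "x \<in> f ` V \<Longrightarrow> S (f x) = g (S x)" for x
    by blast+
  define K where "K = {x\<in>V. f x = 0}"
  define L where "L = {x\<in>W. g x = 0}"
  have K: "vec.subspace K" and L: "vec.subspace L"
    using Suc.prems(1,2) f g
    by (auto simp: K_def L_def vec.subspace_def lin_0 lin_add lin_scale)
  have dKL: "vec.dim K = vec.dim L"
    using Suc.prems(7)[of 1] by (simp add: K_def L_def)
  \<comment> \<open>\<open>S\<close> already treats the part \<open>U\<close> of the kernel of
    \<open>f\<close>. As it is injective there, the complements \<open>K0\<close> of
    \<open>U\<close> and \<open>L0\<close> of the image of \<open>U\<close> in the two kernels have
    equal dimension and can be matched by an isomorphism.\<close>
  define U where "U = f ` V \<inter> K"
  have U: "vec.subspace U" and UK: "U \<subseteq> K"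
    unfolding U_def by (rule vec.subspace_inter[OF fV K]) simp
  have SU: "vec.subspace (S ` U)"
    by (rule lin_image_subspace[OF S(1) U])
  have SUL: "S ` U \<subseteq> L"
  proof
    fix z assume "z \<in> S ` U"
    then obtain x where x: "x \<in> f ` V" "f x = 0" "z = S x"
      by (auto simp: U_def K_def)
    then have "z \<in> g ` W" "g z = 0"
      using S(2) S(4)[OF x(1)] lin_0[OF S(1)] by auto
    with Suc.prems(4) show "z \<in> L"
      by (auto simp: L_def)
  qed
  obtain K0 where K0: "vec.subspace K0" "K0 \<subseteq> K" "U \<inter> K0 \<subseteq> {0}"
      "\<And>x. x \<in> K \<Longrightarrow> \<exists>u\<in>U. \<exists>c\<in>K0. x = u + c" "vec.dim K = vec.dim U + vec.dim K0"
    by (rule subspace_complement[OF U K UK]) blast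
  obtain L0 where L0: "vec.subspace L0" "L0 \<subseteq> L" "S ` U \<inter> L0 \<subseteq> {0}"
      "vec.dim L = vec.dim (S ` U) + vec.dim L0"
    by (rule subspace_complement[OF SU L SUL]) blast
  have "inj_on S U"
  proof (rule inj_onI)
    fix x y assume xy: "x \<in> U" "y \<in> U" "S x = S y"
    then have "x - y \<in> f ` V"
      using fV by (auto simp: U_def intro: vec.subspace_diff)
    with xy S(3)[of "x - y"] show "x = y"
      by (simp add: lin_diff[OF S(1)])
  qed
  then have "vec.dim (S ` U) = vec.dim U"
    using U vec.dim_image_eq[OF S(1)] vec.span_eq_iff by metis
  then have "vec.dim K0 = vec.dim L0"
    using K0(5) L0(4) dKL by simp
  then obtain T where T: "lin T" "T ` K0 = L0" "inj_on T K0"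
    using vec.subspace_isomorphism[OF K0(1) L0(1)] by metis
  have "f ` V \<inter> K0 \<subseteq> {0}"
    using K0(2,3) by (auto simp: U_def)
  then obtain S1 where S1: "lin S1" "\<And>x. x \<in> f ` V \<Longrightarrow> S1 x = S x" "\<And>x. x \<in> K0 \<Longrightarrow> S1 x = T x"
    by (rule linear_glue[OF fV K0(1) _ S(1) T(1)]) blast+
  define M where "M = {x + y |x y. x \<in> f ` V \<and> y \<in> K0}"
  have M: "vec.subspace M"
    unfolding M_def by (rule vec.subspace_sums[OF fV K0(1)])
  have fVV: "f ` V \<subseteq> V" and K0V: "K0 \<subseteq> V"
    using Suc.prems(3) K0(2) by (auto simp: K_def)
  then have "M \<subseteq> V"
    using Suc.prems(1) by (auto simp: M_def intro!: vec.subspace_add)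
  then obtain E where E: "vec.subspace E" "E \<subseteq> V" "M \<inter> E \<subseteq> {0}"
      "\<And>x. x \<in> V \<Longrightarrow> \<exists>u\<in>M. \<exists>c\<in>E. x = u + c"
    by (rule subspace_complement[OF M Suc.prems(1)]) blast+
  \<comment> \<open>Outside \<open>M\<close> the relation \<open>R (f x) = g (R x)\<close>
    determines \<open>R x\<close> up to the kernel of \<open>g\<close>; a right inverse
    \<open>h\<close> of \<open>g\<close> with values in \<open>W\<close> selects one
    solution.\<close>
  obtain h where h: "h ` UNIV \<subseteq> W" "lin h" "\<forall>v\<in>g ` W. g (h v) = v"
    using vec.linear_exists_right_inverse_on[OF g Suc.prems(2)] by blast
  have "lin (\<lambda>x. h (S (f x)))"
    by (intro lin_compose[OF h(2)] lin_compose[OF S(1)] f)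
  then obtain R where R: "lin R" "\<And>x. x \<in> M \<Longrightarrow> R x = S1 x" "\<And>x. x \<in> E \<Longrightarrow> R x = h (S (f x))"
    by (rule linear_glue[OF M E(1) E(3) S1(1)]) blast+
  have fM: "x \<in> M" if "x \<in> f ` V" for x
    unfolding M_def mem_Collect_eq using that vec.subspace_0[OF K0(1)]
    by (intro exI[of _ x] exI[of _ 0]) simp
  have KM: "x \<in> M" if "x \<in> K0" for x
    unfolding M_def mem_Collect_eq using that vec.subspace_0[OF fV]
    by (intro exI[of _ 0] exI[of _ x]) simp
  have R1: "R x = S x" if "x \<in> f ` V" for x
    using R(2)[OF fM[OF that]] S1(2)[OF that] by simp
  have R2: "R x = T x" if "x \<in> K0" for x
    using R(2)[OF KM[OF that]] S1(3)[OF that] by simp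
  have dec: "\<exists>a\<in>f ` V. \<exists>b\<in>K0. \<exists>c\<in>E. x = a + b + c" if "x \<in> V" for x
    using E(4)[OF that] by (auto simp: M_def)
  have TK: "T b \<in> W" "g (T b) = 0" if "b \<in> K0" for b
    using T(2) L0(2) that by (auto simp: L_def)
  have RW: "R x \<in> W" if xV: "x \<in> V" for x
  proof -
    obtain a b c where abc: "a \<in> f ` V" "b \<in> K0" "c \<in> E" "x = a + b + c"
      using dec[OF xV] by blast
    have "S a \<in> W"
      using abc(1) S(2) Suc.prems(4) by blast
    then have "R a \<in> W" "R b \<in> W" "R c \<in> W"
      using R1[OF abc(1)] R2[OF abc(2)] R(3)[OF abc(3)] TK(1)[OF abc(2)] h(1) by auto
    then show ?thesis
      using abc(4) Suc.prems(2) by (simp add: lin_add[OF R(1)] vec.subspace_add)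
  qed
  have Rfg: "R (f x) = g (R x)" if xV: "x \<in> V" for x
  proof -
    obtain a b c where abc: "a \<in> f ` V" "b \<in> K0" "c \<in> E" "x = a + b + c"
      using dec[OF xV] by blast
    have "R (f a) = g (R a)"
      using abc R1 S(4) fVV by (metis image_eqI subsetD)
    moreover have "R (f b) = g (R b)"
      using abc R2 TK K0(2) by (auto simp: K_def lin_0[OF R(1)])
    moreover have "R (f c) = g (R c)"
    proof -
      have "f c \<in> f ` V"
        using abc E(2) by auto
      then have "S (f c) \<in> g ` W"
        using S(2) by auto
      then show ?thesis
        using R1[OF \<open>f c \<in> f ` V\<close>] R(3)[OF abc(3)] bspec[OF h(3), of "S (f c)"] by simp
    qed
    ultimately show ?thesis
      using abc(4) by (simp add: lin_add[OF R(1)] lin_add[OF f] lin_add[OF g])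
  qed
  \<comment> \<open>On the kernel of \<open>f\<close>, \<open>R\<close> maps the summands
    \<open>U\<close> and \<open>K0\<close> injectively into subspaces that meet only in 0.\<close>
  have inj_ker: "x = 0" if xK: "x \<in> K" and Rx: "R x = 0" for x
  proof -
    obtain u b where ub: "u \<in> U" "b \<in> K0" "x = u + b"
      using K0(4)[OF xK] by blast
    have uV: "u \<in> f ` V"
      using ub(1) by (simp add: U_def)
    have eq: "S u + T b = 0"
      using Rx ub(3) R1[OF uV] R2[OF ub(2)] by (simp add: lin_add[OF R(1)])
    have "T b \<in> L0"
      using T(2) ub(2) by auto
    then have "S u \<in> L0"
      using vec.subspace_neg[OF L0(1), of "T b"] eq by (metis add_eq_0_iff2)
    then have "S u = 0"
      using L0(3) ub(1) by auto
    with eq have "T b = T 0"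
      by (simp add: lin_0[OF T(1)])
    then have "b = 0"
      using inj_onD[OF T(3) _ ub(2) vec.subspace_0[OF K0(1)]] by simp
    moreover have "u = 0"
      using S(3)[OF uV \<open>S u = 0\<close>] .
    ultimately show ?thesis
      using ub(3) by simp
  qed
  have inj: "x = 0" if "x \<in> V" "R x = 0" "(f ^^ p) x = 0" for x p
    using that
  proof (induction p arbitrary: x)
    case (Suc p)
    have "f x = 0"
    proof (rule Suc.IH)
      show "f x \<in> V" using fVV Suc.prems(1) by blast
      show "R (f x) = 0" using Rfg[OF Suc.prems(1)] Suc.prems(2) lin_0[OF g] by simp
      show "(f ^^ p) (f x) = 0" using Suc.prems(3) unfolding funpow_Suc_inner .
    qed
    then show ?case
      using inj_ker[OF _ Suc.prems(2)] Suc.prems(1) unfolding K_def by blast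
  qed simp
  show ?case
  proof (intro exI conjI ballI impI)
    show "lin R" by (rule R(1))
    show "R ` V \<subseteq> W" using RW by blast
    show "R (f x) = g (R x)" if "x \<in> V" for x
      by (rule Rfg[OF that])
    show "x = 0" if "x \<in> V" "R x = 0" for x
      using inj[OF that Suc.prems(5)[OF that(1)]] .
  qed
qed

section \<open>Generalized eigenspaces\<close>

lemma matrix_power_Suc_vec:
  "matrix_power B (Suc m) *v v = matrix_power B m *v (B *v v)"
  by (induction m) (simp_all add: matrix_vector_mul_assoc[symmetric])

lemma matrix_power_add_vec:
  "matrix_power B (j + m) *v v = matrix_power B j *v (matrix_power B m *v v)"
  by (induction j) (simp_all add: matrix_vector_mul_assoc[symmetric])

lemma mat_vec: "mat c *v x = c *s (x::'a::field^'n)"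
  by (simp add: vec_eq_iff matrix_vector_mult_def mat_def if_distrib[of "\<lambda>a. a * _"] cong: if_cong)

lemma shift_vec: "(A - mat c) *v x = A *v x - c *s (x::'a::field^'n)"
  by (simp add: matrix_vector_mult_diff_rdistrib mat_vec)

lemma matrix_power_commute_vec:
  fixes B C :: "'a::field^'n^'n"
  assumes "\<And>v. B *v (C *v v) = C *v (B *v v)"
  shows "matrix_power B m *v (C *v v) = C *v (matrix_power B m *v v)"
  by (induction m) (simp_all add: matrix_vector_mul_assoc[symmetric] assms)

lemma matrix_power_funpow: "matrix_power B m *v v = (((*v) B) ^^ m) v"
  by (induction m) (simp_all add: matrix_vector_mul_assoc[symmetric])

definition gker :: "'a::field^'n^'n \<Rightarrow> 'a \<Rightarrow> nat \<Rightarrow> ('a^'n) set"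
  where "gker A c m = {v. matrix_power (A - mat c) m *v v = 0}"

lemma gker_0: "gker A c 0 = {0}"
  by (simp add: gker_def)

lemma gker_Suc_iff: "v \<in> gker A c (Suc m) \<longleftrightarrow> A *v v - c *s v \<in> gker A c m"
  by (simp only: gker_def mem_Collect_eq matrix_power_Suc_vec shift_vec)

lemma gker_1_iff: "v \<in> gker A c 1 \<longleftrightarrow> A *v v = c *s v"
  unfolding One_nat_def gker_Suc_iff gker_0 by simp

lemma subspace_gker: "vec.subspace (gker A c m)"
  unfolding vec.subspace_def gker_def
  by (simp add: matrix_vector_right_distrib vec.scale)

lemma zero_in_gker: "0 \<in> gker A c m"
  by (simp add: gker_def)

lemma gker_mono: "m \<le> n \<Longrightarrow> gker A c m \<subseteq> gker A c n"
  using matrix_power_add_vec[of "A - mat c" "n - m" m] by (auto simp: gker_def)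

lemma gker_commute:
  assumes "v \<in> gker A c m" and "\<And>v. A *v (C *v v) = C *v (A *v v)"
  shows "C *v v \<in> gker A c m"
proof -
  have "(A - mat c) *v (C *v v) = C *v ((A - mat c) *v v)" for v
    by (simp add: shift_vec assms(2) vec.diff vec.scale)
  then show ?thesis
    using assms(1) matrix_power_commute_vec[of "A - mat c" C m v] by (simp add: gker_def)
qed

lemma eigenvector_matrix_power:
  fixes A :: "'a::field^'n^'n"
  assumes "A *v v = c *s v"
  shows "matrix_power (A - mat d) m *v v = (c - d) ^ m *s v"
proof (induction m)
  case (Suc m)
  have "(A - mat d) *v v = (c - d) *s v"
    by (simp add: shift_vec assms vec.scale_left_diff_distrib)
  moreover have "matrix_power (A - mat d) (Suc m) *v v = (A - mat d) *v ((c - d) ^ m *s v)"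
    using Suc.IH by (simp add: matrix_vector_mul_assoc[symmetric])
  ultimately show ?case
    by (simp only: vec.scale vec.scale_scale power_Suc mult.commute)
qed simp

text \<open>Each application of \<open>A - c\<close> lowers the least exponent that kills
  \<open>v\<close> by one, so some iterate has least exponent exactly \<open>Suc q\<close>. With
  \<open>q = 0\<close> this yields eigenvectors; with \<open>q = Suc d\<close> it yields a vector
  whose orbit grows too fast for \<open>growth A r d\<close>.\<close>

lemma gker_step:
  assumes "v \<in> gker A c p" and "v \<notin> gker A c q"
  obtains j where "matrix_power (A - mat c) j *v v \<in> gker A c (Suc q)"
    and "matrix_power (A - mat c) j *v v \<notin> gker A c q"
proof -
  define k where "k = (LEAST k. v \<in> gker A c k)"
  have k: "v \<in> gker A c k"
    unfolding k_def by (rule LeastI) (rule assms(1))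
  have "q < k"
    using k assms(2) gker_mono[of k q A c] by (metis linorder_not_le subsetD)
  define j where "j = k - Suc q"
  have kj: "k = Suc q + j" "q + j < k"
    using \<open>q < k\<close> by (simp_all add: j_def)
  have "v \<notin> gker A c (q + j)"
    using kj(2) not_less_Least[of "q + j" "\<lambda>k. v \<in> gker A c k"] by (simp add: k_def)
  moreover have "v \<in> gker A c (Suc q + j)"
    using k kj(1) by simp
  ultimately show ?thesis
    by (intro that[of j]) (simp_all only: gker_def mem_Collect_eq matrix_power_add_vec simp_thms)
qed

definition geig :: "'a::field^'n^'n \<Rightarrow> 'a \<Rightarrow> ('a^'n) set"
  where "geig A c = (\<Union>m. gker A c m)"

lemma geigI: "v \<in> gker A c m \<Longrightarrow> v \<in> geig A c"
  by (auto simp: geig_def)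

text \<open>The kernels increase and their dimensions are bounded, so one of maximal dimension
  contains all others.\<close>

lemma geig_eq_gker:
  fixes A :: "'a::field^'n^'n"
  shows "\<exists>m. geig A c = gker A c m"
proof -
  obtain M where M: "\<And>m. vec.dim (gker A c m) \<le> vec.dim (gker A c M)"
    using ex_has_greatest_nat[of "\<lambda>_. True" 0 "\<lambda>m. vec.dim (gker A c m)" "Suc CARD('n)"]
      dim_subset_UNIV_cart_gen less_Suc_eq_le by metis
  have "gker A c m \<subseteq> gker A c M" for m
  proof (cases "m \<le> M")
    case False
    then have "gker A c M \<subseteq> gker A c m"
      by (intro gker_mono) simp
    then have "gker A c M = gker A c m"
      by (rule vec.subspace_dim_equal[OF subspace_gker subspace_gker _ M])
    then show ?thesis by (rule equalityD2)
  qed (rule gker_mono)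
  then have "geig A c \<subseteq> gker A c M"
    unfolding geig_def by (rule UN_least)
  moreover have "gker A c M \<subseteq> geig A c"
    by (auto intro: geigI)
  ultimately show ?thesis by blast
qed

lemma subspace_geig: "vec.subspace (geig A c)"
proof -
  obtain m where "geig A c = gker A c m"
    using geig_eq_gker by blast
  then show ?thesis
    by (simp only: subspace_gker)
qed

lemma geig_commute:
  assumes "v \<in> geig A c" and "\<And>v. A *v (C *v v) = C *v (A *v v)"
  shows "C *v v \<in> geig A c"
proof -
  obtain m where "v \<in> gker A c m"
    using assms(1) by (auto simp: geig_def)
  then show ?thesis
    by (intro geigI gker_commute assms(2))
qed

text \<open>By induction \<open>A - c\<close> kills \<open>v\<close>, so \<open>v\<close> is an
  eigenvector for \<open>c\<close>; on it the \<open>k\<close>-th power of \<open>A - d\<close> is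
  multiplication by \<open>(c - d)^k\<close>, which is nonzero.\<close>

lemma gker_disjoint:
  assumes "v \<in> gker A c m" and "v \<in> gker A d k" and "c \<noteq> d"
  shows "v = 0"
  using assms(1,2)
proof (induction m arbitrary: v)
  case 0
  then show ?case by (simp add: gker_0)
next
  case (Suc m)
  have "(A - mat c) *v v \<in> gker A d k"
    by (rule gker_commute[OF Suc.prems(2)]) (simp add: shift_vec vec.diff vec.scale)
  then have "(A - mat c) *v v = 0"
    using Suc.IH Suc.prems(1) unfolding gker_Suc_iff shift_vec by blast
  then have "matrix_power (A - mat d) k *v v = (c - d) ^ k *s v"
    by (intro eigenvector_matrix_power) (simp add: shift_vec)
  then show ?case
    using Suc.prems(2) assms(3) unfolding gker_def mem_Collect_eq
    by (simp only: vec.scale_eq_0_iff power_eq_0_iff right_minus_eq) simp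
qed

lemma geig_disjoint: "v \<in> geig A c \<Longrightarrow> v \<in> geig A d \<Longrightarrow> c \<noteq> d \<Longrightarrow> v = 0"
  unfolding geig_def using gker_disjoint by blast

text \<open>A power of \<open>A - d\<close> kills the component at \<open>d\<close> and keeps every
  other component in its own generalized eigenspace. By the induction hypothesis those images
  vanish, so each remaining component lies in two different generalized eigenspaces.\<close>

lemma independent_geig:
  assumes "finite I"
  shows "independent_family I (geig A)"
  using assms
proof (induction I rule: finite_induct)
  case empty
  then show ?case by (simp add: independent_family_def)
next
  case (insert d I)
  obtain M where M: "geig A d = gker A d M"
    using geig_eq_gker by blast
  let ?B = "matrix_power (A - mat d) M"
  have comm: "A *v (?B *v v) = ?B *v (A *v v)" for v
    by (rule matrix_power_commute_vec[symmetric]) (simp add: shift_vec vec.diff vec.scale)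
  show ?case
    unfolding independent_family_def
  proof (intro allI impI)
    fix y assume y: "\<forall>c\<in>insert d I. y c \<in> geig A c" and sum0: "sum y (insert d I) = 0"
    have "?B *v y d = 0"
      using y M by (auto simp: gker_def)
    moreover have "?B *v sum y (insert d I) = 0"
      by (simp add: sum0)
    ultimately have "(\<Sum>c\<in>I. ?B *v y c) = 0"
      using insert.hyps by (simp add: vec.sum vec.add)
    moreover have "\<forall>c\<in>I. ?B *v y c \<in> geig A c"
      using y comm geig_commute by blast
    ultimately have "\<forall>c\<in>I. ?B *v y c = 0"
      using insert.IH[unfolded independent_family_def, rule_format, of "\<lambda>c. ?B *v y c"] by blast
    then have "\<forall>c\<in>I. y c \<in> geig A d"
      unfolding M gker_def by blast
    then have yI: "\<forall>c\<in>I. y c = 0"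
      using y insert.hyps geig_disjoint by blast
    then have "y d = 0"
      using sum0 insert.hyps by simp
    with yI show "\<forall>c\<in>insert d I. y c = 0" by simp
  qed
qed

lemma independent_subfamily:
  assumes "independent_family I W" and "\<And>i. i \<in> I \<Longrightarrow> V i \<subseteq> W i"
  shows "independent_family I V"
  using assms unfolding independent_family_def by blast

definition eigvals :: "'a::field^'n^'n \<Rightarrow> 'a set"
  where "eigvals A = {c. \<exists>v. v \<noteq> 0 \<and> A *v v = c *s v}"

lemma eigvalsI: "v \<noteq> 0 \<Longrightarrow> v \<in> geig A c \<Longrightarrow> c \<in> eigvals A"
proof -
  assume "v \<noteq> 0" "v \<in> geig A c"
  then obtain p where "v \<in> gker A c p" "v \<notin> gker A c 0"
    by (auto simp: geig_def gker_0)
  then obtain j where "matrix_power (A - mat c) j *v v \<in> gker A c (Suc 0)"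
      "matrix_power (A - mat c) j *v v \<notin> gker A c 0"
    by (rule gker_step)
  then show ?thesis
    unfolding eigvals_def by (auto simp: gker_Suc_iff gker_0)
qed

text \<open>More than \<open>CARD('n)\<close> eigenvalues would give an independent family of
  nonzero subspaces of too large total dimension.\<close>

lemma finite_eigvals: "finite (eigvals (A::'a::field^'n^'n))"
proof (rule ccontr)
  assume "infinite (eigvals A)"
  then obtain I where I: "finite I" "card I = Suc CARD('n)" "I \<subseteq> eigvals A"
    using infinite_arbitrarily_large by blast
  have "1 \<le> vec.dim (geig A c)" if cI: "c \<in> I" for c
  proof -
    obtain v where "v \<noteq> 0" "A *v v = c *s v"
      using cI I(3) by (auto simp: eigvals_def)
    then have "v \<in> geig A c"
      by (intro geigI[of v A c 1]) (simp only: gker_1_iff)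
    then have "\<not> geig A c \<subseteq> {0}"
      using \<open>v \<noteq> 0\<close> by blast
    then show ?thesis
      using vec.dim_eq_0[of "geig A c"] by linarith
  qed
  then have "card I \<le> (\<Sum>c\<in>I. vec.dim (geig A c))"
    using sum_mono[of I "\<lambda>_. 1" "\<lambda>c. vec.dim (geig A c)"] by simp
  also have "\<dots> = vec.dim (subspace_sum I (geig A))"
    by (intro dim_subspace_sum[symmetric] I subspace_geig independent_geig)
  also have "\<dots> \<le> CARD('n)"
    by (rule dim_subset_UNIV_cart_gen)
  finally show False
    using I(2) by simp
qed

section \<open>Primary decomposition of invariant subspaces\<close>

lemma gker_shift_preimage:
  assumes W: "vec.subspace W" and AW: "\<And>v. v \<in> W \<Longrightarrow> A *v v \<in> W" and cd: "c \<noteq> d"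
    and "v \<in> W" and "v \<in> gker A d m"
  shows "\<exists>z. z \<in> W \<and> z \<in> gker A d m \<and> A *v z - c *s z = v"
  using assms(4,5)
proof (induction m arbitrary: v)
  case 0
  then show ?case
    using vec.subspace_0[OF W] by (intro exI[of _ 0]) (simp add: gker_0)
next
  case (Suc m)
  let ?w = "A *v v - d *s v"
  have wW: "?w \<in> W"
    using W AW Suc.prems(1) by (intro vec.subspace_diff vec.subspace_scale) auto
  have "?w \<in> gker A d m"
    using Suc.prems(2) by (simp add: gker_Suc_iff)
  from Suc.IH[OF wW this] obtain z where
    z: "z \<in> W" "z \<in> gker A d m" "A *v z - c *s z = ?w"
    by blast
  \<comment> \<open>Since \<open>(A - c) v = (A - d) v + (d - c) v\<close> and \<open>z\<close> is a
    preimage of \<open>(A - d) v\<close> under \<open>A - c\<close>, the map \<open>A - c\<close>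
    sends \<open>v - z\<close> to \<open>(d - c) v\<close>.\<close>
  let ?y = "inverse (d - c) *s (v - z)"
  have "z \<in> gker A d (Suc m)"
    using z(2) gker_mono[of m "Suc m" A d] by auto
  then have "?y \<in> gker A d (Suc m)"
    using Suc.prems(2) by (intro vec.subspace_scale vec.subspace_diff subspace_gker)
  moreover have "?y \<in> W"
    using Suc.prems(1) z(1) W by (intro vec.subspace_scale vec.subspace_diff)
  moreover have "A *v ?y - c *s ?y = v"
  proof -
    have "A *v ?y - c *s ?y = inverse (d - c) *s ((A *v v - c *s v) - (A *v z - c *s z))"
      by (simp add: vec.scale vec.diff vec.scale_right_diff_distrib mult.commute)
    also have "(A *v v - c *s v) - (A *v z - c *s z) = (d - c) *s v"
      unfolding z(3) by (simp add: vec.scale_left_diff_distrib)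
    also have "inverse (d - c) *s ((d - c) *s v) = (inverse (d - c) * (d - c)) *s v"
      by (rule vec.scale_scale)
    also have "\<dots> = v"
      using cd by (simp only: left_inverse right_minus_eq not_sym[OF cd] simp_thms vec.scale_one)
    finally show ?thesis .
  qed
  ultimately show ?case by blast
qed

text \<open>This is the vector \<open>p(A) v\<close>.\<close>

definition poly_act :: "'a::field poly \<Rightarrow> 'a^'n^'n \<Rightarrow> 'a^'n \<Rightarrow> 'a^'n"
  where "poly_act p A v = (\<Sum>i\<le>degree p. coeff p i *s (matrix_power A i *v v))"

lemma poly_act_bound:
  assumes "degree p \<le> n"
  shows "poly_act p A v = (\<Sum>i\<le>n. coeff p i *s (matrix_power A i *v v))"
  unfolding poly_act_def using assms
  by (intro sum.mono_neutral_left) (auto simp: coeff_eq_0)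

lemma poly_act_linear_factor:
  fixes q :: "'a::field poly"
  shows "poly_act ([:- c, 1:] * q) A v = poly_act q A (A *v v - c *s v)"
proof -
  let ?n = "degree q"
  have deg: "degree ([:- c, 1:] * q) \<le> Suc ?n"
    using degree_mult_le[of "[:- c, 1:]" q] by simp
  have co: "coeff ([:- c, 1:] * q) i = coeff (pCons 0 q) i - c * coeff q i" for i
    by simp
  have "poly_act ([:- c, 1:] * q) A v
      = (\<Sum>i\<le>Suc ?n. coeff (pCons 0 q) i *s (matrix_power A i *v v))
        - (\<Sum>i\<le>Suc ?n. (c * coeff q i) *s (matrix_power A i *v v))"
    unfolding poly_act_bound[OF deg] co vec.scale_left_diff_distrib sum_subtractf ..
  also have "(\<Sum>i\<le>Suc ?n. coeff (pCons 0 q) i *s (matrix_power A i *v v))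
      = (\<Sum>i\<le>?n. coeff q i *s (matrix_power A i *v (A *v v)))"
    unfolding sum.atMost_Suc_shift by (simp only: matrix_power_Suc_vec coeff_pCons_Suc) simp
  also have "(\<Sum>i\<le>Suc ?n. (c * coeff q i) *s (matrix_power A i *v v))
      = (\<Sum>i\<le>?n. coeff q i *s (matrix_power A i *v (c *s v)))"
    by (simp add: coeff_eq_0 vec.scale mult.commute)
  finally show ?thesis
    by (simp add: poly_act_def vec.diff vec.scale_right_diff_distrib sum_subtractf)
qed

text \<open>The vectors \<open>A^i v\<close> for \<open>i \<le> CARD('n)\<close> are one too many to
  be independent. Two equal ones form a dependence that the set of these vectors cannot show, hence
  the case distinction.\<close>

lemma poly_act_annihilator:
  fixes A :: "'a::field^'n^'n"
  shows "\<exists>p. p \<noteq> 0 \<and> poly_act p A v = 0"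
proof -
  let ?f = "\<lambda>i. matrix_power A i *v v"
  let ?I = "{..CARD('n)}"
  have "\<exists>c. (\<exists>i\<in>?I. c i \<noteq> 0) \<and> (\<Sum>i\<in>?I. c i *s ?f i) = 0"
  proof (cases "inj_on ?f ?I")
    case True
    then have "card (?f ` ?I) > CARD('n)"
      by (simp add: card_image)
    then have "vec.dependent (?f ` ?I)"
      using vec.independent_card_le_dim[of "?f ` ?I" UNIV]
      by (metis linorder_not_le subset_UNIV vec_dim_card)
    then obtain u where u: "(\<exists>w\<in>?f ` ?I. u w \<noteq> 0)" "(\<Sum>w\<in>?f ` ?I. u w *s w) = 0"
      using vec.dependent_finite[of "?f ` ?I"] by auto
    then show ?thesis
      using True by (intro exI[of _ "\<lambda>i. u (?f i)"]) (auto simp: sum.reindex)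
  next
    case False
    then obtain i j where ij: "i \<in> ?I" "j \<in> ?I" "i \<noteq> j" "?f i = ?f j"
      by (auto simp: inj_on_def)
    define c where "c = (\<lambda>k. if k = i then 1 else if k = j then - 1 else (0::'a))"
    have "(\<Sum>k\<in>?I. c k *s ?f k) = (\<Sum>k\<in>{i, j}. c k *s ?f k)"
      using ij by (intro sum.mono_neutral_right) (auto simp: c_def)
    also have "\<dots> = 0"
      using ij(3,4) by (simp add: c_def)
    finally show ?thesis
      using ij(1) by (intro exI[of _ c]) (auto simp: c_def)
  qed
  then obtain c i where c: "i \<in> ?I" "c i \<noteq> 0" "(\<Sum>i\<in>?I. c i *s ?f i) = 0"
    by blast
  define p where "p = (\<Sum>i\<in>?I. monom (c i) i)"
  have coeff: "coeff p k = (if k \<in> ?I then c k else 0)" for k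
    by (simp add: p_def coeff_sum)
  have deg: "degree p \<le> CARD('n)"
    by (rule degree_le) (simp add: coeff)
  have "poly_act p A v = (\<Sum>i\<in>?I. c i *s ?f i)"
    unfolding poly_act_bound[OF deg] by (intro sum.cong) (auto simp: coeff)
  moreover have "p \<noteq> 0"
    using c(1,2) coeff[of i] by auto
  ultimately show ?thesis
    using c(3) by auto
qed

text \<open>Induction on the degree. Splitting off a root \<open>c\<close> puts
  \<open>(A - c) v\<close> into the span. If some \<open>z\<close> in the span satisfies
  \<open>(A - c) z = (A - c) v\<close> up to an element of the generalized eigenspace of
  \<open>c\<close>, then \<open>A - c\<close> sends \<open>v - z\<close> into that space, so
  \<open>v - z\<close> belongs to it.\<close>

lemma poly_act_0_in_span_geig:
  fixes A :: "complex^'n^'n"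
  assumes W: "vec.subspace W" and AW: "\<And>v. v \<in> W \<Longrightarrow> A *v v \<in> W"
    and "p \<noteq> 0" and "poly_act p A v = 0" and "v \<in> W"
  shows "v \<in> vec.span (\<Union>c. W \<inter> geig A c)"
  using assms(3-)
proof (induction "degree p" arbitrary: p v)
  case 0
  then obtain a where "p = [:a:]" "a \<noteq> 0"
    by (metis degree_eq_zeroE pCons_0_0)
  with 0 show ?case
    by (simp add: poly_act_def vec.span_zero)
next
  case (Suc n)
  let ?G = "\<Union>c. W \<inter> geig A c"
  have "\<not> constant (poly p)"
    using Suc.hyps(2) by (simp add: constant_degree)
  then obtain c where "poly p c = 0"
    using fundamental_theorem_of_algebra by blast
  then obtain q where q: "p = [:- c, 1:] * q"
    unfolding poly_eq_0_iff_dvd by (rule dvdE)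
  then have q0: "q \<noteq> 0"
    using Suc.prems by auto
  then have "degree p = Suc (degree q)"
    unfolding q by (subst degree_mult_eq) auto
  then have n: "n = degree q"
    using Suc.hyps(2) by simp
  let ?y = "A *v v - c *s v"
  have "?y \<in> W"
    using Suc.prems W AW by (intro vec.subspace_diff vec.subspace_scale) auto
  then have y: "?y \<in> vec.span ?G"
    using Suc.hyps(1)[OF n q0] Suc.prems(2) unfolding q poly_act_linear_factor by blast
  \<comment> \<open>Generators from \<open>d \<noteq> c\<close> have an exact preimage under
    \<open>A - c\<close>; those from \<open>d = c\<close> are absorbed by the error term.\<close>
  have "\<exists>z\<in>vec.span ?G. y - (A *v z - c *s z) \<in> W \<inter> geig A c" if "y \<in> vec.span ?G" for y
    using that
  proof (induction rule: vec.span_induct_alt)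
    case base
    show ?case
      using vec.subspace_0[OF W] vec.subspace_0[OF subspace_geig]
      by (intro bexI[of _ 0]) (auto simp: vec.span_zero)
  next
    case (step a x y)
    then obtain z where z: "z \<in> vec.span ?G" "y - (A *v z - c *s z) \<in> W \<inter> geig A c"
      by blast
    obtain d where d: "x \<in> W" "x \<in> geig A d"
      using step by blast
    have "\<exists>u\<in>vec.span ?G. x - (A *v u - c *s u) \<in> W \<inter> geig A c"
    proof (cases "d = c")
      case True
      then show ?thesis
        using d by (intro bexI[of _ 0]) (auto simp: vec.span_zero)
    next
      case False
      obtain m where "x \<in> gker A d m"
        using d by (auto simp: geig_def)
      then obtain u where u: "u \<in> W" "u \<in> gker A d m" "A *v u - c *s u = x"
        using gker_shift_preimage[OF W AW, of c d x m] False d by blast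
      then have "u \<in> vec.span ?G"
        using geigI[OF u(2)] u(1) by (intro vec.span_base UN_I[of d]) simp_all
      then show ?thesis
        using u(3) vec.subspace_0[OF W] vec.subspace_0[OF subspace_geig]
        by (intro bexI[of _ u]) auto
    qed
    then obtain u where u: "u \<in> vec.span ?G" "x - (A *v u - c *s u) \<in> W \<inter> geig A c"
      by blast
    have "(a *s x + y) - (A *v (a *s u + z) - c *s (a *s u + z))
        = a *s (x - (A *v u - c *s u)) + (y - (A *v z - c *s z))"
      by (simp add: vec.add vec.scale algebra_simps vec.scale_right_distrib
          vec.scale_right_diff_distrib)
    moreover have "vec.subspace (W \<inter> geig A c)"
      by (intro vec.subspace_inter W subspace_geig)
    ultimately have "(a *s x + y) - (A *v (a *s u + z) - c *s (a *s u + z)) \<in> W \<inter> geig A c"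
      using u(2) z(2) by (simp only: vec.subspace_add vec.subspace_scale)
    moreover have "a *s u + z \<in> vec.span ?G"
      using u z by (intro vec.span_add vec.span_scale)
    ultimately show ?case by blast
  qed
  from this[OF y] obtain z where z: "z \<in> vec.span ?G" "?y - (A *v z - c *s z) \<in> W \<inter> geig A c"
    by blast
  have zW: "z \<in> W"
    using z(1) vec.span_minimal[of ?G W] W by blast
  have "A *v (v - z) - c *s (v - z) = ?y - (A *v z - c *s z)"
    by (simp add: vec.diff vec.scale_right_diff_distrib)
  then have "A *v (v - z) - c *s (v - z) \<in> geig A c"
    using z(2) by (simp only: Int_iff)
  then obtain m where "A *v (v - z) - c *s (v - z) \<in> gker A c m"
    unfolding geig_def by (rule UN_E)
  then have "v - z \<in> geig A c"
    by (intro geigI[of _ A c "Suc m"]) (simp only: gker_Suc_iff)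
  moreover have "v - z \<in> W"
    using Suc.prems(3) zW W by (intro vec.subspace_diff)
  ultimately have "v - z \<in> vec.span ?G"
    by (intro vec.span_base UN_I[of c]) simp_all
  then have "v - z + z \<in> vec.span ?G"
    using z(1) by (rule vec.span_add)
  then show ?case by simp
qed

text \<open>The generality in \<open>W\<close> serves three purposes: it is applied to the whole
  space, to growth spaces, and to eigenspaces of a matrix commuting with \<open>A\<close>.\<close>

theorem invariant_decomposition:
  fixes A :: "complex^'n^'n"
  assumes W: "vec.subspace W" and AW: "\<And>v. v \<in> W \<Longrightarrow> A *v v \<in> W"
  shows "W = subspace_sum (eigvals A) (\<lambda>c. W \<inter> geig A c)"
proof
  have sub: "vec.subspace (W \<inter> geig A c)" for c
    by (intro vec.subspace_inter W subspace_geig)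
  show "subspace_sum (eigvals A) (\<lambda>c. W \<inter> geig A c) \<subseteq> W"
    unfolding subspace_sum_def using W by (auto intro!: vec.subspace_sum)
  show "W \<subseteq> subspace_sum (eigvals A) (\<lambda>c. W \<inter> geig A c)"
  proof
    fix v assume "v \<in> W"
    then have "v \<in> vec.span (\<Union>c. W \<inter> geig A c)"
      using poly_act_annihilator[of A v] poly_act_0_in_span_geig[OF W AW] by blast
    moreover have "(\<Union>c. W \<inter> geig A c) \<subseteq> subspace_sum (eigvals A) (\<lambda>c. W \<inter> geig A c)"
    proof
      fix x assume "x \<in> (\<Union>c. W \<inter> geig A c)"
      then obtain c where c: "x \<in> W" "x \<in> geig A c" by blast
      show "x \<in> subspace_sum (eigvals A) (\<lambda>c. W \<inter> geig A c)"
      proof (cases "x = 0")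
        case True
        then show ?thesis
          using vec.subspace_0[OF subspace_subspace_sum, OF sub] by simp
      next
        case False
        then have "c \<in> eigvals A"
          by (rule eigvalsI[OF _ c(2)])
        then have "x = (\<Sum>k\<in>eigvals A. if k = c then x else 0)"
          by (simp add: finite_eigvals)
        moreover have "\<forall>k\<in>eigvals A. (if k = c then x else 0) \<in> W \<inter> geig A k"
          using c vec.subspace_0[OF sub] by auto
        ultimately show ?thesis
          unfolding subspace_sum_def by blast
      qed
    qed
    ultimately show "v \<in> subspace_sum (eigvals A) (\<lambda>c. W \<inter> geig A c)"
      by (rule rev_subsetD[OF _ vec.span_minimal[OF _ subspace_subspace_sum[OF sub]]])
  qed
qed

section \<open>Growth of orbits\<close>

definition zpow :: "'a::field^'n^'n \<Rightarrow> int \<Rightarrow> 'a^'n^'n"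
  where "zpow A k = (if 0 \<le> k then matrix_power A (nat k) else matrix_power (matrix_inv A) (nat (- k)))"

lemma zpow_0 [simp]: "zpow A 0 = mat 1"
  by (simp add: zpow_def)

lemma matrix_inv_vec:
  fixes A :: "'a::field^'n^'n"
  assumes "invertible A"
  shows "A *v (matrix_inv A *v x) = x" and "matrix_inv A *v (A *v x) = x"
proof -
  have "A ** matrix_inv A = mat 1 \<and> matrix_inv A ** A = mat 1"
    using assms unfolding invertible_def matrix_inv_def by (rule someI_ex)
  then show "A *v (matrix_inv A *v x) = x" "matrix_inv A *v (A *v x) = x"
    by (simp_all add: matrix_vector_mul_assoc)
qed

lemma zpow_Suc:
  fixes A :: "'a::field^'n^'n"
  assumes "invertible A"
  shows "zpow A (k + 1) *v x = A *v (zpow A k *v x)"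
proof (cases "0 \<le> k")
  case True
  then have "nat (k + 1) = Suc (nat k)"
    by simp
  with True show ?thesis
    by (simp add: zpow_def matrix_vector_mul_assoc)
next
  case False
  define j where "j = nat (- (k + 1))"
  have j: "nat (- k) = Suc j" "0 \<le> k + 1 \<Longrightarrow> j = 0" "nat (k + 1) = 0"
    using False by (simp_all add: j_def)
  have "zpow A (k + 1) = matrix_power (matrix_inv A) j"
    using j by (cases "0 \<le> k + 1") (simp_all add: zpow_def j_def)
  moreover have "zpow A k = matrix_inv A ** matrix_power (matrix_inv A) j"
    using False j(1) by (simp add: zpow_def)
  ultimately show ?thesis
    by (simp add: matrix_vector_mul_assoc[symmetric] matrix_inv_vec[OF assms])
qed

text \<open>The working principle for integer powers: an identity about them is proved by exhibiting
  a two-sided sequence that satisfies the one-step recursion, with no separate treatment of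
  signs.\<close>

lemma zpow_unique:
  fixes A :: "'a::field^'n^'n" and u :: "int \<Rightarrow> 'a^'n"
  assumes A: "invertible A" and u: "\<And>k. u (k + 1) = A *v u k"
  shows "u k = zpow A k *v u 0"
proof (induction k rule: int_induct[of _ 0])
  case (step1 i)
  then show ?case
    by (simp add: u zpow_Suc[OF A])
next
  case (step2 i)
  have "A *v u (i - 1) = A *v (zpow A (i - 1) *v u 0)"
    using step2 u[of "i - 1"] zpow_Suc[OF A, of "i - 1" "u 0"] by simp
  then show ?case
    using inj_matrix_vector_mult[OF A] by (simp add: inj_def)
qed simp

lemma zpow_add:
  fixes A :: "'a::field^'n^'n"
  assumes "invertible A"
  shows "zpow A (j + k) *v x = zpow A j *v (zpow A k *v x)"
  using zpow_unique[OF assms, of "\<lambda>i. zpow A (i + k) *v x" j] zpow_Suc[OF assms, of "_ + k" x]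
  by (simp add: algebra_simps)

lemma zpow_commute:
  fixes A B :: "'a::field^'n^'n"
  assumes "invertible A" and "\<And>x. A *v (B *v x) = B *v (A *v x)"
  shows "zpow A k *v (B *v x) = B *v (zpow A k *v x)"
  using zpow_unique[OF assms(1), of "\<lambda>i. B *v (zpow A i *v x)" k]
  by (simp add: zpow_Suc[OF assms(1)] assms(2))

lemma zpow_minus:
  fixes A :: "'a::field^'n^'n"
  assumes "invertible A"
  shows "zpow A (- k) *v (zpow A k *v x) = x" and "zpow A k *v (zpow A (- k) *v x) = x"
  using zpow_add[OF assms, of "- k" k x] zpow_add[OF assms, of k "- k" x] by simp_all

lemma norm_smult_complex: "norm (c *s (v::complex^'n)) = cmod c * norm v"
  by (simp add: norm_vec_def norm_mult L2_set_right_distrib)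

lemma matrix_bounded:
  fixes M :: "complex^'n^'m"
  obtains B where "0 < B" and "\<And>x. norm (M *v x) \<le> B * norm x"
  using bounded_linear.pos_bounded[OF matrix_vector_mul_bounded_linear[of M]]
  by (auto simp: mult.commute)

lemma lin_bounded:
  fixes f :: "complex^'n \<Rightarrow> complex^'m"
  assumes "lin f"
  obtains B where "0 < B" and "\<And>x. norm (f x) \<le> B * norm x"
  using matrix_bounded[of "matrix f"] by (auto simp: matrix_works[OF assms])

definition growth :: "complex^'n^'n \<Rightarrow> real \<Rightarrow> nat \<Rightarrow> (complex^'n) set"
  where "growth A r d =
    {x. \<exists>C. \<forall>k::int. norm (zpow A k *v x) \<le> C * r powr k * (1 + \<bar>real_of_int k\<bar>) ^ d}"

lemma growthI:
  "(\<And>k. norm (zpow A k *v x) \<le> C * r powr real_of_int k * (1 + \<bar>real_of_int k\<bar>) ^ d) \<Longrightarrow> x \<in> growth A r d"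
  by (auto simp: growth_def)

lemma growthE:
  assumes "x \<in> growth A r d"
  obtains C where "0 \<le> C"
    and "\<And>k. norm (zpow A k *v x) \<le> C * r powr real_of_int k * (1 + \<bar>real_of_int k\<bar>) ^ d"
proof -
  obtain C where C: "\<And>k. norm (zpow A k *v x) \<le> C * r powr real_of_int k * (1 + \<bar>real_of_int k\<bar>) ^ d"
    using assms by (auto simp: growth_def)
  have "norm (zpow A k *v x) \<le> max 0 C * r powr real_of_int k * (1 + \<bar>real_of_int k\<bar>) ^ d" for k
    by (rule order_trans[OF C]) (intro mult_right_mono, auto)
  then show ?thesis
    by (intro that[of "max 0 C"]) auto
qed

lemma growth_lin_image:
  assumes "x \<in> growth A r d" and "\<And>k. norm (zpow B k *v y) \<le> D * norm (zpow A k *v x)" and "0 \<le> D"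
  shows "y \<in> growth B r d"
proof -
  obtain C where C: "\<And>k. norm (zpow A k *v x) \<le> C * r powr real_of_int k * (1 + \<bar>real_of_int k\<bar>) ^ d"
    using growthE[OF assms(1)] by metis
  have "norm (zpow B k *v y) \<le> (D * C) * r powr real_of_int k * (1 + \<bar>real_of_int k\<bar>) ^ d" for k
    using order_trans[OF assms(2) mult_left_mono[OF C assms(3)]] by (simp add: mult.assoc)
  then show ?thesis by (rule growthI)
qed

lemma subspace_growth: "vec.subspace (growth A r d)"
  unfolding vec.subspace_def
proof (intro conjI ballI allI)
  show "0 \<in> growth A r d"
    by (rule growthI[of _ _ 0]) simp
next
  fix x y assume "x \<in> growth A r d" "y \<in> growth A r d"
  then obtain C D where
    C: "\<And>k. norm (zpow A k *v x) \<le> C * r powr real_of_int k * (1 + \<bar>real_of_int k\<bar>) ^ d" and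
    D: "\<And>k. norm (zpow A k *v y) \<le> D * r powr real_of_int k * (1 + \<bar>real_of_int k\<bar>) ^ d"
    using growthE by metis
  show "x + y \<in> growth A r d"
  proof (rule growthI)
    fix k
    have "norm (zpow A k *v (x + y)) \<le> norm (zpow A k *v x) + norm (zpow A k *v y)"
      by (simp add: vec.add norm_triangle_ineq)
    also have "\<dots> \<le> (C + D) * r powr real_of_int k * (1 + \<bar>real_of_int k\<bar>) ^ d"
      using add_mono[OF C D] by (simp add: distrib_right)
    finally show "norm (zpow A k *v (x + y)) \<le> (C + D) * r powr real_of_int k * (1 + \<bar>real_of_int k\<bar>) ^ d" .
  qed
next
  fix c x assume "x \<in> growth A r d"
  then show "c *s x \<in> growth A r d"
    by (rule growth_lin_image[where D = "cmod c"]) (simp_all add: vec.scale norm_smult_complex)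
qed

lemma growth_commute:
  assumes "invertible A" and "x \<in> growth A r d" and "\<And>x. A *v (B *v x) = B *v (A *v x)"
  shows "B *v x \<in> growth A r d"
proof -
  obtain D where D: "0 < D" "\<And>x. norm (B *v x) \<le> D * norm x"
    using matrix_bounded by blast
  then have "norm (zpow A k *v (B *v x)) \<le> D * norm (zpow A k *v x)" for k
    unfolding zpow_commute[OF assms(1,3)] by blast
  then show ?thesis
    using D(1) by (intro growth_lin_image[OF assms(2)]) auto
qed

section \<open>Binomial powers on generalized eigenspaces\<close>

lemma norm_gbinomial_le: "cmod (a gchoose i) \<le> (1 + cmod a) ^ i"
proof (induction i)
  case (Suc i)
  have "of_nat (Suc i) * (a gchoose Suc i) = (a - of_nat i) * (a gchoose i)"
    using gbinomial_mult_1[of a i] by (simp add: algebra_simps)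
  then have "real (Suc i) * cmod (a gchoose Suc i) = cmod (a - of_nat i) * cmod (a gchoose i)"
    by (metis norm_mult norm_of_nat)
  \<comment> \<open>The factor \<open>i + 1\<close> from the recursion absorbs the \<open>i\<close>
    in \<open>|a - i|\<close>, so each index costs only one factor \<open>1 + |a|\<close>.\<close>
  also have "\<dots> \<le> (real (Suc i) * (1 + cmod a)) * (1 + cmod a) ^ i"
  proof (rule mult_mono[OF _ Suc])
    have "cmod (a - of_nat i) \<le> cmod a + real i"
      using norm_triangle_ineq4[of a "of_nat i"] by simp
    also have "\<dots> \<le> real (Suc i) * (1 + cmod a)"
      by (simp add: algebra_simps)
    finally show "cmod (a - of_nat i) \<le> real (Suc i) * (1 + cmod a)" .
  qed auto
  finally have "real (Suc i) * cmod (a gchoose Suc i) \<le> real (Suc i) * (1 + cmod a) ^ Suc i"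
    by (simp add: mult_ac)
  then show ?case
    by (simp add: mult_le_cancel_left_pos del: of_nat_Suc)
qed simp

text \<open>On the generalized eigenspace of \<open>c\<close> this is the binomial series of \<open>(1 + (A - c) / c)\<^sup>t\<close>, so that
  \<open>c\<^sup>t\<close> times it is a power of \<open>A\<close>.\<close>

definition bflow :: "complex^'n^'n \<Rightarrow> complex \<Rightarrow> nat \<Rightarrow> complex \<Rightarrow> complex^'n \<Rightarrow> complex^'n"
  where "bflow A c K t v =
    (\<Sum>i<K. ((t gchoose i) * inverse c ^ i) *s (matrix_power (A - mat c) i *v v))"

lemma lin_bflow: "lin (bflow A c K t)"
  unfolding bflow_def
  by (intro lin_sum_fun lin_smult matrix_vector_mul_linear_gen)

lemma gker_matrix_power_0:
  assumes "v \<in> gker A c m" and "m \<le> i"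
  shows "matrix_power (A - mat c) i *v v = 0"
  using gker_mono[OF assms(2), of A c] assms(1) by (auto simp: gker_def)

lemma bflow_truncate:
  assumes "v \<in> gker A c m" and "m \<le> K"
  shows "bflow A c K t v = bflow A c m t v"
  unfolding bflow_def using assms(2) gker_matrix_power_0[OF assms(1)]
  by (intro sum.mono_neutral_right) auto

lemma bflow_commute:
  assumes "\<And>v. A *v (B *v v) = B *v (A *v v)"
  shows "bflow A c K t (B *v v) = B *v bflow A c K t v"
proof -
  have "matrix_power (A - mat c) i *v (B *v v) = B *v (matrix_power (A - mat c) i *v v)" for i
    by (rule matrix_power_commute_vec) (simp add: shift_vec assms vec.diff vec.scale)
  then show ?thesis
    by (simp only: bflow_def vec.sum vec.scale)
qed

lemma bflow_gker: "v \<in> gker A c m \<Longrightarrow> bflow A c K t v \<in> gker A c m"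
  unfolding bflow_def
proof (intro vec.subspace_sum vec.subspace_scale subspace_gker)
  fix i assume "v \<in> gker A c m"
  then show "matrix_power (A - mat c) i *v v \<in> gker A c m"
  proof (rule gker_commute)
    show "A *v (matrix_power (A - mat c) i *v v) = matrix_power (A - mat c) i *v (A *v v)" for v
      by (rule matrix_power_commute_vec[symmetric]) (simp add: shift_vec vec.diff vec.scale)
  qed
qed

lemma bflow_0: "0 < K \<Longrightarrow> bflow A c K 0 v = v"
proof -
  assume "0 < K"
  have "bflow A c K 0 v = (\<Sum>i\<in>{0}. ((0 gchoose i) * inverse c ^ i) *s (matrix_power (A - mat c) i *v v))"
    unfolding bflow_def using \<open>0 < K\<close>
    by (intro sum.mono_neutral_right) (auto simp: gbinomial_0_left)
  then show ?thesis by simp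
qed

lemma bflow_1:
  assumes "2 \<le> K" and "c \<noteq> 0"
  shows "bflow A c K 1 v = inverse c *s (A *v v)"
proof -
  have g: "(1::complex) gchoose i = 0" if "i \<notin> {0, Suc 0}" for i
    using that binomial_gbinomial[of 1 i, where 'a = complex] by (simp add: binomial_eq_0)
  have "bflow A c K 1 v
      = (\<Sum>i\<in>{0, Suc 0}. ((1 gchoose i) * inverse c ^ i) *s (matrix_power (A - mat c) i *v v))"
    unfolding bflow_def using assms(1) g
    by (intro sum.mono_neutral_right) auto
  also have "\<dots> = v + inverse c *s (A *v v - c *s v)"
    by (simp add: shift_vec)
  also have "\<dots> = inverse c *s (A *v v) + (v - (inverse c * c) *s v)"
    by (simp only: vec.scale_right_diff_distrib vec.scale_scale) (simp only: algebra_simps)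
  finally show ?thesis
    using assms(2) by simp
qed

text \<open>Terms with \<open>i + j \<ge> K\<close> kill \<open>v\<close>, so the square of index
  pairs collapses to a triangle, on whose diagonals the Vandermonde convolution applies.\<close>

lemma bflow_add:
  assumes "v \<in> gker A c K"
  shows "bflow A c K s (bflow A c K t v) = bflow A c K (s + t) v"
proof -
  let ?N = "\<lambda>i. matrix_power (A - mat c) i"
  let ?g = "\<lambda>i j. ((s gchoose i) * (t gchoose j) * inverse c ^ (i + j)) *s (?N (i + j) *v v)"
  have nz: "i < K" if "?N i *v v \<noteq> 0" for i
    using gker_matrix_power_0[OF assms, of i] that not_less by blast
  have "bflow A c K s (bflow A c K t v) = (\<Sum>i<K. \<Sum>j<K. ?g i j)"
    by (simp only: bflow_def vec.sum vec.scale vec.scale_sum_right vec.scale_scale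
        matrix_power_add_vec power_add mult_ac)
  also have "\<dots> = (\<Sum>(i, j)\<in>{..<K} \<times> {..<K}. ?g i j)"
    by (rule sum.cartesian_product)
  also have "\<dots> = (\<Sum>(i, j)\<in>{(i, j). i + j < K}. ?g i j)"
    using nz by (intro sum.mono_neutral_right) auto
  also have "\<dots> = (\<Sum>k<K. \<Sum>i\<le>k. ?g i (k - i))"
    by (rule sum.triangle_reindex)
  also have "\<dots> = (\<Sum>k<K. (((s + t) gchoose k) * inverse c ^ k) *s (?N k *v v))"
  proof (rule sum.cong[OF refl])
    fix k
    have "(\<Sum>i\<le>k. ?g i (k - i))
        = (\<Sum>i\<le>k. ((s gchoose i) * (t gchoose (k - i)) * inverse c ^ k) *s (?N k *v v))"
      by (intro sum.cong refl) simp
    also have "\<dots> = ((\<Sum>i\<le>k. (s gchoose i) * (t gchoose (k - i))) * inverse c ^ k) *s (?N k *v v)"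
      by (simp only: vec.scale_sum_left sum_distrib_right)
    finally show "(\<Sum>i\<le>k. ?g i (k - i)) = (((s + t) gchoose k) * inverse c ^ k) *s (?N k *v v)"
      using gbinomial_Vandermonde[of s t k] by (simp add: atMost_atLeast0)
  qed
  finally show ?thesis
    unfolding bflow_def .
qed

text \<open>The \<open>Suc d\<close> terms have index at most \<open>d\<close>, and the term of
  index \<open>i\<close> is bounded by a multiple of \<open>(1 + |t|)^i\<close>. This is why the
  growth exponent is one less than the exponent in \<open>gker\<close>.\<close>

lemma bflow_bound:
  obtains C where "0 < C" and "\<And>t v. norm (bflow A c (Suc d) t v) \<le> C * (1 + cmod t) ^ d * norm v"
proof -
  have "\<exists>B>0. \<forall>v. norm (matrix_power (A - mat c) i *v v) \<le> B * norm v" for i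
    by (rule matrix_bounded[of "matrix_power (A - mat c) i"]) blast
  then obtain B where B: "\<And>i. 0 < B i" "\<And>i v. norm (matrix_power (A - mat c) i *v v) \<le> B i * norm v"
    by metis
  let ?C = "1 + (\<Sum>i<Suc d. cmod (inverse c ^ i) * B i)"
  have "0 \<le> (\<Sum>i<Suc d. cmod (inverse c ^ i) * B i)"
    using B(1) by (intro sum_nonneg mult_nonneg_nonneg) (auto intro: less_imp_le)
  moreover have "norm (bflow A c (Suc d) t v) \<le> ?C * (1 + cmod t) ^ d * norm v" for t v
  proof -
    have "norm (bflow A c (Suc d) t v)
        \<le> (\<Sum>i<Suc d. norm (((t gchoose i) * inverse c ^ i) *s (matrix_power (A - mat c) i *v v)))"
      unfolding bflow_def by (rule norm_sum)
    also have "\<dots> \<le> (\<Sum>i<Suc d. (cmod (inverse c ^ i) * B i) * ((1 + cmod t) ^ d * norm v))"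
    proof (rule sum_mono)
      fix i assume "i \<in> {..<Suc d}"
      then have "(1 + cmod t) ^ i \<le> (1 + cmod t) ^ d"
        by (intro power_increasing) auto
      then have "cmod (t gchoose i) \<le> (1 + cmod t) ^ d"
        using norm_gbinomial_le[of t i] by linarith
      then have "cmod (t gchoose i) * (cmod (inverse c ^ i) * norm (matrix_power (A - mat c) i *v v))
          \<le> (1 + cmod t) ^ d * (cmod (inverse c ^ i) * (B i * norm v))"
        using B by (intro mult_mono mult_nonneg_nonneg) auto
      then show "norm (((t gchoose i) * inverse c ^ i) *s (matrix_power (A - mat c) i *v v))
          \<le> (cmod (inverse c ^ i) * B i) * ((1 + cmod t) ^ d * norm v)"
        by (simp only: norm_smult_complex norm_mult mult_ac)
    qed
    also have "\<dots> = (\<Sum>i<Suc d. cmod (inverse c ^ i) * B i) * ((1 + cmod t) ^ d * norm v)"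
      by (rule sum_distrib_right[symmetric])
    also have "\<dots> \<le> ?C * ((1 + cmod t) ^ d * norm v)"
      by (intro mult_right_mono) auto
    finally show ?thesis
      by (simp only: mult.assoc)
  qed
  ultimately show ?thesis
    by (intro that[of ?C]) linarith+
qed

text \<open>At time 1 the binomial series is \<open>1 + (A - c) / c = A / c\<close>, so the
  right-hand side satisfies the one-step recursion; \<open>K \<ge> 2\<close> makes the linear term
  available.\<close>

lemma zpow_gker:
  assumes A: "invertible A" and c: "c \<noteq> 0" and K: "2 \<le> K" and v: "v \<in> gker A c K"
  shows "zpow A k *v v = (c powi k) *s bflow A c K (of_int k) v"
proof -
  define u where "u = (\<lambda>k. (c powi k) *s bflow A c K (of_int k) v)"
  have "u (k + 1) = A *v u k" for k
  proof -
    have "bflow A c K (of_int (k + 1)) v = bflow A c K 1 (bflow A c K (of_int k) v)"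
      using bflow_add[OF v, of 1 "of_int k"] by (simp add: add.commute)
    also have "\<dots> = inverse c *s (A *v bflow A c K (of_int k) v)"
      by (rule bflow_1[OF K c])
    finally have "u (k + 1) = (c powi (k + 1) * inverse c) *s (A *v bflow A c K (of_int k) v)"
      by (simp only: u_def vec.scale_scale)
    also have "c powi (k + 1) * inverse c = c powi k"
      using c by (simp add: power_int_add)
    finally show ?thesis
      by (simp only: u_def vec.scale)
  qed
  then have "u k = zpow A k *v u 0"
    by (rule zpow_unique[OF A, of u])
  moreover have "u 0 = v"
    using K by (simp add: u_def bflow_0)
  ultimately show ?thesis
    by (simp add: u_def)
qed

lemma norm_powi: "c \<noteq> 0 \<Longrightarrow> cmod (c powi k) = cmod c powr real_of_int k"
  by (simp add: norm_power_int powr_real_of_int')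

lemma eigvals_nonzero:
  fixes A :: "'a::field^'n^'n"
  assumes "invertible A" and "c \<in> eigvals A"
  shows "c \<noteq> 0"
proof
  assume "c = 0"
  then obtain v where "v \<noteq> 0" "A *v v = 0"
    using assms(2) by (auto simp: eigvals_def)
  then show False
    using matrix_inv_vec(2)[OF assms(1), of v] by simp
qed

lemma gker_subset_growth:
  assumes A: "invertible A" and c: "c \<noteq> 0"
  shows "gker A c (Suc d) \<subseteq> growth A (cmod c) d"
proof
  fix v assume v: "v \<in> gker A c (Suc d)"
  \<comment> \<open>The larger exponent only meets the requirement \<open>2 \<le> K\<close>;
    truncation then returns to \<open>Suc d\<close> terms and so to the growth exponent
    \<open>d\<close>.\<close>
  then have v2: "v \<in> gker A c (Suc (Suc d))"
    using gker_mono[of "Suc d" "Suc (Suc d)" A c] by auto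
  obtain C where C: "\<And>t v. norm (bflow A c (Suc d) t v) \<le> C * (1 + cmod t) ^ d * norm v"
    using bflow_bound by metis
  show "v \<in> growth A (cmod c) d"
  proof (rule growthI)
    fix k :: int
    have "zpow A k *v v = (c powi k) *s bflow A c (Suc d) (of_int k) v"
      using zpow_gker[OF A c _ v2] bflow_truncate[OF v, of "Suc (Suc d)"] by simp
    then have "norm (zpow A k *v v) = cmod c powr real_of_int k * norm (bflow A c (Suc d) (of_int k) v)"
      by (simp only: norm_smult_complex norm_powi[OF c])
    also have "\<dots> \<le> cmod c powr real_of_int k * (C * (1 + cmod (of_int k)) ^ d * norm v)"
      by (intro mult_left_mono C) simp
    finally show "norm (zpow A k *v v)
        \<le> (C * norm v) * cmod c powr real_of_int k * (1 + \<bar>real_of_int k\<bar>) ^ d"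
      by (simp add: mult_ac)
  qed
qed

lemma power_not_le_smaller_power:
  fixes a C :: real
  assumes "0 < a" and "\<And>n::nat. N \<le> n \<Longrightarrow> a * real n ^ Suc d \<le> C * (1 + real n) ^ d"
  shows False
proof -
  obtain n where n: "N < n" "\<bar>C\<bar> * 2 ^ d / a < real n"
    using reals_Archimedean2[of "max (real N) (\<bar>C\<bar> * 2 ^ d / a)"] by auto
  then have n1: "1 \<le> real n" by simp
  have "a * real n ^ Suc d \<le> C * (1 + real n) ^ d"
    using n by (intro assms(2)) simp
  also have "\<dots> \<le> \<bar>C\<bar> * (2 * real n) ^ d"
    using n1 by (intro mult_mono power_mono) auto
  also have "\<dots> = \<bar>C\<bar> * 2 ^ d * real n ^ d"
    by (simp add: power_mult_distrib)
  finally have "(a * real n) * real n ^ d \<le> (\<bar>C\<bar> * 2 ^ d) * real n ^ d"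
    by (simp add: mult_ac)
  then have "a * real n \<le> \<bar>C\<bar> * 2 ^ d"
    using n1 by (simp add: mult_le_cancel_right)
  then show False
    using n(2) assms(1) by (simp add: field_simps)
qed

text \<open>If \<open>|c| \<noteq> r\<close>, then \<open>(|c| / r)^k\<close> grows exponentially as
  \<open>k\<close> tends to one of the two infinities, the sign of \<open>q\<close> deciding which,
  and beats the polynomial bound.\<close>

lemma growth_eigenvector:
  assumes A: "invertible A" and r: "0 < r" and y: "y \<in> growth A r d" "y \<noteq> 0" "A *v y = c *s y"
  shows "cmod c = r"
proof (rule ccontr)
  assume neq: "cmod c \<noteq> r"
  have c: "c \<noteq> 0"
    using eigvals_nonzero[OF A] y by (auto simp: eigvals_def)
  obtain C where C: "\<And>k. norm (zpow A k *v y) \<le> C * r powr real_of_int k * (1 + \<bar>real_of_int k\<bar>) ^ d"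
    using growthE[OF y(1)] by metis
  have "y \<in> gker A c 1"
    using y(3) unfolding gker_1_iff .
  then have "zpow A k *v y = (c powi k) *s bflow A c 1 (of_int k) y" for k
    using zpow_gker[OF A c, of 2 y k] bflow_truncate[of y A c 1 2] gker_mono[of 1 2 A c] by auto
  then have zp: "zpow A k *v y = (c powi k) *s y" for k
    by (simp add: bflow_def)
  define q where "q = ln (cmod c / r)"
  have q: "q \<noteq> 0"
    using neq c r by (simp add: q_def ln_div)
  have ineq: "exp (q * real_of_int k) * norm y \<le> C * (1 + \<bar>real_of_int k\<bar>) ^ d" for k
  proof -
    have "cmod c powr real_of_int k * norm y \<le> C * r powr real_of_int k * (1 + \<bar>real_of_int k\<bar>) ^ d"
      using C[of k] unfolding zp norm_smult_complex norm_powi[OF c] .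
    moreover have "cmod c powr real_of_int k = exp (q * real_of_int k) * r powr real_of_int k"
      using c r by (simp add: q_def ln_div powr_def left_diff_distrib flip: exp_add)
    ultimately have "r powr real_of_int k * (exp (q * real_of_int k) * norm y)
        \<le> r powr real_of_int k * (C * (1 + \<bar>real_of_int k\<bar>) ^ d)"
      by (simp add: mult_ac)
    then show ?thesis
      using r by (simp add: mult_le_cancel_left)
  qed
  have ineq': "exp (\<bar>q\<bar> * real n) * norm y \<le> C * (1 + real n) ^ d" for n
    using ineq[of "int n"] ineq[of "- int n"] by (cases "0 \<le> q") auto
  \<comment> \<open>From \<open>exp x \<ge> (1 + x / N)^N\<close> with \<open>N = d + 1\<close>, a
    power one higher than the bound allows.\<close>
  define a where "a = (\<bar>q\<bar> / real (Suc d)) ^ Suc d * norm y"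
  have "0 < a"
    using q y(2) by (simp add: a_def)
  moreover have "a * real n ^ Suc d \<le> C * (1 + real n) ^ d" for n
  proof -
    have "(\<bar>q\<bar> * real n / real (Suc d)) ^ Suc d \<le> (1 + \<bar>q\<bar> * real n / real (Suc d)) ^ Suc d"
      by (intro power_mono) auto
    also have "\<dots> \<le> exp (\<bar>q\<bar> * real n)"
      by (rule exp_ge_one_plus_x_over_n_power_n) (auto intro: order_trans[of _ 0])
    finally have "(\<bar>q\<bar> * real n / real (Suc d)) ^ Suc d * norm y \<le> exp (\<bar>q\<bar> * real n) * norm y"
      by (intro mult_right_mono) auto
    then show ?thesis
      using ineq'[of n] by (simp add: a_def power_mult_distrib power_divide mult_ac del: power_Suc of_nat_Suc)
  qed
  ultimately show False
    using power_not_le_smaller_power[of a 0 d C] by blast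
qed

lemma growth_matrix_power:
  assumes "invertible A" and "v \<in> growth A r d"
  shows "matrix_power (A - mat c) j *v v \<in> growth A r d"
  by (rule growth_commute[OF assms], rule matrix_power_commute_vec[symmetric])
    (simp add: shift_vec vec.diff vec.scale)

text \<open>The growth space is invariant under \<open>A - c\<close>, so it contains an eigenvector
  derived from \<open>v\<close>, which fixes \<open>|c|\<close>. If \<open>v\<close> survived the
  power \<open>d + 1\<close>, some iterate \<open>z\<close> would have least exponent
  \<open>d + 2\<close>; the top term of its binomial series carries \<open>n choose (d + 1)\<close>,
  of order \<open>n^(d+1)\<close>, and cannot be cancelled by the lower terms.\<close>

lemma growth_geig:
  assumes A: "invertible A" and r: "0 < r" and v: "v \<in> growth A r d" "v \<in> geig A c" "v \<noteq> 0"
  shows "cmod c = r" and "v \<in> gker A c (Suc d)"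
proof -
  obtain p where p: "v \<in> gker A c p"
    using v(2) by (auto simp: geig_def)
  moreover have "v \<notin> gker A c 0"
    using v(3) by (simp add: gker_0)
  ultimately obtain j where j: "matrix_power (A - mat c) j *v v \<in> gker A c (Suc 0)"
      "matrix_power (A - mat c) j *v v \<notin> gker A c 0"
    by (rule gker_step)
  show cr: "cmod c = r"
  proof (rule growth_eigenvector[OF A r growth_matrix_power[OF A v(1), of c j]])
    show "matrix_power (A - mat c) j *v v \<noteq> 0"
      using j(2) by (simp add: gker_0)
    show "A *v (matrix_power (A - mat c) j *v v) = c *s (matrix_power (A - mat c) j *v v)"
      using j(1) gker_1_iff by (metis One_nat_def)
  qed
  have c: "c \<noteq> 0"
    using cr r by auto
  show "v \<in> gker A c (Suc d)"
  proof (rule ccontr)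
    assume "v \<notin> gker A c (Suc d)"
    with p obtain j where j: "matrix_power (A - mat c) j *v v \<in> gker A c (Suc (Suc d))"
        "matrix_power (A - mat c) j *v v \<notin> gker A c (Suc d)"
      by (rule gker_step)
    define z where "z = matrix_power (A - mat c) j *v v"
    define w where "w = matrix_power (A - mat c) (Suc d) *v z"
    have w: "w \<noteq> 0"
      using j(2) by (simp only: w_def z_def gker_def mem_Collect_eq not_False_eq_True)
    have zK: "z \<in> gker A c (Suc (Suc d))"
      using j(1) by (simp only: z_def)
    have "z \<in> growth A r d"
      unfolding z_def by (rule growth_matrix_power[OF A v(1)])
    then obtain C where
      C: "\<And>k. norm (zpow A k *v z) \<le> C * r powr real_of_int k * (1 + \<bar>real_of_int k\<bar>) ^ d"
      by (metis growthE)
    obtain D where D: "\<And>t v. norm (bflow A c (Suc d) t v) \<le> D * (1 + cmod t) ^ d * norm v"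
      using bflow_bound by metis
    \<comment> \<open>Combines \<open>n choose (d + 1) \<ge> (n / (d + 1))^(d+1)\<close> with the
      factor \<open>|c|^(-(d+1))\<close> of the top term, where \<open>|c| = r\<close>.\<close>
    define a where "a = norm w / (r * real (Suc d)) ^ Suc d"
    have "0 < a"
      using w r by (simp add: a_def)
    moreover have "a * real n ^ Suc d \<le> (C + D * norm z) * (1 + real n) ^ d" if "Suc d \<le> n" for n
    proof -
      let ?b = "((of_nat n gchoose Suc d) * inverse c ^ Suc d) *s w"
      have split: "bflow A c (Suc (Suc d)) (of_nat n) z = bflow A c (Suc d) (of_nat n) z + ?b"
        by (simp only: bflow_def sum.lessThan_Suc[of _ "Suc d"] w_def)
      have "norm (zpow A (int n) *v z) = r powr real_of_int (int n) * norm (bflow A c (Suc (Suc d)) (of_nat n) z)"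
        using zpow_gker[OF A c _ zK, of "int n"] norm_powi[OF c, of "int n"] cr
        by (simp add: norm_smult_complex)
      then have "r powr real_of_int (int n) * norm (bflow A c (Suc (Suc d)) (of_nat n) z)
          \<le> r powr real_of_int (int n) * (C * (1 + real n) ^ d)"
        using C[of "int n"] by (simp add: mult_ac)
      then have "norm (bflow A c (Suc (Suc d)) (of_nat n) z) \<le> C * (1 + real n) ^ d"
        using r by (simp add: mult_le_cancel_left)
      moreover have "norm (bflow A c (Suc d) (of_nat n) z) \<le> D * (1 + real n) ^ d * norm z"
        using D[of "of_nat n" z] by simp
      moreover have "norm ?b \<le> norm (bflow A c (Suc (Suc d)) (of_nat n) z) + norm (bflow A c (Suc d) (of_nat n) z)"
        unfolding split using norm_triangle_ineq4[of "bflow A c (Suc d) (of_nat n) z + ?b" "bflow A c (Suc d) (of_nat n) z"]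
        by (simp only: add_diff_cancel_left')
      ultimately have "norm ?b \<le> (C + D * norm z) * (1 + real n) ^ d"
        by (simp add: algebra_simps)
      moreover have "a * real n ^ Suc d \<le> norm ?b"
      proof -
        have "(real n / real (Suc d)) ^ Suc d \<le> real (n choose Suc d)"
          using binomial_ge_n_over_k_pow_k[OF that, where 'a = real] by simp
        moreover have "cmod (of_nat n gchoose Suc d) = real (n choose Suc d)"
          by (metis binomial_gbinomial norm_of_nat)
        moreover have "cmod (inverse c ^ Suc d) = inverse (r ^ Suc d)"
          using cr by (simp only: norm_power norm_inverse power_inverse)
        ultimately have "(real n / real (Suc d)) ^ Suc d * (inverse (r ^ Suc d) * norm w) \<le> norm ?b"
          using r by (simp only: norm_smult_complex norm_mult mult.assoc) (intro mult_right_mono, auto)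
        then show ?thesis
          by (simp only: a_def power_divide power_mult_distrib divide_inverse inverse_mult_distrib power_inverse mult_ac)
      qed
      ultimately show ?thesis by linarith
    qed
    ultimately show False
      by (rule power_not_le_smaller_power)
  qed
qed

text \<open>Invariance splits the growth space along generalized eigenspaces, and
  \<open>growth_geig\<close> confines each nonzero piece to modulus \<open>r\<close> and exponent
  \<open>d + 1\<close>.\<close>

theorem growth_eq_subspace_sum:
  assumes A: "invertible A" and r: "0 < r"
  shows "growth A r d = subspace_sum {c \<in> eigvals A. cmod c = r} (\<lambda>c. gker A c (Suc d))"
    (is "_ = subspace_sum ?I _")
proof
  show "growth A r d \<subseteq> subspace_sum ?I (\<lambda>c. gker A c (Suc d))"
  proof
    fix v assume "v \<in> growth A r d"
    then have "v \<in> subspace_sum (eigvals A) (\<lambda>c. growth A r d \<inter> geig A c)"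
      using invariant_decomposition[OF subspace_growth growth_commute[OF A], of r d A] by blast
    then obtain y where y: "v = sum y (eigvals A)" "\<forall>c\<in>eigvals A. y c \<in> growth A r d \<inter> geig A c"
      by (auto simp: subspace_sum_def)
    have "v = sum y ?I"
      unfolding y(1) using growth_geig(1)[OF A r] y(2)
      by (intro sum.mono_neutral_right finite_eigvals) blast+
    moreover have "y c \<in> gker A c (Suc d)" if "c \<in> ?I" for c
      using growth_geig(2)[OF A r, of "y c" d c] y(2) that zero_in_gker by (cases "y c = 0") auto
    ultimately show "v \<in> subspace_sum ?I (\<lambda>c. gker A c (Suc d))"
      unfolding subspace_sum_def by blast
  qed
  show "subspace_sum ?I (\<lambda>c. gker A c (Suc d)) \<subseteq> growth A r d"
  proof
    fix v assume "v \<in> subspace_sum ?I (\<lambda>c. gker A c (Suc d))"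
    then obtain y where y: "v = sum y ?I" "\<forall>c\<in>?I. y c \<in> gker A c (Suc d)"
      by (auto simp: subspace_sum_def)
    have "y c \<in> growth A r d" if "c \<in> ?I" for c
      using gker_subset_growth[OF A, of c d] eigvals_nonzero[OF A, of c] y(2) that by auto
    then show "v \<in> growth A r d"
      unfolding y(1) by (intro vec.subspace_sum subspace_growth) blast
  qed
qed

corollary dim_growth:
  assumes "invertible A" and "0 < r"
  shows "vec.dim (growth A r d) = (\<Sum>c | c \<in> eigvals A \<and> cmod c = r. vec.dim (gker A c (Suc d)))"
  unfolding growth_eq_subspace_sum[OF assms]
proof (rule dim_subspace_sum)
  let ?I = "{c \<in> eigvals A. cmod c = r}"
  show fin: "finite ?I"
    using finite_eigvals[of A] by simp
  show "independent_family ?I (\<lambda>c. gker A c (Suc d))"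
    by (rule independent_subfamily[OF independent_geig[OF fin]]) (auto intro: geigI)
qed (rule subspace_gker)

section \<open>Real powers of the modulus of a matrix, and similarity of complex matrices\<close>

lemma subspace_sum_geig_UNIV:
  fixes A :: "complex^'n^'n"
  shows "subspace_sum (eigvals A) (geig A) = UNIV"
  using invariant_decomposition[of UNIV A] by simp

lemma lin_eq_on_geig:
  fixes A :: "complex^'n^'n"
  assumes f: "lin f" and g: "lin g" and eq: "\<And>c x. c \<in> eigvals A \<Longrightarrow> x \<in> geig A c \<Longrightarrow> f x = g x"
  shows "f x = g x"
proof -
  have "x \<in> subspace_sum (eigvals A) (geig A)"
    by (simp only: subspace_sum_geig_UNIV UNIV_I)
  then obtain y where y: "x = sum y (eigvals A)" "\<forall>c\<in>eigvals A. y c \<in> geig A c"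
    by (auto simp: subspace_sum_def)
  show ?thesis
    unfolding y(1) lin_sum[OF f] lin_sum[OF g] using eq y(2) by (intro sum.cong) auto
qed

text \<open>\<open>D\<close> bounds the sum of the norms of the projections to the generalized
  eigenspaces. It depends neither on \<open>f\<close> nor on \<open>B\<close>, which is what makes
  later estimates uniform over all integer powers.\<close>

lemma bounded_on_geig:
  fixes A :: "complex^'n^'n"
  shows "\<exists>D>0. \<forall>(f :: complex^'n \<Rightarrow> complex^'n) B x.
      lin f \<longrightarrow> 0 \<le> B \<longrightarrow> (\<forall>c\<in>eigvals A. \<forall>x\<in>geig A c. norm (f x) \<le> B * norm x)
      \<longrightarrow> norm (f x) \<le> D * B * norm x"
proof -
  let ?E = "eigvals A"
  have ind: "independent_family ?E (geig A)"
    by (rule independent_geig[OF finite_eigvals])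
  have "lin (\<lambda>x. if d = c then x else 0)" for c d :: complex
    by (cases "d = c") (simp_all add: lin_id lin_zero)
  then have "\<exists>P. lin P \<and> (\<forall>d\<in>?E. \<forall>x\<in>geig A d. P x = (if d = c then x else 0))" for c
    by (rule linear_glue_family[OF finite_eigvals subspace_geig ind])
  then obtain P where P: "\<And>c. lin (P c)"
      "\<And>c d x. d \<in> ?E \<Longrightarrow> x \<in> geig A d \<Longrightarrow> P c x = (if d = c then x else 0)"
    by metis
  have "\<exists>B>0. \<forall>x. norm (P c x) \<le> B * norm x" for c
    by (rule lin_bounded[OF P(1)]) blast
  then obtain b where b: "\<And>c. 0 < b c" "\<And>c x. norm (P c x) \<le> b c * norm x"
    by metis
  have dec: "x = (\<Sum>c\<in>?E. P c x) \<and> (\<forall>c\<in>?E. P c x \<in> geig A c)" for x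
  proof -
    have "x \<in> subspace_sum ?E (geig A)"
      by (simp only: subspace_sum_geig_UNIV UNIV_I)
    then obtain y where y: "x = sum y ?E" "\<forall>c\<in>?E. y c \<in> geig A c"
      by (auto simp: subspace_sum_def)
    have "P c x = y c" if "c \<in> ?E" for c
    proof -
      have "P c x = (\<Sum>d\<in>?E. if d = c then y d else 0)"
        unfolding y(1) lin_sum[OF P(1)] using P(2) y(2) by (intro sum.cong) auto
      then show ?thesis
        using that finite_eigvals[of A] by simp
    qed
    with y show ?thesis by simp
  qed
  show ?thesis
  proof (intro exI conjI allI impI)
    show "0 < 1 + (\<Sum>c\<in>?E. b c)"
      using b(1) by (intro add_pos_nonneg sum_nonneg) (auto intro: less_imp_le)
    fix f :: "complex^'n \<Rightarrow> complex^'n" and B x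
    assume f: "lin f" and B: "0 \<le> B"
      and bd: "\<forall>c\<in>?E. \<forall>x\<in>geig A c. norm (f x) \<le> B * norm x"
    have "f x = (\<Sum>c\<in>?E. f (P c x))"
      by (rule trans[OF arg_cong[OF conjunct1[OF dec[of x]], of f] lin_sum[OF f]])
    then have "norm (f x) \<le> (\<Sum>c\<in>?E. norm (f (P c x)))"
      by (simp add: norm_sum)
    also have "\<dots> \<le> (\<Sum>c\<in>?E. B * (b c * norm x))"
    proof (rule sum_mono)
      fix c assume c: "c \<in> ?E"
      have "norm (f (P c x)) \<le> B * norm (P c x)"
        using dec[of x] bd c by blast
      also have "\<dots> \<le> B * (b c * norm x)"
        by (intro mult_left_mono b B)
      finally show "norm (f (P c x)) \<le> B * (b c * norm x)" .
    qed
    also have "\<dots> = (\<Sum>c\<in>?E. b c) * (B * norm x)"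
      unfolding sum_distrib_right by (simp only: mult_ac)
    also have "\<dots> \<le> (1 + (\<Sum>c\<in>?E. b c)) * (B * norm x)"
      using B by (intro mult_right_mono) auto
    finally show "norm (f x) \<le> (1 + (\<Sum>c\<in>?E. b c)) * B * norm x"
      by (simp only: mult.assoc)
  qed
qed

lemma geig_uniform_exponent:
  fixes A :: "complex^'n^'n"
  obtains K where "2 \<le> K" and "\<And>c. c \<in> eigvals A \<Longrightarrow> geig A c = gker A c K"
proof -
  obtain m where m: "\<And>c. geig A c = gker A c (m c)"
    using geig_eq_gker[of A] by metis
  \<comment> \<open>The summand 2 secures the lower bound that \<open>zpow_gker\<close> and
    \<open>bflow_1\<close> ask for.\<close>
  let ?K = "2 + (\<Sum>c\<in>eigvals A. m c)"
  have "geig A c = gker A c ?K" if "c \<in> eigvals A" for c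
  proof
    have "m c \<le> (\<Sum>c\<in>eigvals A. m c)"
      using that by (intro member_le_sum finite_eigvals) auto
    then have "gker A c (m c) \<subseteq> gker A c ?K"
      by (intro gker_mono) linarith
    then show "geig A c \<subseteq> gker A c ?K"
      by (simp only: m)
    show "gker A c ?K \<subseteq> geig A c"
      by (auto intro: geigI)
  qed
  then show ?thesis
    by (intro that[of ?K]) auto
qed

text \<open>\<open>F s\<close> is \<open>|A|^s\<close>, glued from \<open>|c|^s\<close> times the
  binomial series. On the generalized eigenspace of \<open>c\<close> it differs from the integer
  power of \<open>A\<close> only by a unimodular scalar, an isometry there;
  \<open>bounded_on_geig\<close> turns this into a bound on the whole space with one constant for
  all \<open>k\<close>.\<close>

lemma real_flow:
  fixes A :: "complex^'n^'n"
  assumes A: "invertible A"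
  obtains F :: "real \<Rightarrow> complex^'n \<Rightarrow> complex^'n" and D :: real
  where "\<And>s. lin (F s)" and "\<And>s t x. F (s + t) x = F s (F t x)" and "\<And>x. F 0 x = x"
    and "\<And>s x. F s (A *v x) = A *v F s x"
    and "\<And>s x c. A *v x = c *s x \<Longrightarrow> F s x = complex_of_real (cmod c powr s) *s x"
    and "0 < D" and "\<And>s x. \<bar>s\<bar> \<le> 1 \<Longrightarrow> norm (F s x) \<le> D * norm x"
    and "\<And>k x. norm (F (real_of_int k) x) \<le> D * norm (zpow A k *v x)"
    and "\<And>k x. norm (zpow A k *v x) \<le> D * norm (F (real_of_int k) x)"
proof -
  let ?E = "eigvals A"
  obtain K where K: "2 \<le> K" "\<And>c. c \<in> ?E \<Longrightarrow> geig A c = gker A c K"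
    using geig_uniform_exponent by blast
  define p where "p = (\<lambda>s c x. complex_of_real (cmod c powr s) *s bflow A c K (complex_of_real s) x)"
  have lp: "lin (p s c)" for s c
    unfolding p_def by (intro lin_smult lin_bflow)
  have pg: "p s c x \<in> geig A c" if "c \<in> ?E" "x \<in> geig A c" for s c x
    using that bflow_gker unfolding p_def K(2)[OF that(1)]
    by (intro vec.subspace_scale subspace_gker) blast
  have "\<exists>F. lin F \<and> (\<forall>c\<in>?E. \<forall>x\<in>geig A c. F x = p s c x)" for s
    by (rule linear_glue_family[OF finite_eigvals subspace_geig independent_geig[OF finite_eigvals] lp])
  then obtain F where F: "\<And>s. lin (F s)" "\<And>s c x. c \<in> ?E \<Longrightarrow> x \<in> geig A c \<Longrightarrow> F s x = p s c x"
    by metis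
  have c0: "c \<noteq> 0" if "c \<in> ?E" for c
    using eigvals_nonzero[OF A that] .
  have add: "F (s + t) x = F s (F t x)" for s t x
  proof (rule lin_eq_on_geig[of "F (s + t)" "\<lambda>x. F s (F t x)" A])
    show "lin (F (s + t))" "lin (\<lambda>x. F s (F t x))"
      by (rule F, rule lin_compose[OF F(1) F(1)])
    fix c x assume cx: "c \<in> ?E" "x \<in> geig A c"
    have "F s (F t x) = p s c (p t c x)"
      using F(2) pg cx by simp
    also have "\<dots> = (complex_of_real (cmod c powr s) * complex_of_real (cmod c powr t))
        *s bflow A c K (complex_of_real s) (bflow A c K (complex_of_real t) x)"
      by (simp only: p_def lin_scale[OF lin_bflow] vec.scale_scale)
    also have "\<dots> = p (s + t) c x"
      using bflow_add[of x A c K] cx(2) unfolding K(2)[OF cx(1)]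
      by (simp add: p_def powr_add)
    finally show "F (s + t) x = F s (F t x)"
      using F(2)[OF cx] by simp
  qed
  have F0: "F 0 x = x" for x
  proof (rule lin_eq_on_geig[of "F 0" "\<lambda>x. x" A, OF F(1) lin_id])
    fix c x assume cx: "c \<in> ?E" "x \<in> geig A c"
    then show "F 0 x = x"
      using F(2)[OF cx] K(1) c0[OF cx(1)] by (simp add: p_def bflow_0)
  qed
  have comm: "F s (A *v x) = A *v F s x" for s x
  proof (rule lin_eq_on_geig[of "\<lambda>x. F s (A *v x)" "\<lambda>x. A *v F s x" A])
    show "lin (\<lambda>x. F s (A *v x))" "lin (\<lambda>x. A *v F s x)"
      by (rule lin_compose[OF F(1) matrix_vector_mul_linear_gen],
          rule lin_compose[OF matrix_vector_mul_linear_gen F(1)])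
    fix c x assume cx: "c \<in> ?E" "x \<in> geig A c"
    have "A *v x \<in> geig A c"
      by (rule geig_commute[OF cx(2)]) simp
    then have "F s (A *v x) = p s c (A *v x)"
      by (rule F(2)[OF cx(1)])
    also have "\<dots> = A *v p s c x"
      unfolding p_def by (subst bflow_commute) (simp_all add: vec.scale)
    finally show "F s (A *v x) = A *v F s x"
      using F(2)[OF cx] by simp
  qed
  have eig: "F s x = complex_of_real (cmod c powr s) *s x" if ev: "A *v x = c *s x" for s x c
  proof (cases "x = 0")
    case True
    then show ?thesis
      using lin_0[OF F(1)] by simp
  next
    case False
    have x1: "x \<in> gker A c 1"
      using ev unfolding gker_1_iff .
    have "c \<in> ?E" "x \<in> geig A c"
      using False ev geigI[OF x1] by (auto simp: eigvals_def)
    then have "F s x = p s c x"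
      by (rule F(2))
    moreover have "bflow A c K (complex_of_real s) x = bflow A c 1 (complex_of_real s) x"
      using K(1) by (intro bflow_truncate[OF x1]) simp
    ultimately show ?thesis
      by (simp add: p_def bflow_def)
  qed
  obtain D where D: "0 < D" and D': "\<forall>(f :: complex^'n \<Rightarrow> complex^'n) B x.
      lin f \<longrightarrow> 0 \<le> B \<longrightarrow> (\<forall>c\<in>?E. \<forall>x\<in>geig A c. norm (f x) \<le> B * norm x)
      \<longrightarrow> norm (f x) \<le> D * B * norm x"
    using bounded_on_geig[of A] by (elim exE conjE)
  note bd = D'[rule_format]
  have lz: "lin ((*v) (zpow A k))" for k
    by (rule matrix_vector_mul_linear_gen)
  have zg: "zpow A k *v x = (c powi k) *s bflow A c K (complex_of_int k) x"
      "zpow A k *v x \<in> geig A c" if "c \<in> ?E" "x \<in> geig A c" for k c x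
  proof -
    have xK: "x \<in> gker A c K"
      using that K(2) by blast
    show "zpow A k *v x = (c powi k) *s bflow A c K (complex_of_int k) x"
      by (rule zpow_gker[OF A c0[OF that(1)] K(1) xK])
    then show "zpow A k *v x \<in> geig A c"
      using bflow_gker[OF xK, of K "complex_of_int k"] K(2)[OF that(1)]
      by (simp only: vec.subspace_scale subspace_gker)
  qed
  \<comment> \<open>The nilpotent parts of the two factors cancel by \<open>bflow_add\<close>,
    leaving a power of \<open>|c| / c\<close> or of its inverse.\<close>
  have unimodular: "norm (F (real_of_int k) (zpow A (- k) *v x)) = norm x \<and>
      norm (zpow A k *v F (real_of_int (- k)) x) = norm x"
    if "c \<in> ?E" "x \<in> geig A c" for k c x
  proof -
    have xK: "x \<in> gker A c K"
      using that K(2) by blast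
    have c: "0 < cmod c"
      using c0[OF that(1)] by simp
    have "F (real_of_int k) (zpow A (- k) *v x) = p (real_of_int k) c (zpow A (- k) *v x)"
      by (rule F(2)[OF that(1) zg(2)[OF that]])
    also have "\<dots> = (complex_of_real (cmod c powr real_of_int k) * (c powi (- k)))
          *s bflow A c K (complex_of_int k) (bflow A c K (complex_of_int (- k)) x)"
      by (simp only: p_def zg(1)[OF that] lin_scale[OF lin_bflow] vec.scale_scale of_real_of_int_eq)
    also have "bflow A c K (complex_of_int k) (bflow A c K (complex_of_int (- k)) x) = x"
      using bflow_add[OF xK] bflow_0[of K A c x] K(1) by simp
    finally have 1: "norm (F (real_of_int k) (zpow A (- k) *v x)) = norm x"
      using c0[OF that(1)] c
      by (simp add: norm_smult_complex norm_mult norm_powi powr_minus norm_inverse)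
    have "zpow A k *v F (real_of_int (- k)) x
        = ((c powi k) * complex_of_real (cmod c powr real_of_int (- k)))
          *s bflow A c K (complex_of_int k) (bflow A c K (complex_of_int (- k)) x)"
      unfolding F(2)[OF that] zg(1)[OF that(1) pg[OF that]]
      by (simp only: p_def lin_scale[OF lin_bflow] vec.scale_scale of_real_of_int_eq)
    also have "bflow A c K (complex_of_int k) (bflow A c K (complex_of_int (- k)) x) = x"
      using bflow_add[OF xK] bflow_0[of K A c x] K(1) by simp
    finally have 2: "norm (zpow A k *v F (real_of_int (- k)) x) = norm x"
      using c0[OF that(1)] c
      by (simp add: norm_smult_complex norm_mult norm_powi powr_minus norm_inverse)
    from 1 2 show ?thesis ..
  qed
  have b1': "norm (F (real_of_int k) (zpow A (- k) *v y)) \<le> D * 1 * norm y" for k y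
    by (rule bd[OF lin_compose[OF F(1) lz]]) (use unimodular in auto)
  have b1: "norm (F (real_of_int k) x) \<le> D * norm (zpow A k *v x)" for k x
    using b1'[of k "zpow A k *v x"] by (simp only: zpow_minus[OF A] mult_1_right)
  have b2': "norm (zpow A k *v F (real_of_int (- k)) y) \<le> D * 1 * norm y" for k y
    by (rule bd[OF lin_compose[OF lz F(1)]]) (use unimodular in auto)
  have "F (real_of_int (- k)) (F (real_of_int k) x) = x" for k x
    using add[of "real_of_int (- k)" "real_of_int k" x] F0 by simp
  then have b2: "norm (zpow A k *v x) \<le> D * norm (F (real_of_int k) x)" for k x
    using b2'[of k "F (real_of_int k) x"] by (simp only: mult_1_right)
  obtain K' where K': "K = Suc K'"
    using K(1) by (cases K) auto
  have "\<exists>C>0. \<forall>t v. norm (bflow A c (Suc K') t v) \<le> C * (1 + cmod t) ^ K' * norm v" for c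
    by (rule bflow_bound[of A c K']) blast
  then obtain C where C: "\<And>c. 0 < C c"
      "\<And>c t v. norm (bflow A c (Suc K') t v) \<le> C c * (1 + cmod t) ^ K' * norm v"
    by metis
  \<comment> \<open>For \<open>|s| \<le> 1\<close>, \<open>|c|^s\<close> is at most
    \<open>1 + |c| + 1 / |c|\<close> whatever the size of \<open>|c|\<close>, and
    \<open>1 + |s| \<le> 2\<close> bounds the binomial part.\<close>
  define M where "M = (\<Sum>c\<in>?E. (1 + cmod c + inverse (cmod c)) * (C c * 2 ^ K'))"
  have M0: "0 \<le> M"
    unfolding M_def using C(1) by (intro sum_nonneg mult_nonneg_nonneg) (auto intro: less_imp_le)
  have b3: "norm (F s x) \<le> D * M * norm x" if s: "\<bar>s\<bar> \<le> 1" for s x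
  proof (rule bd[OF F(1) M0])
    fix c x assume cx: "c \<in> ?E" "x \<in> geig A c"
    have c: "0 < cmod c"
      using c0[OF cx(1)] by simp
    have "cmod c powr s \<le> 1 + cmod c + inverse (cmod c)"
    proof (cases "1 \<le> cmod c")
      case True
      then have "cmod c powr s \<le> cmod c powr 1"
        using s by (intro powr_mono) auto
      then show ?thesis
        using c by (simp add: add_increasing2)
    next
      case False
      then have "cmod c powr s \<le> cmod c powr (- 1)"
        using s c by (intro powr_mono') auto
      then show ?thesis
        using c by (simp add: powr_minus add_increasing)
    qed
    moreover have "norm (bflow A c K (complex_of_real s) x) \<le> C c * 2 ^ K' * norm x"
    proof -
      have "C c * (1 + cmod (complex_of_real s)) ^ K' * norm x \<le> C c * 2 ^ K' * norm x"
        using s C(1)[of c] by (intro mult_right_mono mult_left_mono power_mono) auto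
      then show ?thesis
        using C(2)[of c "complex_of_real s" x] unfolding K' by linarith
    qed
    ultimately have "norm (F s x) \<le> (1 + cmod c + inverse (cmod c)) * (C c * 2 ^ K' * norm x)"
      unfolding F(2)[OF cx] p_def norm_smult_complex by (intro mult_mono) (use c in auto)
    also have "\<dots> = (1 + cmod c + inverse (cmod c)) * (C c * 2 ^ K') * norm x"
      by (simp only: mult.assoc)
    also have "\<dots> \<le> M * norm x"
      unfolding M_def using C(1) cx(1)
      by (intro mult_right_mono member_le_sum finite_eigvals mult_nonneg_nonneg add_nonneg_nonneg)
        (auto intro: less_imp_le)
    finally show "norm (F s x) \<le> M * norm x" .
  qed
  let ?D = "D + D * M"
  have DM: "0 \<le> D * M" "0 < ?D"
    using D M0 by (auto intro: add_pos_nonneg)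
  show ?thesis
  proof (rule that[of F ?D])
    show "norm (F s x) \<le> ?D * norm x" if "\<bar>s\<bar> \<le> 1" for s x
      by (rule order_trans[OF b3[OF that]]) (use D in \<open>auto intro!: mult_right_mono\<close>)
    show "norm (F (real_of_int k) x) \<le> ?D * norm (zpow A k *v x)" for k x
      by (rule order_trans[OF b1]) (use DM in \<open>auto intro!: mult_right_mono\<close>)
    show "norm (zpow A k *v x) \<le> ?D * norm (F (real_of_int k) x)" for k x
      by (rule order_trans[OF b2]) (use DM in \<open>auto intro!: mult_right_mono\<close>)
  qed (use F(1) add F0 comm eig DM in auto)
qed

text \<open>The matrix \<open>X\<close> plays the role of the power \<open>|A|\<^sup>t\<close>.\<close>

theorem positive_matrix_power:
  fixes A :: "complex^'n^'n"
  assumes A: "invertible A"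
  obtains X :: "complex^'n^'n" and D :: real
  where "invertible X" and "\<And>c. c \<in> eigvals X \<Longrightarrow> c = complex_of_real (cmod c)" and "0 < D"
    and "\<And>k x. norm (zpow X k *v x) \<le> D * norm (zpow A \<lfloor>t * real_of_int k\<rfloor> *v x)"
    and "\<And>k x. norm (zpow A \<lfloor>t * real_of_int k\<rfloor> *v x) \<le> D * norm (zpow X k *v x)"
proof -
  obtain F D where F: "\<And>s. lin (F s)" "\<And>s t x. F (s + t) x = F s (F t x)" "\<And>x. F 0 x = x"
    "\<And>s x. F s (A *v x) = A *v F s x"
    "\<And>s x c. A *v x = c *s x \<Longrightarrow> F s x = complex_of_real (cmod c powr s) *s x"
    and D: "0 < D" "\<And>s x. \<bar>s\<bar> \<le> 1 \<Longrightarrow> norm (F s x) \<le> D * norm x"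
    "\<And>k x. norm (F (real_of_int k) x) \<le> D * norm (zpow A k *v x)"
    "\<And>k x. norm (zpow A k *v x) \<le> D * norm (F (real_of_int k) x)"
  proof (rule real_flow[OF A], goal_cases)
    case (1 F D)
    show ?case by (rule 1(1)[OF 1(2-)])
  qed
  define X where "X = matrix (F t)"
  have Xv: "X *v x = F t x" for x
    unfolding X_def by (rule matrix_works[OF F(1)])
  have "matrix (F (- t)) *v (X *v x) = x" for x
    using F(2)[of "- t" t x] F(3) by (simp add: Xv matrix_works[OF F(1)])
  then have "matrix (F (- t)) ** X = mat 1"
    by (simp add: matrix_eq matrix_vector_mul_assoc[symmetric])
  then have X: "invertible X"
    unfolding invertible_left_inverse by blast
  have zX: "zpow X k *v x = F (t * real_of_int k) x" for k x
  proof -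
    have "F (t * real_of_int (i + 1)) x = X *v F (t * real_of_int i) x" for i
      using F(2)[of t "t * real_of_int i" x] by (simp add: Xv algebra_simps)
    then have "F (t * real_of_int k) x = zpow X k *v F (t * real_of_int 0) x"
      by (rule zpow_unique[OF X, of "\<lambda>i. F (t * real_of_int i) x"])
    then show ?thesis
      by (simp add: F(3))
  qed
  have eig: "c = complex_of_real (cmod c)" if cX: "c \<in> eigvals X" for c
  proof -
    \<comment> \<open>This eigenspace of \<open>X\<close> is invariant under \<open>A\<close>,
      because the flow commutes with \<open>A\<close>. Hence it contains an eigenvector
      \<open>u\<close> of \<open>A\<close>, on which \<open>X\<close> is multiplication by a
      positive number.\<close>
    define W where "W = {v. X *v v = c *s v}"
    have W: "vec.subspace W"
      unfolding W_def vec.subspace_def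
      by (auto simp: vec.add vec.scale vec.scale_right_distrib mult.commute)
    have AW: "A *v v \<in> W" if "v \<in> W" for v
      using that by (simp add: W_def Xv F(4) vec.scale)
    obtain v where v: "v \<in> W" "v \<noteq> 0"
      using cX by (auto simp: W_def eigvals_def)
    have "v \<in> subspace_sum (eigvals A) (\<lambda>d. W \<inter> geig A d)"
      using invariant_decomposition[OF W AW] v(1) by blast
    then obtain y where y: "v = sum y (eigvals A)" "\<forall>d\<in>eigvals A. y d \<in> W \<inter> geig A d"
      by (auto simp: subspace_sum_def)
    have "\<not> (\<forall>d\<in>eigvals A. y d = 0)"
      using v(2) sum.neutral[of "eigvals A" y] unfolding y(1) by blast
    then obtain d where d: "y d \<in> W" "y d \<in> geig A d" "y d \<noteq> 0"
      using y(2) by blast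
    then obtain p where p: "y d \<in> gker A d p"
      by (auto simp: geig_def)
    moreover have "y d \<notin> gker A d 0"
      using d(3) by (simp add: gker_0)
    ultimately obtain j where j: "matrix_power (A - mat d) j *v y d \<in> gker A d (Suc 0)"
        "matrix_power (A - mat d) j *v y d \<notin> gker A d 0"
      by (rule gker_step)
    define u where "u = matrix_power (A - mat d) j *v y d"
    have "matrix_power (A - mat d) i *v y d \<in> W" for i
    proof (induction i)
      case (Suc i)
      have "(A - mat d) *v (matrix_power (A - mat d) i *v y d) \<in> W"
        unfolding shift_vec by (intro vec.subspace_diff vec.subspace_scale W AW Suc)
      then show ?case
        by (simp add: matrix_vector_mul_assoc)
    qed (simp add: d)
    then have "X *v u = c *s u"
      by (simp add: u_def W_def)
    moreover have Au: "A *v u = d *s u"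
      using j(1) gker_1_iff unfolding u_def by (metis One_nat_def)
    ultimately have "c *s u = complex_of_real (cmod d powr t) *s u"
      using F(5)[OF Au, of t] by (simp only: Xv)
    moreover have "u \<noteq> 0"
      using j(2) by (simp add: u_def gker_0)
    ultimately have "c = complex_of_real (cmod d powr t)"
      by (simp only: vec.scale_cancel_right) simp
    then show ?thesis by simp
  qed
  \<comment> \<open>Rounding the time to an integer moves it by at most 1, at the cost of one factor
    \<open>D\<close>.\<close>
  have 1: "norm (F a x) \<le> D * norm (F b x)" if "\<bar>a - b\<bar> \<le> 1" for a b x
    using D(2)[OF that, of "F b x"] F(2)[of "a - b" b x] by simp
  have fl: "\<bar>t * real_of_int k - real_of_int \<lfloor>t * real_of_int k\<rfloor>\<bar> \<le> 1"
      "\<bar>real_of_int \<lfloor>t * real_of_int k\<rfloor> - t * real_of_int k\<bar> \<le> 1" for k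
    by linarith+
  show ?thesis
  proof (rule that[OF X eig])
    show "0 < D * D" using D(1) by simp
    show "norm (zpow X k *v x) \<le> D * D * norm (zpow A \<lfloor>t * real_of_int k\<rfloor> *v x)" for k x
      unfolding zX mult.assoc
      using order_trans[OF 1[OF fl(1)] mult_left_mono[OF D(3)]] D(1) by simp
    show "norm (zpow A \<lfloor>t * real_of_int k\<rfloor> *v x) \<le> D * D * norm (zpow X k *v x)" for k x
      unfolding zX mult.assoc
      using order_trans[OF D(4) mult_left_mono[OF 1[OF fl(2)]]] D(1) by simp
  qed
qed

text \<open>On each generalized eigenspace the shifted matrices are nilpotent with equal kernel
  dimensions, so an injective intertwiner exists there. The glued map stays injective because the
  pieces land in independent generalized eigenspaces of \<open>Y\<close>.\<close>

theorem similar_of_dim_gker_eq: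
  fixes X Y :: "complex^'n^'n"
  assumes dims: "\<And>c m. vec.dim (gker X c m) = vec.dim (gker Y c m)"
  shows "\<exists>S. invertible S \<and> (\<forall>v. S *v (X *v v) = Y *v (S *v v))"
proof -
  have "\<exists>S. lin S \<and> S ` geig X c \<subseteq> geig Y c \<and> (\<forall>x\<in>geig X c. S x = 0 \<longrightarrow> x = 0) \<and>
      (\<forall>x\<in>geig X c. S (X *v x) = Y *v S x)" for c
  proof -
    obtain p q where pq: "geig X c = gker X c p" "geig Y c = gker Y c q"
      using geig_eq_gker by metis
    let ?f = "(*v) (X - mat c)" and ?g = "(*v) (Y - mat c)"
    have inv: "?f ` geig X c \<subseteq> geig X c" "?g ` geig Y c \<subseteq> geig Y c"
      using geig_commute[of _ X c "X - mat c"] geig_commute[of _ Y c "Y - mat c"]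
      by (auto simp: shift_vec vec.diff vec.scale)
    have kx: "{x\<in>geig X c. (?f ^^ m) x = 0} = gker X c m" for m
      unfolding matrix_power_funpow[symmetric] by (auto simp: gker_def geig_def)
    have ky: "{x\<in>geig Y c. (?g ^^ m) x = 0} = gker Y c m" for m
      unfolding matrix_power_funpow[symmetric] by (auto simp: gker_def geig_def)
    have "\<exists>S. lin S \<and> S ` geig X c \<subseteq> geig Y c \<and> (\<forall>x\<in>geig X c. S x = 0 \<longrightarrow> x = 0)
        \<and> (\<forall>x\<in>geig X c. S (?f x) = ?g (S x))"
    proof (rule nilpotent_similar[where q = "p + q"])
      show "(?f ^^ (p + q)) x = 0" if "x \<in> geig X c" for x
        using that gker_matrix_power_0[of x X c p "p + q"]
        unfolding pq(1) matrix_power_funpow[symmetric] by simp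
      show "(?g ^^ (p + q)) x = 0" if "x \<in> geig Y c" for x
        using that gker_matrix_power_0[of x Y c q "p + q"]
        unfolding pq(2) matrix_power_funpow[symmetric] by simp
    qed (rule matrix_vector_mul_linear_gen subspace_geig inv | simp only: kx ky dims)+
    then obtain S where S: "lin S \<and> S ` geig X c \<subseteq> geig Y c \<and> (\<forall>x\<in>geig X c. S x = 0 \<longrightarrow> x = 0)
        \<and> (\<forall>x\<in>geig X c. S (?f x) = ?g (S x))" ..
    have "S (X *v x) = Y *v S x" if "x \<in> geig X c" for x
    proof -
      have "S (X *v x - c *s x) = Y *v S x - c *s S x"
        using S that unfolding shift_vec by blast
      then show ?thesis
        using S by (simp add: lin_diff lin_scale)
    qed
    with S show ?thesis by blast
  qed
  then obtain S where S: "\<And>c. lin (S c)" "\<And>c. S c ` geig X c \<subseteq> geig Y c"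
      "\<And>c x. x \<in> geig X c \<Longrightarrow> S c x = 0 \<Longrightarrow> x = 0"
      "\<And>c x. x \<in> geig X c \<Longrightarrow> S c (X *v x) = Y *v S c x"
    by metis
  let ?E = "eigvals X"
  have "\<exists>F. lin F \<and> (\<forall>c\<in>?E. \<forall>x\<in>geig X c. F x = S c x)"
    by (rule linear_glue_family[OF finite_eigvals subspace_geig independent_geig[OF finite_eigvals] S(1)])
  then obtain F where F: "lin F" "\<And>c x. c \<in> ?E \<Longrightarrow> x \<in> geig X c \<Longrightarrow> F x = S c x"
    by blast
  have inj: "x = 0" if Fx: "F x = 0" for x
  proof -
    have "x \<in> subspace_sum ?E (geig X)"
      by (simp only: subspace_sum_geig_UNIV UNIV_I)
    then obtain y where y: "x = sum y ?E" "\<forall>c\<in>?E. y c \<in> geig X c"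
      by (auto simp: subspace_sum_def)
    have "(\<Sum>c\<in>?E. S c (y c)) = F x"
      unfolding y(1) lin_sum[OF F(1)] using F(2) y(2) by (intro sum.cong) auto
    then have "(\<Sum>c\<in>?E. S c (y c)) = 0"
      by (simp only: Fx)
    moreover have "\<forall>c\<in>?E. S c (y c) \<in> geig Y c"
      using S(2) y(2) by blast
    ultimately have "\<forall>c\<in>?E. S c (y c) = 0"
      using independent_geig[OF finite_eigvals[of X], of Y, unfolded independent_family_def,
          rule_format, of "\<lambda>c. S c (y c)"] by blast
    then have "\<forall>c\<in>?E. y c = 0"
      using S(3) y(2) by blast
    then show ?thesis
      unfolding y(1) by (intro sum.neutral)
  qed
  have "\<exists>B. B ** matrix F = mat 1"
    unfolding matrix_left_invertible_ker using inj by (simp add: matrix_works[OF F(1)])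
  then have "invertible (matrix F)"
    unfolding invertible_left_inverse .
  moreover have "matrix F *v (X *v v) = Y *v (matrix F *v v)" for v
    unfolding matrix_works[OF F(1)]
  proof (rule lin_eq_on_geig[of "\<lambda>v. F (X *v v)" "\<lambda>v. Y *v F v" X])
    show "lin (\<lambda>v. F (X *v v))" "lin (\<lambda>v. Y *v F v)"
      by (rule lin_compose[OF F(1) matrix_vector_mul_linear_gen],
          rule lin_compose[OF matrix_vector_mul_linear_gen F(1)])
    fix c x assume cx: "c \<in> ?E" "x \<in> geig X c"
    have "X *v x \<in> geig X c"
      by (rule geig_commute[OF cx(2)]) simp
    then show "F (X *v x) = Y *v F x"
      using F(2)[OF cx] F(2)[OF cx(1), of "X *v x"] S(4)[OF cx(2)] by simp
  qed
  ultimately show ?thesis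
    by (intro exI[of _ "matrix F"] conjI allI)
qed

section \<open>Real matrices and their complexifications\<close>

definition cvec :: "real^'n \<Rightarrow> complex^'n"
  where "cvec x = (\<chi> i. complex_of_real (x $ i))"

definition vec_Re :: "complex^'n \<Rightarrow> real^'n"
  where "vec_Re v = (\<chi> i. Re (v $ i))"

definition vec_Im :: "complex^'n \<Rightarrow> real^'n"
  where "vec_Im v = (\<chi> i. Im (v $ i))"

lemma complexify_cvec: "complexify A *v cvec x = cvec (A *v x)"
  by (simp add: complexify_def cvec_def matrix_vector_mult_def vec_eq_iff map_matrix_def)

lemma vec_Re_complexify: "vec_Re (complexify A *v v) = A *v vec_Re v"
  and vec_Im_complexify: "vec_Im (complexify A *v v) = A *v vec_Im v"
  by (simp_all add: complexify_def vec_Re_def vec_Im_def matrix_vector_mult_def vec_eq_iff map_matrix_def)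

lemma norm_cvec: "norm (cvec x) = norm x"
  by (simp add: norm_vec_def cvec_def)

lemma norm_vec_Re_le: "norm (vec_Re v) \<le> norm v"
  and norm_vec_Im_le: "norm (vec_Im v) \<le> norm v"
  unfolding norm_vec_def vec_Re_def vec_Im_def
  by (auto intro!: L2_set_mono abs_Re_le_cmod abs_Im_le_cmod)

lemma complex_vec_eq: "v = cvec (vec_Re v) + \<i> *s cvec (vec_Im v)"
  by (simp add: vec_eq_iff cvec_def vec_Re_def vec_Im_def complex_eq)

lemma norm_le_Re_Im: "norm v \<le> norm (vec_Re v) + norm (vec_Im v)"
  by (subst complex_vec_eq, rule order_trans[OF norm_triangle_ineq])
    (simp add: norm_smult_complex norm_cvec)

lemma zpow_complexify_Re_Im:
  assumes "invertible A" and "invertible (complexify A)"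
  shows "vec_Re (zpow (complexify A) k *v v) = zpow A k *v vec_Re v"
    and "vec_Im (zpow (complexify A) k *v v) = zpow A k *v vec_Im v"
  using zpow_unique[OF assms(1), of "\<lambda>k. vec_Re (zpow (complexify A) k *v v)" k]
    zpow_unique[OF assms(1), of "\<lambda>k. vec_Im (zpow (complexify A) k *v v)" k]
  by (simp_all add: zpow_Suc[OF assms(2)] vec_Re_complexify vec_Im_complexify)

lemma zpow_complexify_cvec:
  assumes "invertible A" and "invertible (complexify A)"
  shows "zpow (complexify A) k *v cvec x = cvec (zpow A k *v x)"
  using zpow_unique[OF assms(2), of "\<lambda>k. cvec (zpow A k *v x)" k]
  by (simp add: zpow_Suc[OF assms(1)] complexify_cvec)

lemma complex_eigenvalue_iff: "complex_eigenvalue A \<mu> \<longleftrightarrow> \<mu> \<in> eigvals (complexify A)"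
  by (simp add: complex_eigenvalue_def eigvals_def)

lemma dilation_eigvals: "dilation A \<Longrightarrow> \<mu> \<in> eigvals (complexify A) \<Longrightarrow> 1 < cmod \<mu>"
  by (simp add: dilation_def complex_eigenvalue_iff)

lemma dilation_invertible:
  fixes A :: "real^'n^'n"
  assumes "dilation A"
  shows "invertible A" and "invertible (complexify A)"
proof -
  have ker: "v = 0" if "complexify A *v v = 0" for v
  proof (rule ccontr)
    assume "v \<noteq> 0"
    with that have "0 \<in> eigvals (complexify A)"
      by (auto simp: eigvals_def)
    then show False
      using dilation_eigvals[OF assms, of 0] by simp
  qed
  then show "invertible (complexify A)"
    unfolding invertible_left_inverse matrix_left_invertible_ker by blast
  have "x = 0" if "A *v x = 0" for x
  proof -
    have "cvec x = 0"
      by (rule ker) (simp add: complexify_cvec that, simp add: cvec_def vec_eq_iff)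
    then show ?thesis
      by (simp add: cvec_def vec_eq_iff)
  qed
  then show "invertible A"
    unfolding invertible_left_inverse matrix_left_invertible_ker by blast
qed

lemma sum_dim_ker_eq_dim_growth:
  assumes "dilation A" and "0 < r"
  shows "sum_dim_ker A r (Suc d) = vec.dim (growth (complexify A) r d)"
  unfolding dim_growth[OF dilation_invertible(2)[OF assms(1)] assms(2)]
  by (simp add: sum_dim_ker_def dim_ker_power_def gker_def complex_eigenvalue_iff)

text \<open>Covers the radii about which (ii) says nothing.\<close>

lemma dim_growth_dilation_0:
  assumes "dilation A" and "0 < r" and "r \<le> 1"
  shows "vec.dim (growth (complexify A) r d) = 0"
proof -
  have "{c \<in> eigvals (complexify A). cmod c = r} = {}"
    using dilation_eigvals[OF assms(1)] assms(3) by fastforce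
  then show ?thesis
    unfolding dim_growth[OF dilation_invertible(2)[OF assms(1)] assms(2)] by (simp only: sum.empty)
qed

section \<open>Growth spaces when the exponent is rescaled and rounded\<close>

lemma powr_le_of_abs_le:
  fixes r :: real
  assumes "0 < r" and "\<bar>s\<bar> \<le> e"
  shows "r powr s \<le> r powr e + r powr (- e)"
proof (cases "1 \<le> r")
  case True
  then have "r powr s \<le> r powr e"
    using assms by (intro powr_mono) auto
  then show ?thesis by (simp add: add_increasing2)
next
  case False
  then have "r powr s \<le> r powr (- e)"
    using assms by (intro powr_mono') auto
  then show ?thesis by (simp add: add_increasing)
qed

text \<open>Rounding changes \<open>r^(e k)\<close> by at most a constant factor, and
  \<open>1 + |j| \<le> (2 + e) (1 + |k|)\<close> preserves the polynomial degree.\<close>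

lemma growth_reindex:
  fixes A B :: "complex^'n^'n"
  assumes e: "0 < e" and r: "0 < r" and C: "0 \<le> C"
    and le: "\<And>k. norm (zpow B k *v y) \<le> C * norm (zpow A \<lfloor>e * real_of_int k\<rfloor> *v x)"
    and x: "x \<in> growth A r d"
  shows "y \<in> growth B (r powr e) d"
proof -
  obtain D where D: "0 \<le> D"
    "\<And>k. norm (zpow A k *v x) \<le> D * r powr real_of_int k * (1 + \<bar>real_of_int k\<bar>) ^ d"
    using growthE[OF x] by metis
  let ?m = "r powr 1 + r powr (- 1)"
  show ?thesis
  proof (rule growthI)
    fix k :: int
    let ?j = "\<lfloor>e * real_of_int k\<rfloor>"
    have "r powr real_of_int ?j = r powr (e * real_of_int k) * r powr (real_of_int ?j - e * real_of_int k)"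
      by (simp flip: powr_add)
    also have "\<dots> \<le> r powr (e * real_of_int k) * ?m"
      by (intro mult_left_mono powr_le_of_abs_le[OF r]) (linarith, simp)
    finally have 1: "r powr real_of_int ?j \<le> (r powr e) powr real_of_int k * ?m"
      by (simp add: powr_powr)
    have "\<bar>real_of_int ?j\<bar> \<le> \<bar>e * real_of_int k\<bar> + 1"
      by linarith
    then have "1 + \<bar>real_of_int ?j\<bar> \<le> 2 + e * \<bar>real_of_int k\<bar>"
      using e by (simp add: abs_mult)
    also have "\<dots> \<le> (2 + e) * (1 + \<bar>real_of_int k\<bar>)"
      using e by (simp add: algebra_simps)
    finally have 2: "(1 + \<bar>real_of_int ?j\<bar>) ^ d \<le> ((2 + e) * (1 + \<bar>real_of_int k\<bar>)) ^ d"
      by (intro power_mono) auto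
    have "norm (zpow A ?j *v x) \<le> D * r powr real_of_int ?j * (1 + \<bar>real_of_int ?j\<bar>) ^ d"
      by (rule D(2))
    also have "\<dots> \<le> D * ((r powr e) powr real_of_int k * ?m) * ((2 + e) * (1 + \<bar>real_of_int k\<bar>)) ^ d"
      using D(1) by (intro mult_mono mult_left_mono 1 2) auto
    finally have "C * norm (zpow A ?j *v x)
        \<le> C * (D * ((r powr e) powr real_of_int k * ?m) * ((2 + e) * (1 + \<bar>real_of_int k\<bar>)) ^ d)"
      using C by (rule mult_left_mono)
    with le[of k] show "norm (zpow B k *v y)
        \<le> (C * D * ?m * (2 + e) ^ d) * (r powr e) powr real_of_int k * (1 + \<bar>real_of_int k\<bar>) ^ d"
      by (simp add: power_mult_distrib mult_ac)
  qed
qed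

text \<open>For \<open>e > 1\<close> the floors of \<open>e k\<close> skip integers. An arbitrary
  \<open>j\<close> is reached from a floor by a power \<open>A^(-i)\<close> with
  \<open>0 \<le> i \<le> N\<close>, and these finitely many matrices have a common bound
  \<open>M\<close>.\<close>

lemma growth_reindex_converse:
  fixes A B :: "complex^'n^'n"
  assumes A: "invertible A" and e: "0 < e" and r: "0 < r" and C: "0 \<le> C"
    and le: "\<And>k. norm (zpow A \<lfloor>e * real_of_int k\<rfloor> *v x) \<le> C * norm (zpow B k *v y)"
    and y: "y \<in> growth B (r powr e) d"
  shows "x \<in> growth A r d"
proof -
  obtain D where D: "0 \<le> D"
    "\<And>k. norm (zpow B k *v y) \<le> D * (r powr e) powr real_of_int k * (1 + \<bar>real_of_int k\<bar>) ^ d"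
    using growthE[OF y] by metis
  have "\<exists>b>0. \<forall>v. norm (zpow A (- int i) *v v) \<le> b * norm v" for i
    by (rule matrix_bounded[of "zpow A (- int i)"]) blast
  then obtain b where b: "\<And>i. 0 < b i" "\<And>i v. norm (zpow A (- int i) *v v) \<le> b i * norm v"
    by metis
  define N where "N = nat \<lceil>e\<rceil>"
  define M where "M = (\<Sum>i\<le>N. b i)"
  have M: "0 \<le> M"
    unfolding M_def using b(1) by (intro sum_nonneg) (auto intro: less_imp_le)
  let ?m = "r powr e + r powr (- e)"
  show ?thesis
  proof (rule growthI)
    fix j :: int
    \<comment> \<open>The least \<open>k\<close> with \<open>j \<le> e k\<close>, so that
      \<open>e k\<close> exceeds \<open>j\<close> by less than \<open>e\<close>.\<close>
    define k where "k = \<lceil>real_of_int j / e\<rceil>"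
    have k: "real_of_int j / e \<le> real_of_int k" "real_of_int k < real_of_int j / e + 1"
      unfolding k_def by linarith+
    then have ek: "real_of_int j \<le> e * real_of_int k" "e * real_of_int k < real_of_int j + e"
      using e by (simp_all add: field_simps)
    define i where "i = nat (\<lfloor>e * real_of_int k\<rfloor> - j)"
    have "0 \<le> \<lfloor>e * real_of_int k\<rfloor> - j" "\<lfloor>e * real_of_int k\<rfloor> - j \<le> \<lceil>e\<rceil>"
      using ek by linarith+
    then have i: "j = - int i + \<lfloor>e * real_of_int k\<rfloor>" "i \<le> N"
      by (simp_all add: i_def N_def)
    have "norm (zpow A j *v x) = norm (zpow A (- int i) *v (zpow A \<lfloor>e * real_of_int k\<rfloor> *v x))"
      by (subst i(1)) (simp only: zpow_add[OF A])
    also have "\<dots> \<le> b i * norm (zpow A \<lfloor>e * real_of_int k\<rfloor> *v x)"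
      by (rule b(2))
    also have "\<dots> \<le> M * (C * norm (zpow B k *v y))"
      unfolding M_def using i(2) b(1) le
      by (intro mult_mono member_le_sum sum_nonneg) (auto intro: less_imp_le)
    also have "\<dots> \<le> M * (C * (D * (r powr e) powr real_of_int k * (1 + \<bar>real_of_int k\<bar>) ^ d))"
      using M C by (intro mult_left_mono D(2))
    also have "\<dots> \<le> M * (C * (D * (r powr real_of_int j * ?m) * ((2 + 1 / e) * (1 + \<bar>real_of_int j\<bar>)) ^ d))"
    proof (intro mult_left_mono mult_mono power_mono)
      have "(r powr e) powr real_of_int k = r powr real_of_int j * r powr (e * real_of_int k - real_of_int j)"
        by (simp add: powr_powr flip: powr_add)
      also have "\<dots> \<le> r powr real_of_int j * ?m"
        using ek by (intro mult_left_mono powr_le_of_abs_le[OF r]) auto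
      finally show "(r powr e) powr real_of_int k \<le> r powr real_of_int j * ?m" .
      have "\<bar>real_of_int k\<bar> \<le> \<bar>real_of_int j / e\<bar> + 1"
        using k by linarith
      then have "1 + \<bar>real_of_int k\<bar> \<le> 2 + 1 / e * \<bar>real_of_int j\<bar>"
        using e by simp
      also have "\<dots> \<le> (2 + 1 / e) * (1 + \<bar>real_of_int j\<bar>)"
        using e by (simp add: algebra_simps)
      finally show "1 + \<bar>real_of_int k\<bar> \<le> (2 + 1 / e) * (1 + \<bar>real_of_int j\<bar>)" .
    qed (use M C D(1) in auto)
    finally show "norm (zpow A j *v x)
        \<le> (M * C * D * ?m * (2 + 1 / e) ^ d) * r powr real_of_int j * (1 + \<bar>real_of_int j\<bar>) ^ d"
      by (simp add: power_mult_distrib mult_ac)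
  qed
qed

lemma dim_growth_reindex:
  fixes A B S :: "complex^'n^'n"
  assumes A: "invertible A" and S: "invertible S" and e: "0 < e" and r: "0 < r" and C: "0 \<le> C"
    and le1: "\<And>k x. norm (zpow B k *v x) \<le> C * norm (zpow A \<lfloor>e * real_of_int k\<rfloor> *v (S *v x))"
    and le2: "\<And>k x. norm (zpow A \<lfloor>e * real_of_int k\<rfloor> *v (S *v x)) \<le> C * norm (zpow B k *v x)"
  shows "vec.dim (growth B (r powr e) d) = vec.dim (growth A r d)"
proof -
  have "(*v) S ` growth B (r powr e) d = growth A r d"
  proof (intro subset_antisym subsetI)
    fix z assume "z \<in> (*v) S ` growth B (r powr e) d"
    then obtain x where "x \<in> growth B (r powr e) d" "z = S *v x" by blast
    then show "z \<in> growth A r d"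
      using growth_reindex_converse[OF A e r C le2] by blast
  next
    fix z assume z: "z \<in> growth A r d"
    have Sz: "S *v (matrix_inv S *v z) = z"
      by (rule matrix_inv_vec(1)[OF S])
    have "matrix_inv S *v z \<in> growth B (r powr e) d"
      by (rule growth_reindex[OF e r C le1]) (simp only: Sz z)
    then show "z \<in> (*v) S ` growth B (r powr e) d"
      using Sz by (metis image_eqI)
  qed
  moreover have "inj_on ((*v) S) (vec.span (growth B (r powr e) d))"
    by (rule inj_on_subset[OF inj_matrix_vector_mult[OF S]]) simp
  ultimately show ?thesis
    using vec.dim_image_eq[OF matrix_vector_mul_linear_gen, of S "growth B (r powr e) d"] by simp
qed

lemma gker_eq_0:
  assumes "c \<notin> eigvals A"
  shows "gker A c m = {0}"
proof -
  have "v = 0" if "v \<in> gker A c m" for v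
    using assms eigvalsI[of v A c] geigI[OF that] by blast
  then show ?thesis
    using zero_in_gker[of A c m] by blast
qed

text \<open>With positive eigenvalues only, a circle carries at most one of them, so the growth
  spaces determine each single kernel dimension.\<close>

lemma dim_gker_positive:
  fixes X :: "complex^'n^'n"
  assumes X: "invertible X" and pos: "\<And>c. c \<in> eigvals X \<Longrightarrow> c = complex_of_real (cmod c)"
  shows "vec.dim (gker X c (Suc d))
    = (if c \<noteq> 0 \<and> c = complex_of_real (cmod c) then vec.dim (growth X (cmod c) d) else 0)"
proof (cases "c \<in> eigvals X")
  case True
  then have c: "c \<noteq> 0" "c = complex_of_real (cmod c)"
    using pos eigvals_nonzero[OF X] by blast+
  have "{b \<in> eigvals X. cmod b = cmod c} = {c}"
    using True pos c(2) by (auto, metis)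
  then show ?thesis
    using c dim_growth[OF X, of "cmod c" d] by simp
next
  case False
  have "vec.dim (growth X (cmod c) d) = 0" if "c \<noteq> 0" "c = complex_of_real (cmod c)"
  proof -
    have "{b \<in> eigvals X. cmod b = cmod c} = {}"
      using False pos that(2) by (auto, metis)
    then have "vec.dim (growth X (cmod c) d) = (\<Sum>b\<in>{}. vec.dim (gker X b (Suc d)))"
      using that(1) dim_growth[OF X, of "cmod c" d] by (simp only: zero_less_norm_iff simp_thms)
    then show ?thesis by simp
  qed
  then show ?thesis
    using gker_eq_0[OF False] by simp
qed

section \<open>Determinants: size, inverses and real combinations\<close>

lemma det_zpow:
  fixes A :: "real^'n^'n"
  assumes "invertible A"
  shows "\<bar>det (zpow A k)\<bar> = \<bar>det A\<bar> powr real_of_int k"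
proof -
  have A: "det A \<noteq> 0"
    using assms by (simp add: invertible_det_nz)
  have S: "zpow A (i + 1) = A ** zpow A i" for i
    by (simp add: matrix_eq zpow_Suc[OF assms] matrix_vector_mul_assoc)
  have p: "\<bar>det A\<bar> powr real_of_int (i + 1) = \<bar>det A\<bar> * \<bar>det A\<bar> powr real_of_int i" for i
    using A by (simp add: powr_add)
  show ?thesis
  proof (induction k rule: int_induct[of _ 0])
    case (step1 i)
    then show ?case
      by (simp add: S det_mul abs_mult p del: of_int_add)
  next
    case (step2 i)
    then have "\<bar>det A\<bar> * \<bar>det (zpow A (i - 1))\<bar> = \<bar>det A\<bar> * \<bar>det A\<bar> powr real_of_int (i - 1)"
      using S[of "i - 1"] p[of "i - 1"] by (simp add: det_mul abs_mult)
    then show ?case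
      using A by simp
  qed (use A in simp)
qed

lemma det_le:
  fixes M :: "real^'n^'n"
  assumes "\<And>i j. \<bar>M $ i $ j\<bar> \<le> B"
  shows "\<bar>det M\<bar> \<le> fact CARD('n) * B ^ CARD('n)"
proof -
  have B: "0 \<le> B"
    using assms[of undefined undefined] by linarith
  have "\<bar>det M\<bar> \<le> (\<Sum>p | p permutes (UNIV :: 'n set). B ^ CARD('n))"
    unfolding det_def
  proof (rule order_trans[OF sum_abs sum_mono])
    fix p assume "p \<in> {p. p permutes (UNIV :: 'n set)}"
    have "\<bar>\<Prod>i\<in>UNIV. M $ i $ p i\<bar> \<le> (\<Prod>i\<in>(UNIV :: 'n set). B)"
      unfolding abs_prod using assms by (intro prod_mono) auto
    moreover have "\<bar>real_of_int (sign p)\<bar> = 1"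
      by (simp add: sign_def)
    ultimately show "\<bar>of_int (sign p) * (\<Prod>i\<in>UNIV. M $ i $ p i)\<bar> \<le> B ^ CARD('n)"
      by (simp add: abs_mult)
  qed
  also have "\<dots> = fact CARD('n) * B ^ CARD('n)"
    using card_permutations[of "UNIV :: 'n set" "CARD('n)"] by simp
  finally show ?thesis .
qed

lemma matrix_entry_le:
  fixes M :: "real^'n^'n"
  assumes "\<And>x. norm (M *v x) \<le> B * norm x"
  shows "\<bar>M $ i $ j\<bar> \<le> B"
proof -
  have "M $ i $ j = (M *v axis j 1) $ i"
    by (simp add: matrix_vector_mult_basis column_def)
  then have "\<bar>M $ i $ j\<bar> \<le> norm (M *v axis j 1)"
    by (metis component_le_norm_cart)
  then show ?thesis
    using assms[of "axis j 1"] by simp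
qed

text \<open>After scaling, \<open>M z\<close> is a unit vector, and Cramer's rule writes every entry
  of \<open>z\<close> as a determinant with bounded entries divided by \<open>det M\<close>.\<close>

lemma inverse_bounded_by_det:
  fixes B \<eta> :: real
  assumes \<eta>: "0 < \<eta>"
  obtains C where "0 < C"
    and "\<And>(M :: real^'n^'n) y. (\<forall>x. norm (M *v x) \<le> B * norm x) \<Longrightarrow> \<eta> \<le> \<bar>det M\<bar> \<Longrightarrow> norm y \<le> C * norm (M *v y)"
proof -
  \<comment> \<open>The column replaced in Cramer's rule is a unit vector, with entries up to 1; the
    other entries are bounded by \<open>B\<close>.\<close>
  define b where "b = max 1 B"
  define C where "C = real CARD('n) * (fact CARD('n) * b ^ CARD('n) / \<eta>)"
  have b: "1 \<le> b" "B \<le> b" "0 < b"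
    by (auto simp: b_def)
  have C0: "0 < C"
    using \<eta> b(3) by (auto simp: C_def intro!: mult_pos_pos divide_pos_pos)
  have "norm y \<le> C * norm (M *v y)"
    if M: "\<forall>x. norm (M *v x) \<le> B * norm x" and det: "\<eta> \<le> \<bar>det M\<bar>" for M :: "real^'n^'n" and y
  proof -
    have d0: "det M \<noteq> 0"
      using det \<eta> by auto
    show ?thesis
    proof (cases "M *v y = 0")
      case True
      have "M *v 0 = M *v y" using True by simp
      then have "y = 0"
        using inj_matrix_vector_mult[of M] d0 by (metis inj_def invertible_det_nz)
      then show ?thesis by simp
    next
      case False
      define s where "s = norm (M *v y)"
      have s: "0 < s"
        using False by (simp add: s_def)
      define z where "z = (1 / s) *\<^sub>R y"
      have Mz: "norm (M *v z) = 1"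
        using s by (simp add: z_def matrix_vector_mult_scaleR s_def)
      have comp: "\<bar>z $ k\<bar> \<le> fact CARD('n) * b ^ CARD('n) / \<eta>" for k
      proof -
        let ?N = "\<chi> i j. if j = k then (M *v z) $ i else M $ i $ j"
        have "\<bar>?N $ i $ j\<bar> \<le> b" for i j
        proof (cases "j = k")
          case True
          then show ?thesis
            using component_le_norm_cart[of "M *v z" i] Mz b(1) by simp
        next
          case False
          then show ?thesis
            using matrix_entry_le[of M B i j] M b(2) by simp
        qed
        then have 1: "\<bar>det ?N\<bar> \<le> fact CARD('n) * b ^ CARD('n)"
          by (rule det_le)
        have "z = (\<chi> k. det (\<chi> i j. if j = k then (M *v z) $ i else M $ i $ j) / det M)"
          using cramer[OF d0, of z "M *v z"] by blast
        then have "z $ k = (\<chi> k. det (\<chi> i j. if j = k then (M *v z) $ i else M $ i $ j) / det M) $ k"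
          by (rule arg_cong)
        then have "z $ k = det ?N / det M"
          by (simp only: vec_lambda_beta)
        then have "\<bar>z $ k\<bar> = \<bar>det ?N\<bar> / \<bar>det M\<bar>"
          by (simp only: abs_divide)
        also have "\<dots> \<le> fact CARD('n) * b ^ CARD('n) / \<eta>"
          using 1 det \<eta> by (intro frac_le) auto
        finally show ?thesis .
      qed
      have "norm z \<le> (\<Sum>k\<in>UNIV. \<bar>z $ k\<bar>)"
        by (rule norm_le_l1_cart)
      also have "\<dots> \<le> C"
        using sum_mono[of UNIV "\<lambda>k. \<bar>z $ k\<bar>" "\<lambda>_. fact CARD('n) * b ^ CARD('n) / \<eta>"] comp
        by (simp add: C_def)
      finally have "norm y / s \<le> C"
        using s by (simp add: z_def)
      then show ?thesis
        using s by (simp add: s_def field_simps)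
    qed
  qed
  with C0 show ?thesis
    using that by blast
qed

lemma det_poly_eval:
  fixes M :: "'a::{comm_ring_1} poly^'n^'n"
  shows "poly (det M) z = det (\<chi> i j. poly (M $ i $ j) z)"
  by (simp add: det_def poly_sum poly_prod)

text \<open>\<open>det (P + z Q)\<close> is a polynomial in \<open>z\<close> that does not vanish at
  the imaginary unit, so it has finitely many roots and some real number is not among them.\<close>

lemma real_invertible_combination:
  fixes P Q :: "real^'n^'n"
  assumes "det (\<chi> i j. complex_of_real (P $ i $ j) + \<i> * complex_of_real (Q $ i $ j)) \<noteq> 0"
  obtains t where "invertible (P + t *\<^sub>R Q)"
proof -
  let ?M = "\<chi> i j. [:complex_of_real (P $ i $ j), complex_of_real (Q $ i $ j):]"
  have "poly (det ?M) \<i> \<noteq> 0"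
    using assms by (simp add: det_poly_eval)
  then have "finite {z. poly (det ?M) z = 0}"
    by (intro poly_roots_finite) auto
  moreover have "infinite (range complex_of_real)"
    using finite_imageD[of complex_of_real UNIV] infinite_UNIV_char_0[where 'a = real]
    by (auto simp: inj_of_real)
  ultimately have "\<not> range complex_of_real \<subseteq> {z. poly (det ?M) z = 0}"
    using finite_subset by blast
  then obtain t where "poly (det ?M) (complex_of_real t) \<noteq> 0"
    by blast
  then have "det (\<chi> i j. complex_of_real ((P + t *\<^sub>R Q) $ i $ j)) \<noteq> 0"
    by (simp add: det_poly_eval)
  moreover have "det (\<chi> i j. complex_of_real ((P + t *\<^sub>R Q) $ i $ j)) = complex_of_real (det (P + t *\<^sub>R Q))"
    by (simp add: det_def)
  ultimately show ?thesis
    by (intro that[of t]) (simp add: invertible_det_nz)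
qed

section \<open>Dilations and quasi-norms\<close>

lemma polynomial_times_geometric_tendsto_0:
  fixes x :: real
  assumes "0 < x" and "x < 1"
  shows "(\<lambda>n. (1 + real n) ^ p * x ^ n) \<longlonglongrightarrow> 0"
proof -
  \<comment> \<open>Of the \<open>p + 1\<close> factors \<open>y^n\<close> of \<open>x^n\<close>,
    \<open>p\<close> are spent on the factors \<open>1 + n\<close> and one is left to tend to
    0.\<close>
  define y where "y = root (Suc p) x"
  have y: "0 < y" "y < 1" "y ^ Suc p = x"
    using assms by (simp_all add: y_def real_root_lt_1_iff del: power_Suc)
  have y0: "(\<lambda>n. y ^ n) \<longlonglongrightarrow> 0"
    using y by (intro LIMSEQ_realpow_zero) auto
  have "(\<lambda>n. real n * y ^ n) \<longlonglongrightarrow> 0"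
    using powser_times_n_limit_0[of y] y by simp
  from tendsto_add[OF y0 this] have y1: "(\<lambda>n. (1 + real n) * y ^ n) \<longlonglongrightarrow> 0"
    by (simp add: algebra_simps)
  have "(1 + real n) ^ p * x ^ n = ((1 + real n) * y ^ n) ^ p * y ^ n" for n
  proof -
    have "x ^ n = (y ^ n) ^ p * y ^ n"
      unfolding y(3)[symmetric] power_Suc2 power_mult_distrib
      by (simp only: power_mult[symmetric] mult.commute)
    then show ?thesis
      by (simp only: power_mult_distrib mult.assoc)
  qed
  moreover have "(\<lambda>n. ((1 + real n) * y ^ n) ^ p * y ^ n) \<longlonglongrightarrow> 0 ^ p * 0"
    by (intro tendsto_mult tendsto_power y0 y1)
  ultimately show ?thesis by simp
qed

text \<open>On a generalized eigenspace \<open>A^(-k)\<close> is bounded by a polynomial in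
  \<open>k\<close> times \<open>|c|^(-k)\<close>, and \<open>|c| > 1\<close>. The threshold
  \<open>1 / (2 D)\<close> compensates for the constant lost in passing to the whole space.\<close>

lemma dilation_contraction:
  fixes A :: "real^'n^'n"
  assumes A: "dilation A"
  shows "\<exists>K>0. \<forall>x. norm (zpow A (- int K) *v x) \<le> norm x / 2"
proof -
  let ?A = "complexify A"
  let ?E = "eigvals ?A"
  note inv = dilation_invertible[OF A]
  obtain D where D: "0 < D" and D': "\<forall>(f :: complex^'n \<Rightarrow> complex^'n) B x.
      lin f \<longrightarrow> 0 \<le> B \<longrightarrow> (\<forall>c\<in>?E. \<forall>x\<in>geig ?A c. norm (f x) \<le> B * norm x)
      \<longrightarrow> norm (f x) \<le> D * B * norm x"
    using bounded_on_geig[of ?A] by (elim exE conjE)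
  obtain K0 where K0: "2 \<le> K0" "\<And>c. c \<in> ?E \<Longrightarrow> geig ?A c = gker ?A c K0"
    using geig_uniform_exponent by blast
  then obtain p where p: "K0 = Suc p"
    by (cases K0) auto
  have "\<exists>C>0. \<forall>t v. norm (bflow ?A c (Suc p) t v) \<le> C * (1 + cmod t) ^ p * norm v" for c
    by (rule bflow_bound[of ?A c p]) blast
  then obtain C where C: "\<And>c. 0 < C c"
      "\<And>c t v. norm (bflow ?A c (Suc p) t v) \<le> C c * (1 + cmod t) ^ p * norm v"
    by metis
  have ev: "\<forall>\<^sub>F k in sequentially. \<forall>c\<in>?E. C c * ((1 + real k) ^ p * inverse (cmod c) ^ k) < 1 / (2 * D)"
  proof (intro eventually_ball_finite finite_eigvals ballI)
    fix c assume "c \<in> ?E"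
    then have "1 < cmod c"
      by (rule dilation_eigvals[OF A])
    then have "0 < inverse (cmod c)" "inverse (cmod c) < 1"
      by (auto simp: inverse_less_1_iff intro: less_trans[of _ 1])
    then have "(\<lambda>k. C c * ((1 + real k) ^ p * inverse (cmod c) ^ k)) \<longlonglongrightarrow> C c * 0"
      by (intro tendsto_mult_left polynomial_times_geometric_tendsto_0)
    moreover have "C c * 0 < 1 / (2 * D)"
      using D by simp
    ultimately show "\<forall>\<^sub>F k in sequentially. C c * ((1 + real k) ^ p * inverse (cmod c) ^ k) < 1 / (2 * D)"
      by (rule order_tendstoD(2))
  qed
  have "\<forall>\<^sub>F k in sequentially. 0 < k \<and> (\<forall>c\<in>?E. C c * ((1 + real k) ^ p * inverse (cmod c) ^ k) < 1 / (2 * D))"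
    by (intro eventually_conj ev eventually_gt_at_top)
  from eventually_happens'[OF sequentially_bot this] obtain k where k: "0 < k"
      "\<And>c. c \<in> ?E \<Longrightarrow> C c * ((1 + real k) ^ p * inverse (cmod c) ^ k) < 1 / (2 * D)"
    by blast
  have "norm (zpow ?A (- int k) *v v) \<le> D * (1 / (2 * D)) * norm v" for v
  proof (rule D'[rule_format, OF matrix_vector_mul_linear_gen])
    show "0 \<le> 1 / (2 * D)" using D by simp
    fix c x assume cx: "c \<in> ?E" "x \<in> geig ?A c"
    then have xK: "x \<in> gker ?A c K0"
      using K0(2) by blast
    have c0: "c \<noteq> 0"
      by (rule eigvals_nonzero[OF inv(2) cx(1)])
    have "norm (zpow ?A (- int k) *v x)
        = cmod (c powi (- int k)) * norm (bflow ?A c K0 (complex_of_int (- int k)) x)"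
      unfolding zpow_gker[OF inv(2) c0 K0(1) xK] by (rule norm_smult_complex)
    also have "cmod (c powi (- int k)) = inverse (cmod c) ^ k"
      by (simp add: power_int_minus norm_inverse norm_power power_inverse)
    also have "inverse (cmod c) ^ k * norm (bflow ?A c K0 (complex_of_int (- int k)) x)
        \<le> inverse (cmod c) ^ k * (C c * (1 + real k) ^ p * norm x)"
      using C(2)[of c "complex_of_int (- int k)" x] unfolding p by (intro mult_left_mono) auto
    also have "\<dots> = C c * ((1 + real k) ^ p * inverse (cmod c) ^ k) * norm x"
      by (simp only: mult_ac)
    also have "\<dots> \<le> 1 / (2 * D) * norm x"
      using k(2)[OF cx(1)] by (intro mult_right_mono) auto
    finally show "norm (zpow ?A (- int k) *v x) \<le> 1 / (2 * D) * norm x" .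
  qed
  from this[of "cvec _"] have "norm (zpow A (- int k) *v x) \<le> norm x / 2" for x
    using D by (simp add: zpow_complexify_cvec[OF inv] norm_cvec)
  with k(1) show ?thesis
    by (intro exI[of _ k] conjI allI)
qed

lemma zpow_mult_Suc:
  fixes A :: "'a::field^'n^'n"
  assumes "invertible A"
  shows "zpow A (m * int (Suc i)) *v x = zpow A m *v (zpow A (m * int i) *v x)"
  using zpow_add[OF assms, of m "m * int i" x] by (simp add: algebra_simps)

lemma zpow_iterate_bound:
  fixes A :: "real^'n^'n"
  assumes A: "invertible A" and b: "0 \<le> b" and le: "\<And>x. norm (zpow A m *v x) \<le> b * norm x"
  shows "norm (zpow A (m * int i) *v x) \<le> b ^ i * norm x"
proof (induction i)
  case (Suc i)
  have "norm (zpow A (m * int (Suc i)) *v x) \<le> b * norm (zpow A (m * int i) *v x)"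
    unfolding zpow_mult_Suc[OF A] by (rule le)
  also have "\<dots> \<le> b * (b ^ i * norm x)"
    by (intro mult_left_mono Suc b)
  finally show ?case
    by (simp add: mult.assoc)
qed simp

text \<open>Iterating the contraction makes the entries of a negative power, and with them its
  determinant, arbitrarily small; if \<open>|det A| \<le> 1\<close>, that determinant would be at
  least 1 in modulus.\<close>

lemma dilation_det:
  fixes A :: "real^'n^'n"
  assumes A: "dilation A"
  shows "1 < \<bar>det A\<bar>"
proof (rule ccontr)
  assume neg: "\<not> 1 < \<bar>det A\<bar>"
  note inv = dilation_invertible(1)[OF A]
  have d0: "0 < \<bar>det A\<bar>"
    using inv by (simp add: invertible_det_nz)
  obtain K where K': "0 < K \<and> (\<forall>x. norm (zpow A (- int K) *v x) \<le> norm x / 2)"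
    using dilation_contraction[OF A] ..
  note K = K'[THEN conjunct2, rule_format]
  have n: "0 < CARD('n)" by simp
  obtain j where j: "fact CARD('n) < (2::real) ^ j"
    using real_arch_pow[of 2 "fact CARD('n)"] by auto
  have "norm (zpow A (- int K * int j) *v x) \<le> (1 / 2) ^ j * norm x" for x
    by (rule zpow_iterate_bound[OF inv]) (use K in auto)
  then have "\<bar>det (zpow A (- int K * int j))\<bar> \<le> fact CARD('n) * ((1 / 2) ^ j) ^ CARD('n)"
    by (intro det_le matrix_entry_le)
  also have "\<dots> \<le> fact CARD('n) * ((1 / 2) ^ j) ^ 1"
    using n by (intro mult_left_mono power_decreasing) (auto simp: power_le_one)
  also have "\<dots> < 1"
    using j by (simp add: power_one_over field_simps)
  finally have "\<bar>det A\<bar> powr real_of_int (- int K * int j) < 1"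
    by (simp only: det_zpow[OF inv])
  moreover have "\<bar>det A\<bar> powr 0 \<le> \<bar>det A\<bar> powr real_of_int (- int K * int j)"
    using neg d0 by (intro powr_mono') auto
  ultimately show False
    using d0 by simp
qed

section \<open>Comparison of a quasi-norm with the Euclidean norm\<close>

lemma quasi_norm_zpow:
  fixes A :: "real^'n^'n"
  assumes A: "invertible A" and q: "quasi_norm A \<rho>"
  shows "\<rho> (zpow A k *v x) = \<bar>det A\<bar> powr real_of_int k * \<rho> x"
proof -
  have d: "0 < \<bar>det A\<bar>"
    using A by (simp add: invertible_det_nz)
  have S: "\<rho> (zpow A (i + 1) *v x) = \<bar>det A\<bar> * \<rho> (zpow A i *v x)" for i
    using q by (simp add: zpow_Suc[OF A] quasi_norm_def)
  have p: "\<bar>det A\<bar> powr real_of_int (i + 1) = \<bar>det A\<bar> * \<bar>det A\<bar> powr real_of_int i" for i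
    using d by (simp add: powr_add)
  show ?thesis
  proof (induction k rule: int_induct[of _ 0])
    case (step1 i)
    then show ?case
      by (simp add: S p del: of_int_add)
  next
    case (step2 i)
    have "\<bar>det A\<bar> * \<rho> (zpow A (i - 1) *v x) = \<rho> (zpow A i *v x)"
      using S[of "i - 1"] by simp
    also have "\<dots> = \<bar>det A\<bar> * (\<bar>det A\<bar> powr real_of_int (i - 1) * \<rho> x)"
      using step2 p[of "i - 1"] by (simp only: diff_add_cancel mult.assoc)
    finally have eq: "\<bar>det A\<bar> * \<rho> (zpow A (i - 1) *v x)
        = \<bar>det A\<bar> * (\<bar>det A\<bar> powr real_of_int (i - 1) * \<rho> x)" .
    have "\<bar>det A\<bar> \<noteq> 0"
      using d by simp
    from mult_left_cancel[OF this] eq show ?case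
      by (rule iffD1)
  qed (use d in simp)
qed

text \<open>This takes the place of Steinhaus' theorem: measurable quasi-norms are locally bounded because
  \<open>E\<close> and \<open>x - E\<close> overlap for a sublevel set \<open>E\<close> of almost full measure in the ball.\<close>

lemma reflection_meets:
  fixes E :: "'a::euclidean_space set"
  assumes E: "E \<in> sets lebesgue" "E \<subseteq> ball 0 1"
    and big: "3 / 4 * measure lebesgue (ball (0::'a) 1) < measure lebesgue E"
    and \<delta>: "0 < \<delta>" "(1 + \<delta>) ^ DIM('a) \<le> 3 / 2" and x: "norm x < \<delta>"
  obtains y z where "y \<in> E" "z \<in> E" "x = y + z"
proof -
  define F where "F = (\<lambda>y. (- 1) *\<^sub>R y + x) ` E"
  have vol: "measure lebesgue (ball (0::'a) r) = unit_ball_vol DIM('a) * r ^ DIM('a)" if "0 \<le> r" for r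
    using content_ball[OF that, of "0::'a"] by simp
  have mF: "measure lebesgue F = measure lebesgue E"
    unfolding F_def by (subst measure_lebesgue_affine) simp
  have "0 < measure lebesgue E"
    using big by (rule le_less_trans[rotated]) simp
  \<comment> \<open>By convention \<open>measure\<close> is 0 on non-measurable sets, so positive
    measure already gives measurability.\<close>
  then have F: "F \<in> sets lebesgue"
    using measure_notin_sets[of F lebesgue] mF by force
  have "F \<subseteq> ball 0 (1 + \<delta>)"
  proof
    fix w assume "w \<in> F"
    then obtain y where "y \<in> E" "w = x - y"
      by (auto simp: F_def)
    then show "w \<in> ball 0 (1 + \<delta>)"
      using E(2) x norm_triangle_ineq4[of x y] by auto
  qed
  then have sub: "E \<union> F \<subseteq> ball 0 (1 + \<delta>)"
    using E(2) \<delta>(1) by auto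
  have fin: "S \<in> fmeasurable lebesgue" if "S \<in> sets lebesgue" "S \<subseteq> ball 0 (1 + \<delta>)" for S :: "'a set"
    using fmeasurableI2[OF lmeasurable_ball that(2,1)] .
  \<comment> \<open>If disjoint, the two sets would together exceed 3/2 of the unit ball's measure,
    while the ball of radius \<open>1 + \<delta>\<close> containing them has at most that.\<close>
  have "E \<inter> F \<noteq> {}"
  proof
    assume "E \<inter> F = {}"
    then have "F - E = F" by blast
    moreover have "measure lebesgue (E \<union> F) = measure lebesgue E + measure lebesgue (F - E)"
      using fin[OF E(1)] fin[OF F] sub by (intro measure_Un2) auto
    ultimately have "measure lebesgue (E \<union> F) = measure lebesgue E + measure lebesgue F"
      by simp
    moreover have "measure lebesgue (E \<union> F) \<le> measure lebesgue (ball (0::'a) (1 + \<delta>))"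
      using sub E(1) F by (intro measure_mono_fmeasurable) auto
    moreover have "measure lebesgue (ball (0::'a) (1 + \<delta>)) \<le> 3 / 2 * measure lebesgue (ball (0::'a) 1)"
    proof -
      have "unit_ball_vol DIM('a) * (1 + \<delta>) ^ DIM('a) \<le> unit_ball_vol DIM('a) * (3 / 2)"
        by (intro mult_left_mono \<delta>(2)) (simp add: less_imp_le)
      moreover have "measure lebesgue (ball (0::'a) (1 + \<delta>)) = unit_ball_vol DIM('a) * (1 + \<delta>) ^ DIM('a)"
        by (rule vol) (use \<delta>(1) in simp)
      moreover have "measure lebesgue (ball (0::'a) 1) = unit_ball_vol DIM('a)"
        using vol[of 1] by (simp only: power_one mult_1_right zero_le_one simp_thms)
      ultimately show ?thesis by linarith
    qed
    ultimately show False
      using mF big by linarith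
  qed
  then obtain y z where "y \<in> E" "z \<in> E" "y = - z + x"
    by (auto simp: F_def)
  then show ?thesis
    by (intro that[of y z]) auto
qed

text \<open>The sublevel sets \<open>E N\<close> exhaust the unit ball, so one of them has more than
  3/4 of its measure. Every small \<open>x\<close> is then a sum of two of its points, and the
  quasi-triangle inequality applies.\<close>

lemma quasi_norm_bounded_near_0:
  fixes A :: "real^'n^'n"
  assumes q: "quasi_norm A \<rho>"
  shows "\<exists>\<delta> T. 0 < \<delta> \<and> (\<forall>x. norm x < \<delta> \<longrightarrow> \<rho> x \<le> T)"
proof -
  obtain c where c: "0 < c" "\<And>x y. \<rho> (x + y) \<le> c * (\<rho> x + \<rho> y)"
    using q by (auto simp: quasi_norm_def)
  define B where "B = ball (0::real^'n) 1"
  define E where "E = (\<lambda>N::nat. {x \<in> B. \<rho> x \<le> real N})"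
  have Es: "E N \<in> sets lebesgue" for N
  proof -
    have "{x. \<rho> x \<in> {..real N}} \<in> sets lebesgue"
      using q by (intro lebesgue_measurable_vimage_borel) (auto simp: quasi_norm_def)
    then have "B \<inter> {x. \<rho> x \<in> {..real N}} \<in> sets lebesgue"
      unfolding B_def by (intro sets.Int) auto
    also have "B \<inter> {x. \<rho> x \<in> {..real N}} = E N"
      by (auto simp: E_def)
    finally show ?thesis .
  qed
  have UE: "(\<Union>N. E N) = B"
    using real_arch_simple by (auto simp: E_def)
  have "(\<lambda>N. measure lebesgue (E N)) \<longlonglongrightarrow> measure lebesgue (\<Union>N. E N)"
  proof (rule Lim_measure_incseq)
    show "incseq E"
      unfolding incseq_def E_def by auto
    show "emeasure lebesgue (\<Union>N. E N) \<noteq> \<infinity>"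
      unfolding UE B_def using lmeasurable_ball[of "0::real^'n" 1] by (auto simp: fmeasurable_def)
  qed (use Es in auto)
  moreover have "3 / 4 * measure lebesgue B < measure lebesgue B"
  proof -
    have "0 < measure lebesgue B"
      using content_ball[of 1 "0::real^'n"] by (simp add: B_def)
    then show ?thesis by simp
  qed
  ultimately have "\<forall>\<^sub>F N in sequentially. 3 / 4 * measure lebesgue B < measure lebesgue (E N)"
    unfolding UE by (intro order_tendstoD(1))
  then obtain N where N: "3 / 4 * measure lebesgue B < measure lebesgue (E N)"
    unfolding eventually_sequentially by blast
  \<comment> \<open>Solves \<open>(1 + \<delta>)^n = 3 / 2\<close> for the dimension
    \<open>n\<close>.\<close>
  define \<delta> where "\<delta> = root DIM(real^'n) (3 / 2) - 1"
  have D: "0 < DIM(real^'n)" by (rule DIM_positive)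
  then have "1 < root DIM(real^'n) (3 / 2)"
    by (subst real_root_gt_1_iff) auto
  then have \<delta>: "0 < \<delta>"
    by (simp add: \<delta>_def)
  have \<delta>': "(1 + \<delta>) ^ DIM(real^'n) \<le> 3 / 2"
    unfolding \<delta>_def using real_root_pow_pos2[OF D, of "3 / 2"] by (simp del: DIM_cart)
  have "\<rho> x \<le> c * (real N + real N)" if x: "norm x < \<delta>" for x
  proof -
    have "E N \<subseteq> ball 0 1"
      by (auto simp: E_def B_def)
    then obtain y z where yz: "y \<in> E N" "z \<in> E N" "x = y + z"
      by (rule reflection_meets[OF Es _ N[unfolded B_def] \<delta> \<delta>' x])
    have "\<rho> x \<le> c * (\<rho> y + \<rho> z)"
      unfolding yz(3) by (rule c(2))
    also have "\<dots> \<le> c * (real N + real N)"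
      using yz c(1) by (intro mult_left_mono add_mono) (auto simp: E_def)
    finally show ?thesis .
  qed
  with \<delta> show ?thesis
    by (intro exI conjI allI impI)
qed

text \<open>A fixed negative power of \<open>A\<close> shrinks the ball into the neighbourhood of 0
  where the bound is known; undoing it multiplies the quasi-norm by a fixed factor.\<close>

lemma quasi_norm_bounded:
  fixes A :: "real^'n^'n"
  assumes A: "dilation A" and q: "quasi_norm A \<rho>"
  shows "\<exists>T. \<forall>x. norm x \<le> R \<longrightarrow> \<rho> x \<le> T"
proof -
  note inv = dilation_invertible(1)[OF A]
  obtain \<delta> T where \<delta>': "0 < \<delta> \<and> (\<forall>x. norm x < \<delta> \<longrightarrow> \<rho> x \<le> T)"
    using quasi_norm_bounded_near_0[OF q] by (elim exE)
  note \<delta> = \<delta>'[THEN conjunct1] \<delta>'[THEN conjunct2, rule_format]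
  obtain K where K': "0 < K \<and> (\<forall>x. norm (zpow A (- int K) *v x) \<le> norm x / 2)"
    using dilation_contraction[OF A] ..
  note K = K'[THEN conjunct2, rule_format]
  obtain i where i: "R / \<delta> < 2 ^ i"
    using real_arch_pow[of 2 "R / \<delta>"] by auto
  have "\<rho> x \<le> \<bar>det A\<bar> powr real_of_int (int K * int i) * T" if "norm x \<le> R" for x
  proof -
    have "norm (zpow A (- int K * int i) *v x) \<le> (1 / 2) ^ i * norm x"
      by (rule zpow_iterate_bound[OF inv]) (use K in auto)
    also have "\<dots> \<le> (1 / 2) ^ i * R"
      using that by (intro mult_left_mono) auto
    also have "\<dots> < \<delta>"
      using i \<delta>(1) by (simp add: power_one_over field_simps)
    finally have "\<rho> (zpow A (- int K * int i) *v x) \<le> T"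
      by (rule \<delta>(2))
    moreover have "\<rho> x = \<bar>det A\<bar> powr real_of_int (int K * int i) * \<rho> (zpow A (- int K * int i) *v x)"
      using quasi_norm_zpow[OF inv q, of "int K * int i" "zpow A (- int K * int i) *v x"]
        zpow_minus(2)[OF inv, of "int K * int i" x] by simp
    ultimately show ?thesis
      by (simp add: mult_left_mono)
  qed
  then show ?thesis by blast
qed

text \<open>If \<open>A^i x\<close> still lies where the quasi-norm is at most \<open>T\<close>,
  then \<open>x\<close> has quasi-norm at most \<open>T / |det A|^i\<close>, which is below
  \<open>e\<close> for large \<open>i\<close>.\<close>

lemma quasi_norm_small_near_0:
  fixes A :: "real^'n^'n"
  assumes A: "dilation A" and q: "quasi_norm A \<rho>" and e: "0 < e"
  shows "\<exists>\<delta>>0. \<forall>x. norm x < \<delta> \<longrightarrow> \<rho> x < e"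
proof -
  note inv = dilation_invertible(1)[OF A]
  note d = dilation_det[OF A]
  obtain \<delta> T where \<delta>': "0 < \<delta> \<and> (\<forall>x. norm x < \<delta> \<longrightarrow> \<rho> x \<le> T)"
    using quasi_norm_bounded_near_0[OF q] by (elim exE)
  note \<delta> = \<delta>'[THEN conjunct1] \<delta>'[THEN conjunct2, rule_format]
  obtain i where i: "T / e < \<bar>det A\<bar> ^ i"
    using real_arch_pow[OF d, of "T / e"] by auto
  have "\<exists>b>0. \<forall>x. norm (zpow A (int i) *v x) \<le> norm x * b"
    by (rule bounded_linear.pos_bounded[OF matrix_vector_mul_bounded_linear])
  then obtain b where b': "0 < b \<and> (\<forall>x. norm (zpow A (int i) *v x) \<le> norm x * b)" ..
  note b = b'[THEN conjunct1] b'[THEN conjunct2, rule_format]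
  have "\<rho> x < e" if "norm x < \<delta> / b" for x
  proof -
    have "norm (zpow A (int i) *v x) < \<delta>"
      using b that by (intro le_less_trans[OF b(2)]) (simp add: field_simps)
    then have "\<rho> (zpow A (int i) *v x) \<le> T"
      by (rule \<delta>(2))
    moreover have "\<rho> (zpow A (int i) *v x) = \<bar>det A\<bar> ^ i * \<rho> x"
      using quasi_norm_zpow[OF inv q, of "int i" x] d by (simp add: powr_realpow)
    moreover have "T < \<bar>det A\<bar> ^ i * e"
      using i e by (simp add: field_simps)
    ultimately have "\<bar>det A\<bar> ^ i * \<rho> x < \<bar>det A\<bar> ^ i * e"
      by linarith
    then show ?thesis
      using d by (simp add: mult_less_cancel_left)
  qed
  then show ?thesis
    using \<delta>(1) b(1) by (intro exI[of _ "\<delta> / b"]) auto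
qed

text \<open>Compactness without continuity: if quasi-norms along a convergent sequence tend to 0,
  the quasi-triangle inequality and smallness near 0 force the quasi-norm of the limit to vanish,
  although the limit has norm at least 1.\<close>

lemma quasi_norm_bounded_below:
  fixes A :: "real^'n^'n"
  assumes A: "dilation A" and q: "quasi_norm A \<rho>"
  shows "\<exists>\<eta>>0. \<forall>x. 1 \<le> norm x \<and> norm x \<le> L \<longrightarrow> \<eta> \<le> \<rho> x"
proof (rule ccontr)
  assume neg: "\<not> ?thesis"
  have "\<exists>x. (1 \<le> norm x \<and> norm x \<le> L) \<and> \<rho> x < inverse (real (Suc n))" for n
    using neg by (metis inverse_positive_iff_positive not_le of_nat_0_less_iff zero_less_Suc)
  then obtain y where y: "\<And>n. 1 \<le> norm (y n) \<and> norm (y n) \<le> L" "\<And>n. \<rho> (y n) < inverse (real (Suc n))"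
    by metis
  have "compact {x::real^'n. 1 \<le> norm x \<and> norm x \<le> L}"
  proof (rule compact_Int_closed[of "cball 0 L" "{x. 1 \<le> norm x}", THEN back_subst[of compact]])
    show "closed {x::real^'n. 1 \<le> norm x}"
      by (intro closed_Collect_le continuous_intros)
  qed auto
  then have "seq_compact {x::real^'n. 1 \<le> norm x \<and> norm x \<le> L}"
    by (rule compact_imp_seq_compact)
  then obtain l r where l: "1 \<le> norm l" "strict_mono r" "(y \<circ> r) \<longlonglongrightarrow> l"
    using y(1) by (auto elim!: seq_compactE[where f = y])
  obtain c where c: "0 < c" "\<And>x y. \<rho> (x + y) \<le> c * (\<rho> x + \<rho> y)"
    using q by (auto simp: quasi_norm_def)
  have "l \<noteq> 0"
    using l(1) by auto
  then have "0 < \<rho> l"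
    using q by (metis less_eq_real_def quasi_norm_def)
  \<comment> \<open>Chosen so that \<open>c * (e + e)\<close> is exactly the quasi-norm of the
    limit.\<close>
  define e where "e = \<rho> l / (2 * c)"
  have e: "0 < e"
    using \<open>0 < \<rho> l\<close> c(1) by (simp add: e_def)
  obtain \<delta> where \<delta>': "0 < \<delta> \<and> (\<forall>x. norm x < \<delta> \<longrightarrow> \<rho> x < e)"
    using quasi_norm_small_near_0[OF A q e] ..
  note \<delta> = \<delta>'[THEN conjunct1] \<delta>'[THEN conjunct2, rule_format]
  have "\<forall>\<^sub>F n in sequentially. dist ((y \<circ> r) n) l < \<delta>"
    using l(3) \<delta>(1) by (rule tendstoD)
  moreover have "\<forall>\<^sub>F n in sequentially. inverse (real (Suc n)) < e"
    using LIMSEQ_inverse_real_of_nat e by (rule order_tendstoD(2))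
  ultimately have "\<forall>\<^sub>F n in sequentially. dist ((y \<circ> r) n) l < \<delta> \<and> inverse (real (Suc n)) < e"
    by (rule eventually_conj)
  then obtain n where n: "dist (y (r n)) l < \<delta>" "inverse (real (Suc n)) < e"
    unfolding eventually_sequentially by auto
  have "inverse (real (Suc (r n))) \<le> inverse (real (Suc n))"
    using seq_suble[OF l(2), of n] by (intro le_imp_inverse_le) auto
  then have "\<rho> (y (r n)) < e"
    using y(2)[of "r n"] n(2) by linarith
  moreover have "\<rho> (l - y (r n)) < e"
    using n(1) by (intro \<delta>(2)) (simp add: dist_norm norm_minus_commute)
  ultimately have "\<rho> (y (r n)) + \<rho> (l - y (r n)) < 2 * e"
    by linarith
  then have "c * (\<rho> (y (r n)) + \<rho> (l - y (r n))) < c * (2 * e)"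
    using c(1) by (rule mult_strict_left_mono)
  moreover have "\<rho> l \<le> c * (\<rho> (y (r n)) + \<rho> (l - y (r n)))"
    using c(2)[of "y (r n)" "l - y (r n)"] by simp
  moreover have "c * (2 * e) = \<rho> l"
    using c(1) by (simp add: e_def)
  ultimately show False by linarith
qed

text \<open>Contract \<open>x\<close> until it first enters the unit ball. The iterate just before
  lies in the shell \<open>1 \<le> norm z \<le> b\<close>, where the quasi-norm is at least \<eta>.
  Each step divides the quasi-norm by \<open>D\<close>, so the bound \<open>T\<close> limits the
  number of steps, and hence the norm of \<open>x\<close>.\<close>

lemma quasi_norm_sublevel_bounded:
  fixes A :: "real^'n^'n"
  assumes A: "dilation A" and q: "quasi_norm A \<rho>"
  shows "\<exists>R. \<forall>x. \<rho> x \<le> T \<longrightarrow> norm x \<le> R"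
proof -
  note inv = dilation_invertible(1)[OF A]
  note d = dilation_det[OF A]
  obtain K where K': "0 < K \<and> (\<forall>x. norm (zpow A (- int K) *v x) \<le> norm x / 2)"
    using dilation_contraction[OF A] ..
  note K = K'[THEN conjunct1] K'[THEN conjunct2, rule_format]
  have "\<exists>b>0. \<forall>x. norm (zpow A (int K) *v x) \<le> norm x * b"
    by (rule bounded_linear.pos_bounded[OF matrix_vector_mul_bounded_linear])
  then obtain b0 where b0': "0 < b0 \<and> (\<forall>x. norm (zpow A (int K) *v x) \<le> norm x * b0)" ..
  note b0 = b0'[THEN conjunct1] b0'[THEN conjunct2, rule_format]
  define b where "b = max 1 b0"
  have b: "1 \<le> b" "\<And>x. norm (zpow A (int K) *v x) \<le> b * norm x"
  proof -
    show "norm (zpow A (int K) *v x) \<le> b * norm x" for x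
      using order_trans[OF b0(2)[of x] mult_left_mono[of b0 b "norm x"]]
      by (simp add: b_def mult.commute)
  qed (simp add: b_def)
  obtain \<eta> where \<eta>: "0 < \<eta>" "\<And>x. 1 \<le> norm x \<Longrightarrow> norm x \<le> b \<Longrightarrow> \<eta> \<le> \<rho> x"
    using quasi_norm_bounded_below[OF A q, of b] by blast
  define D where "D = \<bar>det A\<bar> ^ K"
  have D: "1 < D"
    unfolding D_def using d K(1) by (rule one_less_power)
  obtain m where m: "T / \<eta> < D ^ m"
    using real_arch_pow[OF D] by blast
  have "norm x \<le> b ^ Suc m" if xT: "\<rho> x \<le> T" for x
  proof (cases "norm x < 1")
    case True
    then show ?thesis
      using one_le_power[OF b(1), of "Suc m"] by linarith
  next
    case False
    let ?z = "\<lambda>i. zpow A (- int K * int i) *v x"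
    obtain i0 where "norm x < 2 ^ i0"
      using real_arch_pow[of 2 "norm x"] by auto
    moreover have "norm (?z i0) \<le> (1 / 2) ^ i0 * norm x"
      by (rule zpow_iterate_bound[OF inv]) (use K in auto)
    moreover have "(1 / 2) ^ i0 * (2::real) ^ i0 = 1"
      by (simp flip: power_mult_distrib)
    ultimately have "norm (?z i0) < 1"
      using mult_strict_left_mono[of "norm x" "2 ^ i0" "(1 / 2) ^ i0"] by simp
    moreover have "\<not> norm (?z 0) < 1"
      using False by simp
    ultimately obtain i where i: "\<not> norm (?z i) < 1" "norm (?z (Suc i)) < 1"
      using ex_least_nat_less[of "\<lambda>i. norm (?z i) < 1" i0] by blast
    have "?z i = zpow A (int K) *v (?z (Suc i))"
      unfolding zpow_mult_Suc[OF inv] by (simp only: zpow_minus(2)[OF inv])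
    then have "norm (?z i) \<le> b * norm (?z (Suc i))"
      using b(2)[of "?z (Suc i)"] by (simp only:)
    also have "\<dots> \<le> b * 1"
      using i(2) b(1) by (intro mult_left_mono) auto
    finally have zb: "norm (?z i) \<le> b"
      by simp
    then have "\<eta> \<le> \<rho> (?z i)"
      using i(1) by (intro \<eta>(2)) auto
    have x: "x = zpow A (int K * int i) *v ?z i"
      using zpow_minus(2)[OF inv, of "int K * int i" x] by simp
    have "\<rho> x = D ^ i * \<rho> (?z i)"
    proof -
      have "\<bar>det A\<bar> powr real_of_int (int K * int i) = \<bar>det A\<bar> powr real (K * i)"
        by simp
      also have "\<dots> = D ^ i"
        using d by (simp only: powr_realpow D_def power_mult)
      finally show ?thesis
        using quasi_norm_zpow[OF inv q, of "int K * int i" "?z i"] x by simp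
    qed
    moreover have "D ^ i * \<eta> \<le> D ^ i * \<rho> (?z i)"
      using \<open>\<eta> \<le> \<rho> (?z i)\<close> D by (intro mult_left_mono) auto
    ultimately have "D ^ i * \<eta> \<le> T"
      using xT by linarith
    moreover have "T < D ^ m * \<eta>"
      using m \<eta>(1) by (simp only: pos_divide_less_eq)
    ultimately have "D ^ i * \<eta> < D ^ m * \<eta>"
      by linarith
    then have "D ^ i < D ^ m"
      using \<eta>(1) by (simp only: mult_less_cancel_right_pos)
    then have "i < m"
      by (rule power_less_imp_less_exp[OF D])
    have "norm x = norm (zpow A (int K * int i) *v ?z i)"
      by (rule arg_cong[OF x])
    also have "\<dots> \<le> b ^ i * norm (?z i)"
      by (rule zpow_iterate_bound[OF inv _ b(2)]) (use b(1) in linarith)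
    also have "\<dots> \<le> b ^ i * b"
      using zb b(1) by (intro mult_left_mono) auto
    also have "\<dots> \<le> b ^ Suc m"
      using power_increasing[of "Suc i" "Suc m" b] \<open>i < m\<close> b(1) by (simp add: mult.commute)
    finally show ?thesis .
  qed
  then show ?thesis by blast
qed

section \<open>Comparison of two dilations\<close>

lemma quasi_norm_nonneg: "quasi_norm A \<rho> \<Longrightarrow> 0 \<le> \<rho> x"
  by (simp add: quasi_norm_def)

lemma quasi_norm_eq_0_iff: "quasi_norm A \<rho> \<Longrightarrow> \<rho> x = 0 \<longleftrightarrow> x = 0"
  by (simp add: quasi_norm_def)

text \<open>A quasi-norm need not be homogeneous under scalars, but matrices are: rescaling
  \<open>x\<close> makes the \<open>A\<close>-side a unit vector, where \<rho> is at most
  \<open>t\<close>. The determinant factors turn this into a bound for \<sigma> on the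
  \<open>B\<close>-side, and sublevel sets of \<sigma> are bounded. The slots \<open>P\<close> and
  \<open>Q\<close> let one statement serve both directions.\<close>

lemma orbit_bound_of_quasi_norm_bound:
  fixes A B P Q :: "real^'n^'n" and a b :: "int \<Rightarrow> int"
  assumes A: "dilation A" "quasi_norm A \<rho>" and B: "dilation B" "quasi_norm B \<sigma>"
    and c: "0 \<le> c" "\<And>x. \<sigma> (Q *v x) \<le> c * \<rho> (P *v x)"
    and c': "0 \<le> c'" "\<And>k. \<bar>det B\<bar> powr real_of_int (b k) \<le> c' * \<bar>det A\<bar> powr real_of_int (a k)"
  shows "\<exists>C\<ge>0. \<forall>k x. norm (zpow B (b k) *v (Q *v x)) \<le> C * norm (zpow A (a k) *v (P *v x))"
proof -
  note iA = dilation_invertible(1)[OF A(1)] and iB = dilation_invertible(1)[OF B(1)]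
  note \<rho>0 = quasi_norm_nonneg[OF A(2)] quasi_norm_eq_0_iff[OF A(2)]
    and \<sigma>0 = quasi_norm_nonneg[OF B(2)] quasi_norm_eq_0_iff[OF B(2)]
  obtain t where t: "\<forall>x. norm x \<le> 1 \<longrightarrow> \<rho> x \<le> t"
    using quasi_norm_bounded[OF A, of 1] ..
  obtain R where R: "\<forall>x. \<sigma> x \<le> c' * c * t \<longrightarrow> norm x \<le> R"
    using quasi_norm_sublevel_bounded[OF B, of "c' * c * t"] ..
  have "norm (zpow B (b k) *v (Q *v x)) \<le> max 0 R * norm (zpow A (a k) *v (P *v x))" for k x
  proof (cases "zpow A (a k) *v (P *v x) = 0")
    case True
    then have "P *v x = 0"
      using zpow_minus(1)[OF iA, of "a k" "P *v x"] by simp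
    then have "\<sigma> (Q *v x) = 0"
      using c(2)[of x] \<rho>0(2)[of "P *v x"] \<sigma>0(1)[of "Q *v x"] by simp
    then have "Q *v x = 0"
      using \<sigma>0(2) by simp
    then show ?thesis by simp
  next
    case False
    define s where "s = norm (zpow A (a k) *v (P *v x))"
    have s: "0 < s"
      using False by (simp add: s_def)
    define x' where "x' = (1 / s) *\<^sub>R x"
    have n1: "zpow A (a k) *v (P *v x') = (1 / s) *\<^sub>R (zpow A (a k) *v (P *v x))"
      and n2: "zpow B (b k) *v (Q *v x') = (1 / s) *\<^sub>R (zpow B (b k) *v (Q *v x))"
      by (simp_all only: x'_def matrix_vector_mult_scaleR)
    have "norm (zpow A (a k) *v (P *v x')) = 1"
      using s unfolding n1 by (simp add: s_def)
    then have r: "\<rho> (zpow A (a k) *v (P *v x')) \<le> t"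
      using t by simp
    have "\<sigma> (zpow B (b k) *v (Q *v x')) = \<bar>det B\<bar> powr real_of_int (b k) * \<sigma> (Q *v x')"
      by (rule quasi_norm_zpow[OF iB B(2)])
    also have "\<dots> \<le> (c' * \<bar>det A\<bar> powr real_of_int (a k)) * (c * \<rho> (P *v x'))"
      using c c' \<sigma>0 by (intro mult_mono) auto
    also have "\<dots> = c' * c * \<rho> (zpow A (a k) *v (P *v x'))"
      unfolding quasi_norm_zpow[OF iA A(2)] by (simp only: mult_ac)
    also have "\<dots> \<le> c' * c * t"
      using c(1) c'(1) r by (intro mult_left_mono) auto
    finally have "norm (zpow B (b k) *v (Q *v x')) \<le> R"
      using R by blast
    then have "norm (zpow B (b k) *v (Q *v x)) / s \<le> max 0 R"
      using s unfolding n2 by simp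
    then show ?thesis
      using s by (simp only: s_def pos_divide_le_eq)
  qed
  then show ?thesis
    by (intro exI[of _ "max 0 R"]) auto
qed

text \<open>The hypothesis \<open>dense\<close> provides, for each \<open>x\<close>, a
  \<open>k\<close> that moves \<open>P x\<close> to where \<rho> lies between 1 and
  \<open>M\<close>. There Euclidean norms, and through the orbit bound also \<sigma>, are bounded;
  the lower bound 1 turns the resulting constant into a multiple of \<rho>.\<close>

lemma quasi_norm_bound_of_orbit_bound:
  fixes A B P Q :: "real^'n^'n" and a b :: "int \<Rightarrow> int"
  assumes A: "dilation A" "quasi_norm A \<rho>" and B: "dilation B" "quasi_norm B \<sigma>"
    and C: "0 \<le> C" "\<And>k x. norm (zpow B (b k) *v (Q *v x)) \<le> C * norm (zpow A (a k) *v (P *v x))"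
    and dense: "\<And>s. 0 < s \<Longrightarrow>
      \<exists>k. 1 \<le> \<bar>det A\<bar> powr real_of_int (a k) * s \<and> \<bar>det A\<bar> powr real_of_int (a k) * s \<le> M"
    and c': "0 \<le> c'" "\<And>k. \<bar>det A\<bar> powr real_of_int (a k) \<le> c' * \<bar>det B\<bar> powr real_of_int (b k)"
  shows "\<exists>c\<ge>0. \<forall>x. \<sigma> (Q *v x) \<le> c * \<rho> (P *v x)"
proof -
  note iA = dilation_invertible(1)[OF A(1)] and iB = dilation_invertible(1)[OF B(1)]
  note \<rho>0 = quasi_norm_nonneg[OF A(2)] quasi_norm_eq_0_iff[OF A(2)]
    and \<sigma>0 = quasi_norm_nonneg[OF B(2)] quasi_norm_eq_0_iff[OF B(2)]
  obtain R where R: "\<forall>x. \<rho> x \<le> M \<longrightarrow> norm x \<le> R"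
    using quasi_norm_sublevel_bounded[OF A, of M] ..
  obtain t where t: "\<forall>x. norm x \<le> C * max 0 R \<longrightarrow> \<sigma> x \<le> t"
    using quasi_norm_bounded[OF B, of "C * max 0 R"] ..
  have "0 \<le> t"
    using t[rule_format, of 0] C(1) \<sigma>0(1)[of 0] by simp
  have "\<sigma> (Q *v x) \<le> (c' * t) * \<rho> (P *v x)" for x
  proof (cases "P *v x = 0")
    case True
    then have "norm (zpow B (b 0) *v (Q *v x)) \<le> 0"
      using C(2)[of 0 x] by simp
    then have "Q *v x = 0"
      using zpow_minus(1)[OF iB, of "b 0" "Q *v x"] by simp
    then show ?thesis
      using \<sigma>0(2)[of 0] \<rho>0(2)[of 0] True by simp
  next
    case False
    then have s: "0 < \<rho> (P *v x)"
      using \<rho>0[of "P *v x"] by linarith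
    then obtain k where k: "1 \<le> \<bar>det A\<bar> powr real_of_int (a k) * \<rho> (P *v x)"
        "\<bar>det A\<bar> powr real_of_int (a k) * \<rho> (P *v x) \<le> M"
      using dense by blast
    let ?e = "\<bar>det B\<bar> powr real_of_int (b k)"
    have "norm (zpow A (a k) *v (P *v x)) \<le> R"
      using R k(2) quasi_norm_zpow[OF iA A(2), of "a k" "P *v x"] by simp
    then have "C * norm (zpow A (a k) *v (P *v x)) \<le> C * max 0 R"
      using C(1) by (intro mult_left_mono) auto
    with C(2)[of k x] have "\<sigma> (zpow B (b k) *v (Q *v x)) \<le> t"
      using t order_trans by blast
    then have et: "?e * \<sigma> (Q *v x) \<le> t"
      unfolding quasi_norm_zpow[OF iB B(2)] .
    have "\<bar>det A\<bar> powr real_of_int (a k) * \<rho> (P *v x) \<le> (c' * ?e) * \<rho> (P *v x)"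
      using c'(2)[of k] s by (intro mult_right_mono) auto
    with k(1) have "1 \<le> (c' * ?e) * \<rho> (P *v x)"
      by linarith
    then have "\<sigma> (Q *v x) * 1 \<le> \<sigma> (Q *v x) * ((c' * ?e) * \<rho> (P *v x))"
      using \<sigma>0(1) by (intro mult_left_mono)
    also have "\<dots> = (c' * \<rho> (P *v x)) * (?e * \<sigma> (Q *v x))"
      by (simp only: mult_ac)
    also have "\<dots> \<le> (c' * \<rho> (P *v x)) * t"
      using c'(1) \<rho>0(1) by (intro mult_left_mono et) auto
    finally show ?thesis
      by (simp only: mult_1_right mult_ac)
  qed
  then show ?thesis
    using c'(1) \<open>0 \<le> t\<close> by (intro exI[of _ "c' * t"]) auto
qed

lemma powr_int_dense:
  fixes d :: real
  assumes d: "1 < d" and L: "0 < L" and s: "0 < s"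
  shows "\<exists>k::int. L \<le> d powr real_of_int k * s \<and> d powr real_of_int k * s \<le> L * d"
proof -
  define k where "k = \<lceil>log d (L / s)\<rceil>"
  have k: "log d (L / s) \<le> real_of_int k" "real_of_int k \<le> log d (L / s) + 1"
    unfolding k_def by linarith+
  have p: "d powr log d (L / s) = L / s"
    using d L s by simp
  have "L / s \<le> d powr real_of_int k"
    using powr_mono[OF k(1), of d] d p by simp
  moreover have "d powr real_of_int k \<le> L / s * d"
    using powr_mono[OF k(2), of d] d p by (simp add: powr_add)
  ultimately show ?thesis
    using s by (intro exI[of _ k]) (simp add: field_simps)
qed

context
  fixes A\<^sub>1 A\<^sub>2 :: "real^'n^'n" and \<epsilon> :: real
  assumes dil: "dilation A\<^sub>1" "dilation A\<^sub>2"
    and eps: "\<epsilon> = ln \<bar>det A\<^sub>1\<bar> / ln \<bar>det A\<^sub>2\<bar>"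
begin

lemma eps_pos: "0 < \<epsilon>"
  using dilation_det[OF dil(1)] dilation_det[OF dil(2)] by (simp add: eps)

text \<open>The reason for the value of \<epsilon>; with its positivity, this is all that the later
  arguments use of it.\<close>

lemma det_powr_eps: "\<bar>det A\<^sub>2\<bar> powr (\<epsilon> * x) = \<bar>det A\<^sub>1\<bar> powr x"
proof -
  have "1 < \<bar>det A\<^sub>1\<bar>" "1 < \<bar>det A\<^sub>2\<bar>" "det A\<^sub>1 \<noteq> 0" "det A\<^sub>2 \<noteq> 0"
    using dilation_det[OF dil(1)] dilation_det[OF dil(2)] by auto
  then show ?thesis
    by (simp add: eps powr_def)
qed

lemma det_floor_le: "\<bar>det A\<^sub>2\<bar> powr real_of_int \<lfloor>\<epsilon> * real_of_int k\<rfloor> \<le> \<bar>det A\<^sub>1\<bar> powr real_of_int k"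
  unfolding det_powr_eps[symmetric] using dilation_det[OF dil(2)]
  by (intro powr_mono) auto

lemma det_le_floor:
  "\<bar>det A\<^sub>1\<bar> powr real_of_int k \<le> \<bar>det A\<^sub>2\<bar> * \<bar>det A\<^sub>2\<bar> powr real_of_int \<lfloor>\<epsilon> * real_of_int k\<rfloor>"
proof -
  have "\<bar>det A\<^sub>2\<bar> powr (\<epsilon> * real_of_int k) \<le> \<bar>det A\<^sub>2\<bar> powr (1 + real_of_int \<lfloor>\<epsilon> * real_of_int k\<rfloor>)"
    using dilation_det[OF dil(2)] by (intro powr_mono) (linarith, simp)
  then show ?thesis
    using dilation_det[OF dil(2)] by (simp add: det_powr_eps powr_add)
qed

lemma dense_1:
  assumes "0 < s"
  shows "\<exists>k. 1 \<le> \<bar>det A\<^sub>1\<bar> powr real_of_int k * s \<and> \<bar>det A\<^sub>1\<bar> powr real_of_int k * s \<le> \<bar>det A\<^sub>1\<bar>"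
  using powr_int_dense[OF dilation_det[OF dil(1)] zero_less_one assms] by simp

lemma dense_2:
  assumes s: "0 < s"
  shows "\<exists>k. 1 \<le> \<bar>det A\<^sub>2\<bar> powr real_of_int \<lfloor>\<epsilon> * real_of_int k\<rfloor> * s \<and>
    \<bar>det A\<^sub>2\<bar> powr real_of_int \<lfloor>\<epsilon> * real_of_int k\<rfloor> * s \<le> \<bar>det A\<^sub>2\<bar> * \<bar>det A\<^sub>1\<bar>"
proof -
  have d: "0 < \<bar>det A\<^sub>2\<bar>"
    using dilation_det[OF dil(2)] by simp
  \<comment> \<open>The window starts at \<open>|det A\<^sub>2|\<close> instead of 1 because
    rounding down can lose that factor.\<close>
  obtain k :: int where k: "\<bar>det A\<^sub>2\<bar> \<le> \<bar>det A\<^sub>1\<bar> powr real_of_int k * s"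
      "\<bar>det A\<^sub>1\<bar> powr real_of_int k * s \<le> \<bar>det A\<^sub>2\<bar> * \<bar>det A\<^sub>1\<bar>"
    using powr_int_dense[OF dilation_det[OF dil(1)] d s] by blast
  let ?f = "\<bar>det A\<^sub>2\<bar> powr real_of_int \<lfloor>\<epsilon> * real_of_int k\<rfloor>"
  have "?f * s \<le> \<bar>det A\<^sub>1\<bar> powr real_of_int k * s"
    using det_floor_le s by (intro mult_right_mono) auto
  moreover have "\<bar>det A\<^sub>1\<bar> powr real_of_int k * s \<le> \<bar>det A\<^sub>2\<bar> * ?f * s"
    using det_le_floor s by (intro mult_right_mono) auto
  then have "\<bar>det A\<^sub>2\<bar> * 1 \<le> \<bar>det A\<^sub>2\<bar> * (?f * s)"
    using k(1) by simp
  then have "1 \<le> ?f * s"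
    using d by (simp only: mult_le_cancel_left_pos)
  ultimately show ?thesis
    using k(2) by (intro exI[of _ k]) linarith
qed

theorem equivalent_iff_orbits_comparable:
  assumes q: "quasi_norm A\<^sub>1 \<rho>\<^sub>1" "quasi_norm A\<^sub>2 \<rho>\<^sub>2"
  shows "equivalent_up_to_linear \<rho>\<^sub>1 \<rho>\<^sub>2 \<longleftrightarrow>
    (\<exists>C\<ge>0. \<exists>S :: real^'n^'n. invertible S \<and> (\<forall>k x.
      norm (zpow A\<^sub>1 k *v x) \<le> C * norm (zpow A\<^sub>2 \<lfloor>\<epsilon> * real_of_int k\<rfloor> *v (S *v x)) \<and>
      norm (zpow A\<^sub>2 \<lfloor>\<epsilon> * real_of_int k\<rfloor> *v (S *v x)) \<le> C * norm (zpow A\<^sub>1 k *v x)))"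
    (is "_ \<longleftrightarrow> (\<exists>C\<ge>0. \<exists>S. invertible S \<and> (\<forall>k x. ?L C S k x \<and> ?R C S k x))")
proof
  assume "equivalent_up_to_linear \<rho>\<^sub>1 \<rho>\<^sub>2"
  then obtain c S where c: "0 < c" and S: "invertible S"
    and le: "\<And>x. 1 / c * \<rho>\<^sub>1 x \<le> \<rho>\<^sub>2 (S *v x)" "\<And>x. \<rho>\<^sub>2 (S *v x) \<le> c * \<rho>\<^sub>1 x"
    by (auto simp: equivalent_up_to_linear_def)
  have le1: "\<rho>\<^sub>1 (mat 1 *v x) \<le> c * \<rho>\<^sub>2 (S *v x)" for x
    using le(1)[of x] c by (simp add: field_simps)
  have le2: "\<rho>\<^sub>2 (S *v x) \<le> c * \<rho>\<^sub>1 (mat 1 *v x)" for x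
    using le(2)[of x] by simp
  have "\<exists>C\<ge>0. \<forall>k x. norm (zpow A\<^sub>1 k *v (mat 1 *v x))
      \<le> C * norm (zpow A\<^sub>2 \<lfloor>\<epsilon> * real_of_int k\<rfloor> *v (S *v x))"
    by (rule orbit_bound_of_quasi_norm_bound[OF dil(2) q(2) dil(1) q(1) _ le1 _ det_le_floor])
      (use c in auto)
  then obtain C where C: "0 \<le> C" "\<And>k x. ?L C S k x"
    by auto
  have "\<exists>C\<ge>0. \<forall>k x. norm (zpow A\<^sub>2 \<lfloor>\<epsilon> * real_of_int k\<rfloor> *v (S *v x))
      \<le> C * norm (zpow A\<^sub>1 k *v (mat 1 *v x))"
    by (rule orbit_bound_of_quasi_norm_bound[OF dil(1) q(1) dil(2) q(2) _ le2, of 1])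
      (use c det_floor_le in auto)
  then obtain D where D: "0 \<le> D" "\<And>k x. ?R D S k x"
    by auto
  have "?L (C + D) S k x \<and> ?R (C + D) S k x" for k x
  proof
    show "?L (C + D) S k x"
      by (rule order_trans[OF C(2)]) (use D(1) in \<open>auto intro!: mult_right_mono\<close>)
    show "?R (C + D) S k x"
      by (rule order_trans[OF D(2)]) (use C(1) in \<open>auto intro!: mult_right_mono\<close>)
  qed
  then show "\<exists>C\<ge>0. \<exists>S. invertible S \<and> (\<forall>k x. ?L C S k x \<and> ?R C S k x)"
    using S C(1) D(1) by (intro exI[of _ "C + D"] conjI exI[of _ S]) auto
next
  assume "\<exists>C\<ge>0. \<exists>S. invertible S \<and> (\<forall>k x. ?L C S k x \<and> ?R C S k x)"
  then obtain C S where C: "0 \<le> C" and S: "invertible S"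
    and LR: "\<And>k x. ?L C S k x" "\<And>k x. ?R C S k x"
    by blast
  have L: "norm (zpow A\<^sub>1 k *v (mat 1 *v x)) \<le> C * norm (zpow A\<^sub>2 \<lfloor>\<epsilon> * real_of_int k\<rfloor> *v (S *v x))"
    and R: "norm (zpow A\<^sub>2 \<lfloor>\<epsilon> * real_of_int k\<rfloor> *v (S *v x)) \<le> C * norm (zpow A\<^sub>1 k *v (mat 1 *v x))" for k x
    using LR[of k x] by simp_all
  have fl: "\<bar>det A\<^sub>2\<bar> powr real_of_int \<lfloor>\<epsilon> * real_of_int k\<rfloor> \<le> 1 * \<bar>det A\<^sub>1\<bar> powr real_of_int k" for k
    using det_floor_le by simp
  have "\<exists>c\<ge>0. \<forall>x. \<rho>\<^sub>1 (mat 1 *v x) \<le> c * \<rho>\<^sub>2 (S *v x)"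
    by (rule quasi_norm_bound_of_orbit_bound[OF dil(2) q(2) dil(1) q(1) C L dense_2 zero_le_one fl])
  then obtain c where c: "0 \<le> c" "\<And>x. \<rho>\<^sub>1 x \<le> c * \<rho>\<^sub>2 (S *v x)"
    by auto
  have "\<exists>c\<ge>0. \<forall>x. \<rho>\<^sub>2 (S *v x) \<le> c * \<rho>\<^sub>1 (mat 1 *v x)"
    by (rule quasi_norm_bound_of_orbit_bound[OF dil(1) q(1) dil(2) q(2) C R dense_1 abs_ge_zero det_le_floor])
  then obtain d where d: "0 \<le> d" "\<And>x. \<rho>\<^sub>2 (S *v x) \<le> d * \<rho>\<^sub>1 x"
    by auto
  note nn = quasi_norm_nonneg[OF q(1)] quasi_norm_nonneg[OF q(2)]
  let ?c = "1 + c + d"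
  have "1 / ?c * \<rho>\<^sub>1 x \<le> \<rho>\<^sub>2 (S *v x) \<and> \<rho>\<^sub>2 (S *v x) \<le> ?c * \<rho>\<^sub>1 x" for x
  proof
    have "\<rho>\<^sub>1 x \<le> ?c * \<rho>\<^sub>2 (S *v x)"
      by (rule order_trans[OF c(2)]) (use nn d(1) in \<open>auto intro!: mult_right_mono\<close>)
    then show "1 / ?c * \<rho>\<^sub>1 x \<le> \<rho>\<^sub>2 (S *v x)"
      using c(1) d(1) by (simp add: divide_le_eq mult.commute)
    show "\<rho>\<^sub>2 (S *v x) \<le> ?c * \<rho>\<^sub>1 x"
      by (rule order_trans[OF d(2)]) (use nn c(1) in \<open>auto intro!: mult_right_mono\<close>)
  qed
  moreover have "0 < ?c"
    using c(1) d(1) by simp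
  ultimately show "equivalent_up_to_linear \<rho>\<^sub>1 \<rho>\<^sub>2"
    unfolding equivalent_up_to_linear_def using S by blast
qed

lemma sum_dim_ker_eq_of_orbits_comparable:
  fixes S :: "real^'n^'n"
  assumes C: "0 \<le> C" and S: "invertible S"
    and L: "\<And>k x. norm (zpow A\<^sub>1 k *v x) \<le> C * norm (zpow A\<^sub>2 \<lfloor>\<epsilon> * real_of_int k\<rfloor> *v (S *v x))"
    and R: "\<And>k x. norm (zpow A\<^sub>2 \<lfloor>\<epsilon> * real_of_int k\<rfloor> *v (S *v x)) \<le> C * norm (zpow A\<^sub>1 k *v x)"
    and r: "0 < r"
  shows "sum_dim_ker A\<^sub>1 (r powr \<epsilon>) (Suc d) = sum_dim_ker A\<^sub>2 r (Suc d)"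
proof -
  note i1 = dilation_invertible[OF dil(1)] and i2 = dilation_invertible[OF dil(2)]
  let ?S = "complexify S"
  have "v = 0" if v0: "?S *v v = 0" for v
  proof -
    have "vec_Re (0 :: complex^'n) = 0" "vec_Im (0 :: complex^'n) = 0"
      by (simp_all add: vec_Re_def vec_Im_def vec_eq_iff)
    then have "S *v vec_Re v = 0" "S *v vec_Im v = 0"
      using vec_Re_complexify[of S v] vec_Im_complexify[of S v] unfolding v0 by simp_all
    then have "vec_Re v = 0" "vec_Im v = 0"
      using matrix_inv_vec(2)[OF S, of "vec_Re v"] matrix_inv_vec(2)[OF S, of "vec_Im v"] by simp_all
    then show ?thesis
      using norm_le_Re_Im[of v] by simp
  qed
  then have iS: "invertible ?S"
    unfolding invertible_left_inverse matrix_left_invertible_ker by blast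
  let ?a = "\<lambda>k v. zpow (complexify A\<^sub>1) k *v v"
  let ?b = "\<lambda>k v. zpow (complexify A\<^sub>2) \<lfloor>\<epsilon> * real_of_int k\<rfloor> *v (?S *v v)"
  have Re: "vec_Re (?a k v) = zpow A\<^sub>1 k *v vec_Re v" "vec_Im (?a k v) = zpow A\<^sub>1 k *v vec_Im v"
    "vec_Re (?b k v) = zpow A\<^sub>2 \<lfloor>\<epsilon> * real_of_int k\<rfloor> *v (S *v vec_Re v)"
    "vec_Im (?b k v) = zpow A\<^sub>2 \<lfloor>\<epsilon> * real_of_int k\<rfloor> *v (S *v vec_Im v)" for k v
    by (simp_all add: zpow_complexify_Re_Im[OF i1] zpow_complexify_Re_Im[OF i2]
        vec_Re_complexify vec_Im_complexify)
  \<comment> \<open>Real and imaginary parts are estimated separately, which costs the factor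
    2.\<close>
  have le1: "norm (?a k v) \<le> 2 * C * norm (?b k v)" for k v
  proof -
    have "norm (?a k v) \<le> C * norm (vec_Re (?b k v)) + C * norm (vec_Im (?b k v))"
      using norm_le_Re_Im[of "?a k v"] L[of k "vec_Re v"] L[of k "vec_Im v"] unfolding Re by linarith
    also have "\<dots> \<le> C * norm (?b k v) + C * norm (?b k v)"
      using C by (intro add_mono mult_left_mono norm_vec_Re_le norm_vec_Im_le)
    finally show ?thesis by simp
  qed
  have le2: "norm (?b k v) \<le> 2 * C * norm (?a k v)" for k v
  proof -
    have "norm (?b k v) \<le> C * norm (vec_Re (?a k v)) + C * norm (vec_Im (?a k v))"
      using norm_le_Re_Im[of "?b k v"] R[of k "vec_Re v"] R[of k "vec_Im v"] unfolding Re by linarith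
    also have "\<dots> \<le> C * norm (?a k v) + C * norm (?a k v)"
      using C by (intro add_mono mult_left_mono norm_vec_Re_le norm_vec_Im_le)
    finally show ?thesis by simp
  qed
  have "vec.dim (growth (complexify A\<^sub>1) (r powr \<epsilon>) d) = vec.dim (growth (complexify A\<^sub>2) r d)"
    by (rule dim_growth_reindex[OF i2(2) iS eps_pos r _ le1 le2]) (use C in simp)
  then show ?thesis
    using r by (simp add: sum_dim_ker_eq_dim_growth[OF dil(1)] sum_dim_ker_eq_dim_growth[OF dil(2)])
qed

text \<open>\<open>X1\<close> and \<open>X2\<close> stand for \<open>|A\<^sub>1|\<close> and
  \<open>|A\<^sub>2|^\<epsilon>\<close>. Being positive with equal growth dimensions they are
  similar, and the similarity intertwines their integer powers exactly, so only the two comparison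
  constants and the norm of \<open>S\<close> enter the bound.\<close>

lemma complex_orbit_bound:
  assumes dims: "\<And>r m. 1 < r \<Longrightarrow> 1 \<le> m \<Longrightarrow> sum_dim_ker A\<^sub>1 (r powr \<epsilon>) m = sum_dim_ker A\<^sub>2 r m"
  shows "\<exists>C S. 0 \<le> C \<and> invertible S \<and> (\<forall>k v.
    norm (zpow (complexify A\<^sub>2) \<lfloor>\<epsilon> * real_of_int k\<rfloor> *v (S *v v)) \<le> C * norm (zpow (complexify A\<^sub>1) k *v v))"
proof -
  let ?A1 = "complexify A\<^sub>1" and ?A2 = "complexify A\<^sub>2"
  note i1 = dilation_invertible(2)[OF dil(1)] and i2 = dilation_invertible(2)[OF dil(2)]
  obtain X1 D1 where X1: "invertible X1" "\<And>c. c \<in> eigvals X1 \<Longrightarrow> c = complex_of_real (cmod c)" "0 < D1"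
    "\<And>k x. norm (zpow X1 k *v x) \<le> D1 * norm (zpow ?A1 \<lfloor>1 * real_of_int k\<rfloor> *v x)"
    "\<And>k x. norm (zpow ?A1 \<lfloor>1 * real_of_int k\<rfloor> *v x) \<le> D1 * norm (zpow X1 k *v x)"
    \<comment> \<open>The exponent 1 only strips the arguments of the eigenvalues; all rescaling
      happens on the side of the second matrix.\<close>
    using positive_matrix_power[OF i1, of 1] by metis
  obtain X2 D2 where X2: "invertible X2" "\<And>c. c \<in> eigvals X2 \<Longrightarrow> c = complex_of_real (cmod c)" "0 < D2"
    "\<And>k x. norm (zpow X2 k *v x) \<le> D2 * norm (zpow ?A2 \<lfloor>\<epsilon> * real_of_int k\<rfloor> *v x)"
    "\<And>k x. norm (zpow ?A2 \<lfloor>\<epsilon> * real_of_int k\<rfloor> *v x) \<le> D2 * norm (zpow X2 k *v x)"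
    using positive_matrix_power[OF i2, of \<epsilon>] by metis
  have im: "invertible (mat 1 :: complex^'n^'n)"
    unfolding invertible_def by (intro exI[of _ "mat 1"]) simp
  have g1: "vec.dim (growth X1 s d) = vec.dim (growth ?A1 s d)" if "0 < s" for s d
    using dim_growth_reindex[OF i1 im zero_less_one that, of D1 X1 d] X1(3-5) that by simp
  have g2: "vec.dim (growth X2 (r powr \<epsilon>) d) = vec.dim (growth ?A2 r d)" if "0 < r" for r d
    using dim_growth_reindex[OF i2 im eps_pos that, of D2 X2 d] X2(3-5) by simp
  have growth_eq: "vec.dim (growth X1 s d) = vec.dim (growth X2 s d)" if s: "0 < s" for s d
  proof -
    define r where "r = s powr (1 / \<epsilon>)"
    have r: "0 < r" "r powr \<epsilon> = s"
      using s eps_pos by (simp_all add: r_def powr_powr)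
    show ?thesis
    proof (cases "1 < r")
      case True
      have "vec.dim (growth ?A1 s d) = sum_dim_ker A\<^sub>1 (r powr \<epsilon>) (Suc d)"
        using sum_dim_ker_eq_dim_growth[OF dil(1) s, of d] r(2) by simp
      also have "\<dots> = sum_dim_ker A\<^sub>2 r (Suc d)"
        by (rule dims[OF True]) simp
      also have "\<dots> = vec.dim (growth ?A2 r d)"
        by (rule sum_dim_ker_eq_dim_growth[OF dil(2) r(1)])
      finally show ?thesis
        using g1[OF s] g2[OF r(1)] r(2) by simp
    next
      case False
      then have "r powr \<epsilon> \<le> 1 powr \<epsilon>"
        using r(1) eps_pos by (intro powr_mono2) auto
      then have "s \<le> 1"
        using r(2) by simp
      then have "vec.dim (growth ?A1 s d) = 0" "vec.dim (growth ?A2 r d) = 0"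
        using dim_growth_dilation_0[OF dil(1) s] dim_growth_dilation_0[OF dil(2) r(1)] False
        by (simp_all only: not_less)
      then show ?thesis
        using g1[OF s, of d] g2[OF r(1), of d] by (simp only: r(2))
    qed
  qed
  have "vec.dim (gker X1 c m) = vec.dim (gker X2 c m)" for c m
  proof (cases m)
    case 0
    then show ?thesis by (simp add: gker_0)
  next
    case (Suc d)
    then show ?thesis
      using growth_eq[of "cmod c" d]
      by (simp only: dim_gker_positive[OF X1(1,2)] dim_gker_positive[OF X2(1,2)] zero_less_norm_iff)
        simp
  qed
  from similar_of_dim_gker_eq[OF this]
  obtain S where S': "invertible S \<and> (\<forall>v. S *v (X1 *v v) = X2 *v (S *v v))" ..
  note S = S'[THEN conjunct1] S'[THEN conjunct2, rule_format]
  have SX: "zpow X2 k *v (S *v v) = S *v (zpow X1 k *v v)" for k v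
    using zpow_unique[OF X2(1), of "\<lambda>k. S *v (zpow X1 k *v v)" k]
    by (simp add: zpow_Suc[OF X1(1)] S(2))
  obtain b where b: "0 < b" "\<And>v. norm (S *v v) \<le> b * norm v"
    using matrix_bounded[of S] by metis
  have "norm (zpow ?A2 \<lfloor>\<epsilon> * real_of_int k\<rfloor> *v (S *v v)) \<le> (D2 * b * D1) * norm (zpow ?A1 k *v v)" for k v
  proof -
    have "norm (zpow ?A2 \<lfloor>\<epsilon> * real_of_int k\<rfloor> *v (S *v v)) \<le> D2 * norm (S *v (zpow X1 k *v v))"
      using X2(5)[of k "S *v v"] unfolding SX .
    also have "\<dots> \<le> D2 * (b * norm (zpow X1 k *v v))"
      using X2(3) by (intro mult_left_mono b(2)) auto
    also have "\<dots> \<le> D2 * (b * (D1 * norm (zpow ?A1 k *v v)))"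
      using X1(4)[of k v] X2(3) b(1) by (intro mult_left_mono) auto
    finally show ?thesis
      by (simp only: mult.assoc)
  qed
  then show ?thesis
    using S(1) X1(3) X2(3) b(1) by (intro exI[of _ "D2 * b * D1"] exI[of _ S]) auto
qed

lemma real_orbits_comparable:
  fixes S\<^sub>0 :: "complex^'n^'n"
  assumes C: "0 \<le> C" and S\<^sub>0: "invertible S\<^sub>0"
    and le: "\<And>k v. norm (zpow (complexify A\<^sub>2) \<lfloor>\<epsilon> * real_of_int k\<rfloor> *v (S\<^sub>0 *v v))
      \<le> C * norm (zpow (complexify A\<^sub>1) k *v v)"
  shows "\<exists>C\<ge>0. \<exists>S :: real^'n^'n. invertible S \<and> (\<forall>k x.
      norm (zpow A\<^sub>1 k *v x) \<le> C * norm (zpow A\<^sub>2 \<lfloor>\<epsilon> * real_of_int k\<rfloor> *v (S *v x)) \<and>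
      norm (zpow A\<^sub>2 \<lfloor>\<epsilon> * real_of_int k\<rfloor> *v (S *v x)) \<le> C * norm (zpow A\<^sub>1 k *v x))"
proof -
  note i1 = dilation_invertible[OF dil(1)] and i2 = dilation_invertible[OF dil(2)]
  define P where "P = (\<chi> i j. Re (S\<^sub>0 $ i $ j))"
  define Q where "Q = (\<chi> i j. Im (S\<^sub>0 $ i $ j))"
  have P: "vec_Re (S\<^sub>0 *v cvec x) = P *v x" and Q: "vec_Im (S\<^sub>0 *v cvec x) = Q *v x" for x
    by (simp_all add: P_def Q_def vec_Re_def vec_Im_def cvec_def matrix_vector_mult_def vec_eq_iff)
  have "(\<chi> i j. complex_of_real (P $ i $ j) + \<i> * complex_of_real (Q $ i $ j)) = S\<^sub>0"
    by (simp add: P_def Q_def vec_eq_iff complex_eq[symmetric])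
  then obtain t where S: "invertible (P + t *\<^sub>R Q)"
    using real_invertible_combination[of P Q] S\<^sub>0 by (metis invertible_det_nz)
  define S where "S = P + t *\<^sub>R Q"
  define D where "D = (1 + \<bar>t\<bar>) * C"
  have D: "0 \<le> D"
    using C by (simp add: D_def)
  let ?j = "\<lambda>k. \<lfloor>\<epsilon> * real_of_int k\<rfloor>"
  have R: "norm (zpow A\<^sub>2 (?j k) *v (S *v x)) \<le> D * norm (zpow A\<^sub>1 k *v x)" for k x
  proof -
    let ?v = "zpow (complexify A\<^sub>2) (?j k) *v (S\<^sub>0 *v cvec x)"
    have v: "norm ?v \<le> C * norm (zpow A\<^sub>1 k *v x)"
      using le[of k "cvec x"] by (simp only: zpow_complexify_cvec[OF i1] norm_cvec)
    have p: "zpow A\<^sub>2 (?j k) *v (P *v x) = vec_Re ?v" and q: "zpow A\<^sub>2 (?j k) *v (Q *v x) = vec_Im ?v"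
      by (simp_all only: zpow_complexify_Re_Im[OF i2] P Q)
    have "zpow A\<^sub>2 (?j k) *v (S *v x) = vec_Re ?v + t *\<^sub>R vec_Im ?v"
      unfolding p[symmetric] q[symmetric] S_def
      by (simp add: matrix_vector_mult_add_rdistrib matrix_vector_right_distrib
          scaleR_matrix_vector_assoc[symmetric] matrix_vector_mult_scaleR)
    then have "norm (zpow A\<^sub>2 (?j k) *v (S *v x)) \<le> norm (vec_Re ?v) + \<bar>t\<bar> * norm (vec_Im ?v)"
      by (metis norm_scaleR norm_triangle_ineq)
    also have "\<dots> \<le> norm ?v + \<bar>t\<bar> * norm ?v"
      by (intro add_mono mult_left_mono norm_vec_Re_le norm_vec_Im_le) simp
    also have "\<dots> = (1 + \<bar>t\<bar>) * norm ?v"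
      by (simp add: algebra_simps)
    also have "\<dots> \<le> (1 + \<bar>t\<bar>) * (C * norm (zpow A\<^sub>1 k *v x))"
      by (intro mult_left_mono v) simp
    finally show ?thesis
      by (simp only: D_def mult.assoc)
  qed
  \<comment> \<open>\<open>|det S|\<close> divided by the one factor \<open>|det A\<^sub>2|\<close>
    that rounding may lose: a lower bound for \<open>|det M|\<close> below, valid for every
    \<open>k\<close>.\<close>
  define \<eta> where "\<eta> = \<bar>det S\<bar> / \<bar>det A\<^sub>2\<bar>"
  have d2: "0 < \<bar>det A\<^sub>2\<bar>"
    using dilation_det[OF dil(2)] by simp
  have \<eta>: "0 < \<eta>"
    using S d2 by (simp add: \<eta>_def S_def invertible_det_nz)
  obtain E where E: "0 < E"
    "\<And>(M :: real^'n^'n) y. (\<forall>x. norm (M *v x) \<le> D * norm x) \<Longrightarrow> \<eta> \<le> \<bar>det M\<bar> \<Longrightarrow> norm y \<le> E * norm (M *v y)"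
    using inverse_bounded_by_det[OF \<eta>, of D] by metis
  have L: "norm (zpow A\<^sub>1 k *v x) \<le> E * norm (zpow A\<^sub>2 (?j k) *v (S *v x))" for k x
  proof -
    \<comment> \<open>The upper estimate with \<open>x\<close> replaced by
      \<open>A\<^sub>1^(-k) y\<close> says that \<open>M\<close> is bounded by \<open>D\<close> for
      every \<open>k\<close>, so the lower estimate is a bound for its inverse.\<close>
    define M where "M = zpow A\<^sub>2 (?j k) ** S ** zpow A\<^sub>1 (- k)"
    have Mv: "M *v y = zpow A\<^sub>2 (?j k) *v (S *v (zpow A\<^sub>1 (- k) *v y))" for y
      by (simp add: M_def matrix_vector_mul_assoc[symmetric])
    have "norm (M *v y) \<le> D * norm y" for y
      using R[of k "zpow A\<^sub>1 (- k) *v y"] by (simp only: Mv zpow_minus(2)[OF i1(1)])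
    moreover have "\<eta> \<le> \<bar>det M\<bar>"
    proof -
      have "\<bar>det M\<bar> = \<bar>det A\<^sub>2\<bar> powr real_of_int (?j k) * \<bar>det S\<bar> * \<bar>det A\<^sub>1\<bar> powr real_of_int (- k)"
        by (simp only: M_def det_mul abs_mult det_zpow[OF i1(1)] det_zpow[OF i2(1)])
      moreover have "\<bar>det A\<^sub>1\<bar> powr real_of_int k * \<bar>det A\<^sub>1\<bar> powr real_of_int (- k) = 1"
        using dilation_det[OF dil(1)] by (simp flip: powr_add)
      moreover have "\<bar>det A\<^sub>1\<bar> powr real_of_int k * (\<bar>det S\<bar> * \<bar>det A\<^sub>1\<bar> powr real_of_int (- k))
          \<le> \<bar>det A\<^sub>2\<bar> * \<bar>det A\<^sub>2\<bar> powr real_of_int (?j k) * (\<bar>det S\<bar> * \<bar>det A\<^sub>1\<bar> powr real_of_int (- k))"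
        by (intro mult_right_mono det_le_floor) simp
      ultimately have "\<bar>det S\<bar> \<le> \<bar>det M\<bar> * \<bar>det A\<^sub>2\<bar>"
        by (simp add: mult_ac)
      then show ?thesis
        using d2 by (simp only: \<eta>_def pos_divide_le_eq)
    qed
    ultimately have "norm (zpow A\<^sub>1 k *v x) \<le> E * norm (M *v (zpow A\<^sub>1 k *v x))"
      by (intro E(2)) auto
    then show ?thesis
      by (simp only: Mv zpow_minus(1)[OF i1(1)])
  qed
  show ?thesis
  proof (intro exI conjI allI)
    show "0 \<le> D + E" using D E(1) by simp
    show "invertible S" using S by (simp only: S_def)
    show "norm (zpow A\<^sub>1 k *v x) \<le> (D + E) * norm (zpow A\<^sub>2 (?j k) *v (S *v x))" for k x
      by (rule order_trans[OF L]) (use D in \<open>auto intro!: mult_right_mono\<close>)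
    show "norm (zpow A\<^sub>2 (?j k) *v (S *v x)) \<le> (D + E) * norm (zpow A\<^sub>1 k *v x)" for k x
      by (rule order_trans[OF R]) (use E(1) in \<open>auto intro!: mult_right_mono\<close>)
  qed
qed

end

theorem theorem4p2:
  fixes A\<^sub>1 A\<^sub>2 :: "real^'n^'n" and \<rho>\<^sub>1 \<rho>\<^sub>2 :: "real^'n \<Rightarrow> real" and \<epsilon> :: real
  assumes "dilation A\<^sub>1" and "dilation A\<^sub>2"
    and "quasi_norm A\<^sub>1 \<rho>\<^sub>1" and "quasi_norm A\<^sub>2 \<rho>\<^sub>2"
    and "\<epsilon> = ln \<bar>det A\<^sub>1\<bar> / ln \<bar>det A\<^sub>2\<bar>"
  shows "equivalent_up_to_linear \<rho>\<^sub>1 \<rho>\<^sub>2 \<longleftrightarrow>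
    (\<forall>r>1. \<forall>m\<ge>1. sum_dim_ker A\<^sub>1 (r powr \<epsilon>) m = sum_dim_ker A\<^sub>2 r m)"
proof
  assume "equivalent_up_to_linear \<rho>\<^sub>1 \<rho>\<^sub>2"
  then obtain C and S :: "real^'n^'n" where CS: "0 \<le> C" "invertible S"
    "\<And>k x. norm (zpow A\<^sub>1 k *v x) \<le> C * norm (zpow A\<^sub>2 \<lfloor>\<epsilon> * real_of_int k\<rfloor> *v (S *v x))"
    "\<And>k x. norm (zpow A\<^sub>2 \<lfloor>\<epsilon> * real_of_int k\<rfloor> *v (S *v x)) \<le> C * norm (zpow A\<^sub>1 k *v x)"
    unfolding equivalent_iff_orbits_comparable[OF assms(1,2,5,3,4)] by blast
  show "\<forall>r>1. \<forall>m\<ge>1. sum_dim_ker A\<^sub>1 (r powr \<epsilon>) m = sum_dim_ker A\<^sub>2 r m"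
  proof (intro allI impI)
    fix r :: real and m :: nat
    assume "1 < r" "1 \<le> m"
    \<comment> \<open>The kernel exponent \<open>m\<close> corresponds to the growth exponent
      \<open>d = m - 1\<close>.\<close>
    then obtain d where "m = Suc d" "0 < r"
      by (cases m) auto
    then show "sum_dim_ker A\<^sub>1 (r powr \<epsilon>) m = sum_dim_ker A\<^sub>2 r m"
      using sum_dim_ker_eq_of_orbits_comparable[OF assms(1,2,5) CS] by simp
  qed
next
  assume dims: "\<forall>r>1. \<forall>m\<ge>1. sum_dim_ker A\<^sub>1 (r powr \<epsilon>) m = sum_dim_ker A\<^sub>2 r m"
  obtain C S where "0 \<le> C" "invertible S" "\<And>k v.
    norm (zpow (complexify A\<^sub>2) \<lfloor>\<epsilon> * real_of_int k\<rfloor> *v (S *v v)) \<le> C * norm (zpow (complexify A\<^sub>1) k *v v)"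
    using complex_orbit_bound[OF assms(1,2,5)] dims by blast
  then show "equivalent_up_to_linear \<rho>\<^sub>1 \<rho>\<^sub>2"
    unfolding equivalent_iff_orbits_comparable[OF assms(1,2,5,3,4)]
    by (rule real_orbits_comparable[OF assms(1,2,5)])
qed

end
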